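(* Let $J\subseteq S$, let $M$ be a $k\Omega_J$-module and let $\mathrm{HY}_J^S(M)$ be the $k$-module $\bigoplus_{w\in D_J}M$. Denote elements of the $w$-component of $\mathrm{HY}_J^S(M)$ by $w|m$ ($m\in M$). Write $\mu_{x,z}^s=\sum_{-L(s)<\gamma<L(s)}\mu_{x,z}^{s,\gamma}v^\gamma$ with $\mu_{x,z}^{s,\gamma}\in\Omega_J$. Then $\mathrm{HY}_J^S(M)$ becomes a $k\Omega$-module via \[e_s\cdot z|m:=\begin{cases}0 & z\in D_{J,s}^+\\ z|e_{s^z}m & z\in D_{J,s}^0\\ z|m & z\in D_{J,s}^-\end{cases}\] \[x_{s,\gamma}\cdot z|m:=\begin{cases}\sum_{x<z}x|\mu_{x,z}^{s,\gamma}m+sz|m & z\in D_{J,s}^+,\ \gamma=0\\ \sum_{x<z}x|\mu_{x,z}^{s,\gamma}m & z\in D_{J,s}^+,\ \gamma\neq 0\\ \sum_{x<z}x|\mu_{x,z}^{s,\gamma}m+z|x_{s^z,\gamma}m & z\in D_{J,s}^0\\ 0 & z\in D_{J,s}^-\end{cases}\] for $s\in S$, $-L(s)<\gamma<L(s)$, $z\in D_J$, $m\in M$ (sums over $x\in D_J$), and the canonicalisation \[c_M:\mathrm{Res}_H^\Omega\,\mathrm{HY}_J^S(M)\to\mathrm{Ind}_{H_J}^H\,\mathrm{Res}_{H_J}^{\Omega_J}(M),\quad z|m\mapsto\sum_{y}T_y\otimes p_{y,z}m\] (extended $k[\Gamma]$-linearly; sum over $y\in D_J$) is $k[\Gamm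a]H$-linear.
   Context: Setting. $k$ is a commutative ring; $(W,S)$ is a (not necessarily finite) Coxeter group with length function $l$ and Bruhat–Chevalley order $\le$; $m_{st}$ is the order of $st$. $\Gamma=\mathbb{Z}$, and $L:W\to\Gamma$ is a weight function ($L(xy)=L(x)+L(y)$ whenever $l(xy)=l(x)+l(y)$) with $L(s)>0$ for all $s\in S$. $\mathbb{Z}[\Gamma]$, $k[\Gamma]$ are the Laurent polynomial rings in $v$ (the group element $\gamma$ is written $v^\gamma$), $v_s:=v^{L(s)}$. For a ring or module $A$, $\mathbb{Z}[\Gamma]A:=\mathbb{Z}[\Gamma]\otimes_{\mathbb{Z}}A$ (similarly $k[\Gamma]A=k[\Gamma]\otimes_kA$ for $k$-modules), $\mathbb{Z}[\Gamma_{>0}]A$ (resp. $\mathbb{Z}[\Gamma_{\ge0}]A$) is the subgroup of elements involving only exponents $>0$ (resp. $\ge0$), and $\overline{\phantom{m}}$ is the map $v^\gamma\otimes a\mapsto v^{-\gamma}\otimes a$. Hecke algebra. $H$ is the $\mathbb{Z}[\Gamma]$-algebra generated by $T_s$ ($s\in S$) with relations $T_s^2=1+(v_s-v_s^{-1})T_s$ and the braid relations $T_sT_tT_s\cdots=T_tT_sT_t\cdots$ ($m_{st}$ factors, $m_{st}<\infty$); $T_w=T_{s_1}\cdots T_{s_l}$ for a reduced expression $w=s_1\cdots s_l$. For $J\subseteq S$, $W_J=\langle J\rangle$ and $H_J=\mathrm{span}\{T_w\mid w\in W_J\}$, the Hecke algebra of $(W_J,J,L|_{W_J})$. $k[\Gamma]H:=k[\Gamma]\otimes_{\mathbb{Z}[\Gamma]}H$.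 $W$-graph algebra. In $\mathbb{Z}[\Gamma]\otimes\mathbb{Z}\langle e_s,x_{s,\gamma}\mid s\in S,-L(s)<\gamma<L(s)\rangle$ (free algebra) put $j(T_s)=-v_s^{-1}e_s+v_s(1-e_s)+\sum_{\gamma}v^\gamma x_{s,\gamma}$ and write $j(T_s)j(T_t)j(T_s)\cdots-j(T_t)j(T_s)j(T_t)\cdots=\sum_\gamma v^\gamma\otimes y^\gamma(s,t)$ ($m_{st}$ factors each, $m_{st}<\infty$). $\Omega$ is the quotient of the free algebra by the relations $e_s^2=e_s$, $e_se_t=e_te_s$, $e_sx_{s,\gamma}=x_{s,\gamma}$, $x_{s,\gamma}e_s=0$, $x_{s,\gamma}=x_{s,-\gamma}$, $y^\gamma(s,t)=0$. Put $x_s=\sum_\gamma v^\gamma x_{s,\gamma}\in\mathbb{Z}[\Gamma]\Omega$. $T_s\mapsto j(T_s)$ defines an embedding $H\hookrightarrow\mathbb{Z}[\Gamma]\Omega$, regarded as an inclusion; $C_s:=T_s-v_s=-(v_s+v_s^{-1})e_s+x_s$. $\Omega_J$ is the algebra $\Omega$ for $(W_J,J,L|_{W_J})$; $k\Omega=k\otimes_{\mathbb Z}\Omega$. For a $k\Omega$-module $N$, $\mathrm{Res}_H^\Omega N$ is $k[\Gamma]\otimes_kN$ viewed as a $k[\Gamma]H$-module; similarly $\mathrm{Res}_{H_J}^{\Omega_J}$. $\mathrm{Ind}_{H_J}^H(V)=H\otimes_{H_J}V$. Cosets. $D_J=\{x\in W\mid l(xs)>l(x)\ \forall s\in J\}$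 (minimal left coset representatives of $W_J$). For $s\in S$: $D_{J,s}^+=\{w\in D_J\mid sw>w,\ sw\in D_J\}$, $D_{J,s}^0=\{w\in D_J\mid sw>w,\ sw\notin D_J\}$, $D_{J,s}^-=\{w\in D_J\mid sw<w\}$; these partition $D_J$. For $w\in D_{J,s}^0$ one has $s^w:=w^{-1}sw\in J$ (and $L(s^w)=L(s)$). Elements $p_{x,z}$. Let $\overline{\phantom m}$-semilinear ring involution $\iota$ of $H$ be given by $\iota(T_s)=T_s^{-1}$ and write $\iota(T_z)=\sum_wR_{w,z}T_w$. For $x,z\in D_J$ put $r_{x,z}=\sum_{y\in W_J}R_{xy,z}T_y\in H_J\subseteq\mathbb{Z}[\Gamma]\Omega_J$. Then $(p_{x,z})_{x,z\in D_J}$ is the unique family in $\mathbb{Z}[\Gamma_{\ge0}]\Omega_J$ with $p_{z,z}=1$, $p_{x,z}=0$ unless $x\le z$, $p_{x,z}\in\mathbb{Z}[\Gamma_{>0}]\Omega_J$ for $x<z$, and $p_{x,z}=\sum_{x\le y\le z}r_{x,y}\overline{p_{y,z}}$. Elements $\mu_{x,z}^s$. $(\mu_{x,z}^s)_{x,z\in D_J,s\in S}$ is the unique family in $\mathbb{Z}[\Gamma]\Omega_J$ such that (i) $\mu_{x,z}^s=0$ unless $x<z$, $z\in D_{J,s}^+\cup D_{J,s}^0$ and $x\in D_{J,s}^0\cup D_{J,s}^-$; (ii) $\overline{\mu_{x,z}^s}=\mu_{x,z}^s$; (iii) if $z\in D_{J,s}^+\cup D_{J,s}^0$ and $x\in D_{J,s}^0\cup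 D_{J,s}^-$ then $\mu_{x,z}^s+R+\sum_{x<y<z}p_{x,y}\mu_{y,z}^s\in\mathbb{Z}[\Gamma_{>0}]\Omega_J$, where $R=-C_{s^x}p_{x,z}$ if $z\in D_{J,s}^+,x\in D_{J,s}^0$; $R=v_s^{-1}p_{x,z}$ if $z\in D_{J,s}^+,x\in D_{J,s}^-$; $R=p_{x,z}C_{s^z}-C_{s^x}p_{x,z}$ if $z\in D_{J,s}^0,x\in D_{J,s}^0$; $R=p_{x,z}C_{s^z}+v_s^{-1}p_{x,z}$ if $z\in D_{J,s}^0,x\in D_{J,s}^-$. These satisfy $v_s\mu^s_{x,z}\in\mathbb{Z}[\Gamma_{>0}]\Omega_J$, so only exponents strictly between $-L(s)$ and $L(s)$ occur in $\mu^s_{x,z}$. *)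

theory Defs
  imports "HOL-Algebra.Generated_Groups" "HOL-Algebra.Multiplicative_Group" "HOL-Library.Poly_Mapping"
begin

section \<open>Coxeter groups\<close>

definition wprod :: "('w, 'q) monoid_scheme \<Rightarrow> 'w list \<Rightarrow> 'w" where
  "wprod G ws = foldr (\<lambda>s w. s \<otimes>\<^bsub>G\<^esub> w) ws \<one>\<^bsub>G\<^esub>"

text \<open>The alternating word \<open>s t s \<dots>\<close> with \<open>n\<close> letters.\<close>
definition alt_word :: "nat \<Rightarrow> 'w \<Rightarrow> 'w \<Rightarrow> 'w list" where
  "alt_word n s t = map (\<lambda>i. if even i then s else t) [0..<n]"

text \<open>The order \<open>m\<close> of \<open>st\<close> is \<^term>\<open>group.ord G (s \<otimes>\<^bsub>G\<^esub> t)\<close>, which is 0 when the order is infinite.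
  The congruence below is the one on words in \<open>S\<close> generated by the relations \<open>(st)\<^sup>m = 1\<close> (\<open>m < \<infinity>\<close>).
  The case \<open>s = t\<close> gives \<open>s\<^sup>2 = 1\<close>, so no formal inverses are needed and the quotient
  monoid is the group presented by these relations.\<close>
inductive coxeter_cong :: "('w, 'q) monoid_scheme \<Rightarrow> 'w set \<Rightarrow> 'w list \<Rightarrow> 'w list \<Rightarrow> bool"
  for G S where
  refl: "coxeter_cong G S u u"
| sym: "coxeter_cong G S u v \<Longrightarrow> coxeter_cong G S v u"
| trans: "coxeter_cong G S u v \<Longrightarrow> coxeter_cong G S v w \<Longrightarrow> coxeter_cong G S u w"
| rel: "\<lbrakk>s \<in> S; t \<in> S; m = group.ord G (s \<otimes>\<^bsub>G\<^esub> t); m \<noteq> 0; u \<in> lists S; v \<in> lists S\<rbrakk>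
    \<Longrightarrow> coxeter_cong G S (u @ alt_word (2 * m) s t @ v) (u @ v)"

definition coxeter_system :: "('w, 'q) monoid_scheme \<Rightarrow> 'w set \<Rightarrow> bool" where
  "coxeter_system G S \<longleftrightarrow> group G \<and> S \<subseteq> carrier G \<and> generate G S = carrier G \<and>
     (\<forall>s\<in>S. s \<noteq> \<one>\<^bsub>G\<^esub> \<and> s \<otimes>\<^bsub>G\<^esub> s = \<one>\<^bsub>G\<^esub>) \<and>
     (\<forall>u\<in>lists S. \<forall>v\<in>lists S. wprod G u = wprod G v \<longrightarrow> coxeter_cong G S u v)"

definition cox_length :: "('w, 'q) monoid_scheme \<Rightarrow> 'w set \<Rightarrow> 'w \<Rightarrow> nat" where
  "cox_length G S w = (LEAST n. \<exists>ws\<in>lists S. length ws = n \<and> wprod G ws = w)"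

definition reduced_expr :: "('w, 'q) monoid_scheme \<Rightarrow> 'w set \<Rightarrow> 'w \<Rightarrow> 'w list \<Rightarrow> bool" where
  "reduced_expr G S w ws \<longleftrightarrow> ws \<in> lists S \<and> wprod G ws = w \<and> length ws = cox_length G S w"

definition reflections :: "('w, 'q) monoid_scheme \<Rightarrow> 'w set \<Rightarrow> 'w set" where
  "reflections G S = {w \<otimes>\<^bsub>G\<^esub> s \<otimes>\<^bsub>G\<^esub> inv\<^bsub>G\<^esub> w | w s. w \<in> carrier G \<and> s \<in> S}"

definition bruhat_le :: "('w, 'q) monoid_scheme \<Rightarrow> 'w set \<Rightarrow> 'w \<Rightarrow> 'w \<Rightarrow> bool" where
  "bruhat_le G S =
     (\<lambda>u w. u \<in> carrier G \<and> (\<exists>t\<in>reflections G S. w = u \<otimes>\<^bsub>G\<^esub> t) \<and>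
            cox_length G S u < cox_length G S w)\<^sup>*\<^sup>*"

definition bruhat_less :: "('w, 'q) monoid_scheme \<Rightarrow> 'w set \<Rightarrow> 'w \<Rightarrow> 'w \<Rightarrow> bool" where
  "bruhat_less G S u w \<longleftrightarrow> bruhat_le G S u w \<and> u \<noteq> w"

definition weight_function :: "('w, 'q) monoid_scheme \<Rightarrow> 'w set \<Rightarrow> ('w \<Rightarrow> int) \<Rightarrow> bool" where
  "weight_function G S L \<longleftrightarrow>
     (\<forall>x\<in>carrier G. \<forall>y\<in>carrier G.
        cox_length G S (x \<otimes>\<^bsub>G\<^esub> y) = cox_length G S x + cox_length G S y \<longrightarrow> L (x \<otimes>\<^bsub>G\<^esub> y) = L x + L y)"

definition coset_reps :: "('w, 'q) monoid_scheme \<Rightarrow> 'w set \<Rightarrow> 'w set \<Rightarrow> 'w set" where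
  "coset_reps G S J =
     {x \<in> carrier G. \<forall>s\<in>J. cox_length G S (x \<otimes>\<^bsub>G\<^esub> s) > cox_length G S x}"

definition D_plus :: "('w, 'q) monoid_scheme \<Rightarrow> 'w set \<Rightarrow> 'w set \<Rightarrow> 'w \<Rightarrow> 'w set" where
  "D_plus G S J s =
     {w \<in> coset_reps G S J. bruhat_less G S w (s \<otimes>\<^bsub>G\<^esub> w) \<and> s \<otimes>\<^bsub>G\<^esub> w \<in> coset_reps G S J}"

definition D_zero :: "('w, 'q) monoid_scheme \<Rightarrow> 'w set \<Rightarrow> 'w set \<Rightarrow> 'w \<Rightarrow> 'w set" where
  "D_zero G S J s =
     {w \<in> coset_reps G S J. bruhat_less G S w (s \<otimes>\<^bsub>G\<^esub> w) \<and> s \<otimes>\<^bsub>G\<^esub> w \<notin> coset_reps G S J}"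

definition D_minus :: "('w, 'q) monoid_scheme \<Rightarrow> 'w set \<Rightarrow> 'w set \<Rightarrow> 'w \<Rightarrow> 'w set" where
  "D_minus G S J s = {w \<in> coset_reps G S J. bruhat_less G S (s \<otimes>\<^bsub>G\<^esub> w) w}"

definition sconj :: "('w, 'q) monoid_scheme \<Rightarrow> 'w \<Rightarrow> 'w \<Rightarrow> 'w" where
  "sconj G s w = inv\<^bsub>G\<^esub> w \<otimes>\<^bsub>G\<^esub> s \<otimes>\<^bsub>G\<^esub> w"


section \<open>Algebras given by generators and relations\<close>

datatype 'g fmon = FMon (letters: "'g list")

instantiation fmon :: (type) monoid_add
begin
definition zero_fmon :: "'g fmon" where "zero_fmon = FMon []"
definition plus_fmon :: "'g fmon \<Rightarrow> 'g fmon \<Rightarrow> 'g fmon" where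
  "plus_fmon u v = FMon (letters u @ letters v)"
instance by standard (simp_all add: zero_fmon_def plus_fmon_def)
end

text \<open>\<^typ>\<open>'g fmon\<close> is the free monoid (written additively), hence \<^typ>\<open>'g fmon \<Rightarrow>\<^sub>0 'c\<close> with its
  convolution product is the free associative \<open>'c\<close>-algebra on \<open>'g\<close>.\<close>
definition free_alg :: "'g set \<Rightarrow> ('g fmon \<Rightarrow>\<^sub>0 'c::comm_ring_1) set" where
  "free_alg X = {f. \<forall>w\<in>Poly_Mapping.keys f. set (letters w) \<subseteq> X}"

definition fgen :: "'g \<Rightarrow> 'g fmon \<Rightarrow>\<^sub>0 'c::comm_ring_1" where
  "fgen g = Poly_Mapping.single (FMon [g]) 1"

definition fscalar :: "'c \<Rightarrow> 'g fmon \<Rightarrow>\<^sub>0 'c::comm_ring_1" where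
  "fscalar c = Poly_Mapping.single 0 c"

definition feval :: "('c \<Rightarrow> 'a) \<Rightarrow> ('g \<Rightarrow> 'a) \<Rightarrow> ('g fmon \<Rightarrow>\<^sub>0 'c::comm_ring_1) \<Rightarrow> 'a::ring_1" where
  "feval \<eta> t f = (\<Sum>w\<in>Poly_Mapping.keys f. \<eta> (Poly_Mapping.lookup f w) * prod_list (map t (letters w)))"

text \<open>The two-sided ideal of the subring \<open>A\<close> generated by \<open>X \<subseteq> A\<close>.\<close>
inductive_set ideal_gen :: "'r::ring_1 set \<Rightarrow> 'r set \<Rightarrow> 'r set" for A X where
  zero: "0 \<in> ideal_gen A X"
| add: "\<lbrakk>f \<in> ideal_gen A X; r \<in> X; a \<in> A; b \<in> A\<rbrakk> \<Longrightarrow> f + a * r * b \<in> ideal_gen A X"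

text \<open>The ring \<open>'a\<close>, with structure map \<open>\<eta>\<close> from \<open>'c\<close> and generators \<open>t g\<close> (\<open>g \<in> X\<close>), is the
  quotient of the free \<open>'c\<close>-algebra on \<open>X\<close> by the ideal generated by the relators \<open>rels\<close>: the
  evaluation map is surjective and its kernel is that ideal. This pins down \<open>('a, \<eta>, t)\<close> up to unique
  isomorphism.\<close>
definition presented_algebra ::
  "('c \<Rightarrow> 'a::ring_1) \<Rightarrow> ('g \<Rightarrow> 'a) \<Rightarrow> 'g set \<Rightarrow> ('g fmon \<Rightarrow>\<^sub>0 'c::comm_ring_1) set \<Rightarrow> bool" where
  "presented_algebra \<eta> t X rels \<longleftrightarrow>
     \<eta> 1 = 1 \<and> (\<forall>c d. \<eta> (c + d) = \<eta> c + \<eta> d \<and> \<eta> (c * d) = \<eta> c * \<eta> d) \<and>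
     (\<forall>c a. \<eta> c * a = a * \<eta> c) \<and>
     feval \<eta> t ` free_alg X = UNIV \<and>
     {f \<in> free_alg X. feval \<eta> t f = 0} = ideal_gen (free_alg X) rels"

fun alt_prod :: "nat \<Rightarrow> 'r::monoid_mult \<Rightarrow> 'r \<Rightarrow> 'r" where
  "alt_prod 0 a b = 1"
| "alt_prod (Suc n) a b = a * alt_prod n b a"


section \<open>Laurent polynomials\<close>

text \<open>\<^typ>\<open>int \<Rightarrow>\<^sub>0 'a\<close> is the group of Laurent polynomials \<open>\<Sum> v\<^sup>\<gamma> a\<^sub>\<gamma>\<close> with coefficients in \<open>'a\<close>.
  In particular \<^typ>\<open>int \<Rightarrow>\<^sub>0 int\<close> is \<open>\<int>[\<Gamma>]\<close>.\<close>

abbreviation vpow :: "int \<Rightarrow> int \<Rightarrow>\<^sub>0 'a::ring_1" where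
  "vpow n \<equiv> Poly_Mapping.single n 1"

definition lbar :: "(int \<Rightarrow>\<^sub>0 'a::zero) \<Rightarrow> int \<Rightarrow>\<^sub>0 'a" where
  "lbar f = Poly_Mapping.map_key uminus f"

definition lpos :: "(int \<Rightarrow>\<^sub>0 'a::zero) set" where
  "lpos = {f. \<forall>\<gamma>\<in>Poly_Mapping.keys f. \<gamma> > 0}"

definition lnonneg :: "(int \<Rightarrow>\<^sub>0 'a::zero) set" where
  "lnonneg = {f. \<forall>\<gamma>\<in>Poly_Mapping.keys f. \<gamma> \<ge> 0}"

text \<open>The action of \<open>A[v,v\<^sup>-\<^sup>1]\<close> on \<open>N[v,v\<^sup>-\<^sup>1]\<close> induced by an action of \<open>A\<close> on \<open>N\<close>.\<close>
definition lact ::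
  "('a::zero \<Rightarrow> 'n \<Rightarrow> 'n) \<Rightarrow> (int \<Rightarrow>\<^sub>0 'a) \<Rightarrow> (int \<Rightarrow>\<^sub>0 'n) \<Rightarrow> int \<Rightarrow>\<^sub>0 'n::ab_group_add" where
  "lact act a f =
     (\<Sum>i\<in>Poly_Mapping.keys a. \<Sum>j\<in>Poly_Mapping.keys f. Poly_Mapping.single (i + j) (act (Poly_Mapping.lookup a i) (Poly_Mapping.lookup f j)))"


section \<open>Hecke algebra\<close>

definition hecke_rels :: "('w, 'q) monoid_scheme \<Rightarrow> 'w set \<Rightarrow> ('w \<Rightarrow> int) \<Rightarrow> ('w fmon \<Rightarrow>\<^sub>0 int \<Rightarrow>\<^sub>0 int) set" where
  "hecke_rels G S L =
     {fgen s * fgen s - 1 - fscalar (vpow (L s) - vpow (- L s)) * fgen s | s. s \<in> S} \<union>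
     {alt_prod m (fgen s) (fgen t) - alt_prod m (fgen t) (fgen s) | s t m.
        s \<in> S \<and> t \<in> S \<and> m = group.ord G (s \<otimes>\<^bsub>G\<^esub> t) \<and> m \<noteq> 0}"

definition is_hecke_algebra ::
  "('w, 'q) monoid_scheme \<Rightarrow> 'w set \<Rightarrow> ('w \<Rightarrow> int) \<Rightarrow> ((int \<Rightarrow>\<^sub>0 int) \<Rightarrow> 'h::ring_1) \<Rightarrow> ('w \<Rightarrow> 'h) \<Rightarrow> bool" where
  "is_hecke_algebra G S L \<eta> t \<longleftrightarrow> presented_algebra \<eta> t S (hecke_rels G S L)"

text \<open>\<open>T\<^sub>w\<close>, computed from the generators \<open>t s = T\<^sub>s\<close> via some reduced expression; by Matsumoto's theorem
  the choice is immaterial.\<close>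
definition T_elem :: "('w, 'q) monoid_scheme \<Rightarrow> 'w set \<Rightarrow> ('w \<Rightarrow> 'h::ring_1) \<Rightarrow> 'w \<Rightarrow> 'h" where
  "T_elem G S t w = prod_list (map t (SOME ws. reduced_expr G S w ws))"

definition hecke_comb ::
  "('w, 'q) monoid_scheme \<Rightarrow> 'w set \<Rightarrow> ((int \<Rightarrow>\<^sub>0 int) \<Rightarrow> 'h::ring_1) \<Rightarrow> ('w \<Rightarrow> 'h) \<Rightarrow>
     'w set \<Rightarrow> ('w \<Rightarrow> int \<Rightarrow>\<^sub>0 int) \<Rightarrow> 'h" where
  "hecke_comb G S \<eta> t A c = (\<Sum>w\<in>A. \<eta> (c w) * T_elem G S t w)"

definition hecke_parabolic ::
  "('w, 'q) monoid_scheme \<Rightarrow> 'w set \<Rightarrow> ((int \<Rightarrow>\<^sub>0 int) \<Rightarrow> 'h::ring_1) \<Rightarrow> ('w \<Rightarrow> 'h) \<Rightarrow> 'w set \<Rightarrow> 'h set" where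
  "hecke_parabolic G S \<eta> t J =
     {hecke_comb G S \<eta> t A c | A c. finite A \<and> A \<subseteq> generate G J}"

definition is_hecke_bar ::
  "'w set \<Rightarrow> ((int \<Rightarrow>\<^sub>0 int) \<Rightarrow> 'h::ring_1) \<Rightarrow> ('w \<Rightarrow> 'h) \<Rightarrow> ('h \<Rightarrow> 'h) \<Rightarrow> bool" where
  "is_hecke_bar S \<eta> t \<iota> \<longleftrightarrow>
     \<iota> 1 = 1 \<and> (\<forall>a b. \<iota> (a + b) = \<iota> a + \<iota> b \<and> \<iota> (a * b) = \<iota> a * \<iota> b) \<and>
     (\<forall>a. \<iota> (\<iota> a) = a) \<and> (\<forall>c. \<iota> (\<eta> c) = \<eta> (lbar c)) \<and>
     (\<forall>s\<in>S. \<iota> (t s) * t s = 1 \<and> t s * \<iota> (t s) = 1)"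

text \<open>\<open>R w z\<close> are the coefficients of \<open>\<iota>(T\<^sub>z)\<close> in the basis \<open>(T\<^sub>w)\<close>.\<close>
definition is_R_family ::
  "('w, 'q) monoid_scheme \<Rightarrow> 'w set \<Rightarrow> ((int \<Rightarrow>\<^sub>0 int) \<Rightarrow> 'h::ring_1) \<Rightarrow> ('w \<Rightarrow> 'h) \<Rightarrow> ('h \<Rightarrow> 'h) \<Rightarrow>
     ('w \<Rightarrow> 'w \<Rightarrow> int \<Rightarrow>\<^sub>0 int) \<Rightarrow> bool" where
  "is_R_family G S \<eta> t \<iota> R \<longleftrightarrow>
     (\<forall>z\<in>carrier G. finite {w \<in> carrier G. R w z \<noteq> 0} \<and>
        \<iota> (T_elem G S t z) = hecke_comb G S \<eta> t {w \<in> carrier G. R w z \<noteq> 0} (\<lambda>w. R w z))"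


section \<open>W-graph algebra\<close>

datatype 'w wgen = GE 'w | GX 'w int

definition wgens :: "'w set \<Rightarrow> ('w \<Rightarrow> int) \<Rightarrow> 'w wgen set" where
  "wgens J L = GE ` J \<union> {GX s \<gamma> | s \<gamma>. s \<in> J \<and> - L s < \<gamma> \<and> \<gamma> < L s}"

definition x_elem :: "('w \<Rightarrow> int) \<Rightarrow> ('w \<Rightarrow> int \<Rightarrow> 'a) \<Rightarrow> 'w \<Rightarrow> int \<Rightarrow>\<^sub>0 'a::ring_1" where
  "x_elem L x s = (\<Sum>\<gamma>\<in>{- L s<..<L s}. Poly_Mapping.single \<gamma> (x s \<gamma>))"

text \<open>\<open>j(T\<^sub>s) = -v\<^sub>s\<^sup>-\<^sup>1 e\<^sub>s + v\<^sub>s (1 - e\<^sub>s) + \<Sum>\<^sub>\<gamma> v\<^sup>\<gamma> x\<^sub>s\<^sub>,\<^sub>\<gamma>\<close>, for elements \<open>e s\<close>, \<open>x s \<gamma>\<close> of any ring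
  (both the free algebra and its quotient are used).\<close>
definition jT :: "('w \<Rightarrow> int) \<Rightarrow> ('w \<Rightarrow> 'a) \<Rightarrow> ('w \<Rightarrow> int \<Rightarrow> 'a) \<Rightarrow> 'w \<Rightarrow> int \<Rightarrow>\<^sub>0 'a::ring_1" where
  "jT L e x s = Poly_Mapping.single (- L s) (- e s) + Poly_Mapping.single (L s) (1 - e s) + x_elem L x s"

definition C_elem :: "('w \<Rightarrow> int) \<Rightarrow> ('w \<Rightarrow> 'a) \<Rightarrow> ('w \<Rightarrow> int \<Rightarrow> 'a) \<Rightarrow> 'w \<Rightarrow> int \<Rightarrow>\<^sub>0 'a::ring_1" where
  "C_elem L e x s = jT L e x s - vpow (L s)"

abbreviation fE :: "'w \<Rightarrow> 'w wgen fmon \<Rightarrow>\<^sub>0 int" where "fE s \<equiv> fgen (GE s)"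
abbreviation fX :: "'w \<Rightarrow> int \<Rightarrow> 'w wgen fmon \<Rightarrow>\<^sub>0 int" where "fX s \<gamma> \<equiv> fgen (GX s \<gamma>)"

definition wgraph_rels :: "('w, 'q) monoid_scheme \<Rightarrow> 'w set \<Rightarrow> ('w \<Rightarrow> int) \<Rightarrow> ('w wgen fmon \<Rightarrow>\<^sub>0 int) set" where
  "wgraph_rels G J L =
     {fE s * fE s - fE s | s. s \<in> J} \<union>
     {fE s * fE t - fE t * fE s | s t. s \<in> J \<and> t \<in> J} \<union>
     {fE s * fX s \<gamma> - fX s \<gamma> | s \<gamma>. s \<in> J \<and> - L s < \<gamma> \<and> \<gamma> < L s} \<union>
     {fX s \<gamma> * fE s | s \<gamma>. s \<in> J \<and> - L s < \<gamma> \<and> \<gamma> < L s} \<union>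
     {fX s \<gamma> - fX s (- \<gamma>) | s \<gamma>. s \<in> J \<and> - L s < \<gamma> \<and> \<gamma> < L s} \<union>
     {Poly_Mapping.lookup (alt_prod m (jT L fE fX s) (jT L fE fX t) - alt_prod m (jT L fE fX t) (jT L fE fX s)) \<gamma>
        | s t m \<gamma>. s \<in> J \<and> t \<in> J \<and> m = group.ord G (s \<otimes>\<^bsub>G\<^esub> t) \<and> m \<noteq> 0}"

text \<open>For \<open>J = S\<close> this characterises \<open>\<Omega>\<close>. For general \<open>J\<close> it characterises the algebra \<open>\<Omega>\<^sub>J\<close> of
  \<open>(W\<^sub>J, J, L|W\<^sub>J)\<close>, because only the orders of \<open>st\<close> and the weights \<open>L s\<close> for \<open>s, t \<in> J\<close> enter.\<close>
definition is_wgraph_algebra ::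
  "('w, 'q) monoid_scheme \<Rightarrow> 'w set \<Rightarrow> ('w \<Rightarrow> int) \<Rightarrow> ('w \<Rightarrow> 'a::ring_1) \<Rightarrow> ('w \<Rightarrow> int \<Rightarrow> 'a) \<Rightarrow> bool" where
  "is_wgraph_algebra G J L e x \<longleftrightarrow>
     presented_algebra (of_int :: int \<Rightarrow> 'a) (\<lambda>g. case g of GE s \<Rightarrow> e s | GX s \<gamma> \<Rightarrow> x s \<gamma>)
       (wgens J L) (wgraph_rels G J L)"

text \<open>\<open>j\<close> is the map \<open>H\<^sub>J \<rightarrow> \<int>[\<Gamma>]\<Omega>\<^sub>J\<close>, \<open>T\<^sub>s \<mapsto> j(T\<^sub>s)\<close>, of \<open>\<int>[\<Gamma>]\<close>-algebras. Since \<open>H\<^sub>J\<close> is generated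
  by the \<open>T\<^sub>s\<close> with \<open>s \<in> J\<close>, this determines \<open>j\<close> on \<open>H\<^sub>J\<close>.\<close>
definition is_hecke_inclusion ::
  "('w, 'q) monoid_scheme \<Rightarrow> 'w set \<Rightarrow> ('w \<Rightarrow> int) \<Rightarrow> ((int \<Rightarrow>\<^sub>0 int) \<Rightarrow> 'h::ring_1) \<Rightarrow> ('w \<Rightarrow> 'h) \<Rightarrow>
     'w set \<Rightarrow> ('w \<Rightarrow> 'a::ring_1) \<Rightarrow> ('w \<Rightarrow> int \<Rightarrow> 'a) \<Rightarrow> ('h \<Rightarrow> int \<Rightarrow>\<^sub>0 'a) \<Rightarrow> bool" where
  "is_hecke_inclusion G S L \<eta> t J e x j \<longleftrightarrow>
     (\<forall>a\<in>hecke_parabolic G S \<eta> t J. \<forall>b\<in>hecke_parabolic G S \<eta> t J.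
        j (a + b) = j a + j b \<and> j (a * b) = j a * j b) \<and>
     (\<forall>c. j (\<eta> c) = Poly_Mapping.map of_int c) \<and>
     (\<forall>s\<in>J. j (t s) = jT L e x s)"


section \<open>The elements p and mu\<close>

definition r_elem ::
  "('w, 'q) monoid_scheme \<Rightarrow> 'w set \<Rightarrow> ((int \<Rightarrow>\<^sub>0 int) \<Rightarrow> 'h::ring_1) \<Rightarrow> ('w \<Rightarrow> 'h) \<Rightarrow>
     ('w \<Rightarrow> 'w \<Rightarrow> int \<Rightarrow>\<^sub>0 int) \<Rightarrow> 'w set \<Rightarrow> 'w \<Rightarrow> 'w \<Rightarrow> 'h" where
  "r_elem G S \<eta> t R J x z =
     hecke_comb G S \<eta> t {y \<in> generate G J. R (x \<otimes>\<^bsub>G\<^esub> y) z \<noteq> 0} (\<lambda>y. R (x \<otimes>\<^bsub>G\<^esub> y) z)"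

text \<open>Here \<open>r x z\<close> stands for \<open>r\<^sub>x\<^sub>,\<^sub>z\<close>, viewed in \<open>\<int>[\<Gamma>]\<Omega>\<^sub>J\<close>.\<close>
definition is_p_family ::
  "('w, 'q) monoid_scheme \<Rightarrow> 'w set \<Rightarrow> 'w set \<Rightarrow> ('w \<Rightarrow> 'w \<Rightarrow> int \<Rightarrow>\<^sub>0 'a) \<Rightarrow>
     ('w \<Rightarrow> 'w \<Rightarrow> int \<Rightarrow>\<^sub>0 'a::ring_1) \<Rightarrow> bool" where
  "is_p_family G S J r p \<longleftrightarrow>
     (\<forall>x\<in>coset_reps G S J. \<forall>z\<in>coset_reps G S J.
        p x z \<in> lnonneg \<and> p z z = 1 \<and>
        (\<not> bruhat_le G S x z \<longrightarrow> p x z = 0) \<and>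
        (bruhat_less G S x z \<longrightarrow> p x z \<in> lpos) \<and>
        p x z = (\<Sum>y\<in>{y \<in> coset_reps G S J. bruhat_le G S x y \<and> bruhat_le G S y z}.
                   r x y * lbar (p y z)))"

definition mu_R ::
  "('w, 'q) monoid_scheme \<Rightarrow> 'w set \<Rightarrow> ('w \<Rightarrow> int) \<Rightarrow> 'w set \<Rightarrow> ('w \<Rightarrow> 'a) \<Rightarrow> ('w \<Rightarrow> int \<Rightarrow> 'a) \<Rightarrow>
     ('w \<Rightarrow> 'w \<Rightarrow> int \<Rightarrow>\<^sub>0 'a) \<Rightarrow> 'w \<Rightarrow> 'w \<Rightarrow> 'w \<Rightarrow> int \<Rightarrow>\<^sub>0 'a::ring_1" where
  "mu_R G S L J e x p s u z =
     (if z \<in> D_plus G S J s then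
        (if u \<in> D_zero G S J s then - (C_elem L e x (sconj G s u) * p u z)
         else vpow (- L s) * p u z)
      else
        (if u \<in> D_zero G S J s
         then p u z * C_elem L e x (sconj G s z) - C_elem L e x (sconj G s u) * p u z
         else p u z * C_elem L e x (sconj G s z) + vpow (- L s) * p u z))"

text \<open>\<open>\<mu> s u z\<close> stands for \<open>\<mu>\<^sup>s\<^sub>u\<^sub>,\<^sub>z\<close>.\<close>
definition is_mu_family ::
  "('w, 'q) monoid_scheme \<Rightarrow> 'w set \<Rightarrow> ('w \<Rightarrow> int) \<Rightarrow> 'w set \<Rightarrow> ('w \<Rightarrow> 'a) \<Rightarrow> ('w \<Rightarrow> int \<Rightarrow> 'a) \<Rightarrow>
     ('w \<Rightarrow> 'w \<Rightarrow> int \<Rightarrow>\<^sub>0 'a) \<Rightarrow> ('w \<Rightarrow> 'w \<Rightarrow> 'w \<Rightarrow> int \<Rightarrow>\<^sub>0 'a::ring_1) \<Rightarrow> bool" where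
  "is_mu_family G S L J e x p \<mu> \<longleftrightarrow>
     (\<forall>s\<in>S. \<forall>u\<in>coset_reps G S J. \<forall>z\<in>coset_reps G S J.
        (\<not> (bruhat_less G S u z \<and> z \<in> D_plus G S J s \<union> D_zero G S J s \<and>
            u \<in> D_zero G S J s \<union> D_minus G S J s) \<longrightarrow> \<mu> s u z = 0) \<and>
        lbar (\<mu> s u z) = \<mu> s u z \<and>
        (z \<in> D_plus G S J s \<union> D_zero G S J s \<and> u \<in> D_zero G S J s \<union> D_minus G S J s \<longrightarrow>
           \<mu> s u z + mu_R G S L J e x p s u z +
             (\<Sum>y\<in>{y \<in> coset_reps G S J. bruhat_less G S u y \<and> bruhat_less G S y z}.
                p u y * \<mu> s y z) \<in> lpos))"


section \<open>Modules\<close>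

text \<open>A module over \<open>k \<otimes>\<^sub>\<int> A\<close> with underlying set \<open>N\<close>: a \<open>k\<close>-module with a biadditive, unital,
  associative action of \<open>A\<close> by \<open>k\<close>-linear maps.\<close>
definition is_alg_module ::
  "('k::comm_ring_1 \<Rightarrow> 'n \<Rightarrow> 'n) \<Rightarrow> 'n::ab_group_add set \<Rightarrow> ('a::ring_1 \<Rightarrow> 'n \<Rightarrow> 'n) \<Rightarrow> bool" where
  "is_alg_module sm N act \<longleftrightarrow>
     0 \<in> N \<and> (\<forall>f\<in>N. \<forall>g\<in>N. f - g \<in> N) \<and>
     (\<forall>c. \<forall>f\<in>N. sm c f \<in> N) \<and> (\<forall>a. \<forall>f\<in>N. act a f \<in> N) \<and>
     (\<forall>f\<in>N. sm 1 f = f \<and> act 1 f = f) \<and>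
     (\<forall>c d. \<forall>f\<in>N. sm (c + d) f = sm c f + sm d f \<and> sm (c * d) f = sm c (sm d f)) \<and>
     (\<forall>c. \<forall>f\<in>N. \<forall>g\<in>N. sm c (f + g) = sm c f + sm c g) \<and>
     (\<forall>a b. \<forall>f\<in>N. act (a + b) f = act a f + act b f \<and> act (a * b) f = act a (act b f)) \<and>
     (\<forall>a. \<forall>f\<in>N. \<forall>g\<in>N. act a (f + g) = act a f + act a g) \<and>
     (\<forall>c a. \<forall>f\<in>N. act a (sm c f) = sm c (act a f))"

text \<open>\<open>HY(M) = \<Oplus>\<^sub>w\<^sub>\<in>\<^sub>D M\<close> consists of the finitely supported functions on \<open>D\<close>, and \<open>z|m\<close> is
  \<^term>\<open>Poly_Mapping.single z m\<close>.\<close>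
definition HY :: "'w set \<Rightarrow> ('w \<Rightarrow>\<^sub>0 'm::zero) set" where
  "HY D = {f. Poly_Mapping.keys f \<subseteq> D}"

definition HY_smult :: "('k \<Rightarrow> 'm \<Rightarrow> 'm) \<Rightarrow> 'k \<Rightarrow> ('w \<Rightarrow>\<^sub>0 'm) \<Rightarrow> 'w \<Rightarrow>\<^sub>0 'm::zero" where
  "HY_smult sm c f = Poly_Mapping.map (sm c) f"

definition HY_laurent :: "'w set \<Rightarrow> (int \<Rightarrow>\<^sub>0 'w \<Rightarrow>\<^sub>0 'm::zero) set" where
  "HY_laurent D = {f. \<forall>\<gamma>. Poly_Mapping.lookup f \<gamma> \<in> HY D}"


section \<open>Induction\<close>

definition int_scale :: "int \<Rightarrow> 'i \<Rightarrow> 'i::ab_group_add" where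
  "int_scale n a = (if n \<ge> 0 then (\<Sum>i<nat n. a) else - (\<Sum>i<nat (- n). a))"

inductive_set subgroup_gen :: "'i::ab_group_add set \<Rightarrow> 'i set" for X where
  zero: "0 \<in> subgroup_gen X"
| add: "f \<in> subgroup_gen X \<Longrightarrow> r \<in> X \<Longrightarrow> f + r \<in> subgroup_gen X"
| diff: "f \<in> subgroup_gen X \<Longrightarrow> r \<in> X \<Longrightarrow> f - r \<in> subgroup_gen X"

definition pure :: "'h \<Rightarrow> 'n \<Rightarrow> ('h \<times> 'n) \<Rightarrow>\<^sub>0 int" where
  "pure h n = Poly_Mapping.single (h, n) 1"

definition tensor_rels ::
  "'h::ring_1 set \<Rightarrow> ('h \<Rightarrow> 'n \<Rightarrow> 'n) \<Rightarrow> ('h \<times> 'n::ab_group_add \<Rightarrow>\<^sub>0 int) set" where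
  "tensor_rels B bact =
     {pure (g + h) n - pure g n - pure h n | g h n. True} \<union>
     {pure h (n + n') - pure h n - pure h n' | h n n'. True} \<union>
     {pure (h * b) n - pure h (bact b n) | h b n. b \<in> B}"

text \<open>The group \<open>'i\<close> with \<open>\<tau> h n = h \<otimes> n\<close> is \<open>'h \<otimes>\<^sub>B 'n\<close>, the quotient of the free abelian group
  on \<open>'h \<times> 'n\<close> by the biadditivity and \<open>B\<close>-balancedness relations.\<close>
definition is_tensor_product ::
  "'h::ring_1 set \<Rightarrow> ('h \<Rightarrow> 'n \<Rightarrow> 'n) \<Rightarrow> ('h \<Rightarrow> 'n::ab_group_add \<Rightarrow> 'i::ab_group_add) \<Rightarrow> bool" where
  "is_tensor_product B bact \<tau> \<longleftrightarrow>
     (let ev = (\<lambda>f. \<Sum>(h, n)\<in>Poly_Mapping.keys f. int_scale (Poly_Mapping.lookup f (h, n)) (\<tau> h n))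
      in range ev = UNIV \<and> {f. ev f = 0} = subgroup_gen (tensor_rels B bact))"

text \<open>\<open>'i\<close> is \<open>H \<otimes>\<^sub>B 'n\<close> together with its actions \<open>hact\<close> of \<open>H\<close> and \<open>kact\<close> of \<open>k[\<Gamma>]\<close>,
  the latter coming from the action \<open>kn\<close> of \<open>k[\<Gamma>]\<close> on \<open>'n\<close>.\<close>
definition is_induced_module ::
  "'h::ring_1 set \<Rightarrow> ('h \<Rightarrow> 'n \<Rightarrow> 'n) \<Rightarrow> ('kk \<Rightarrow> 'n \<Rightarrow> 'n) \<Rightarrow>
     ('h \<Rightarrow> 'n::ab_group_add \<Rightarrow> 'i::ab_group_add) \<Rightarrow> ('h \<Rightarrow> 'i \<Rightarrow> 'i) \<Rightarrow> ('kk \<Rightarrow> 'i \<Rightarrow> 'i) \<Rightarrow> bool" where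
  "is_induced_module B bact kn \<tau> hact kact \<longleftrightarrow>
     is_tensor_product B bact \<tau> \<and>
     (\<forall>h a b. hact h (a + b) = hact h a + hact h b) \<and>
     (\<forall>h g n. hact h (\<tau> g n) = \<tau> (h * g) n) \<and>
     (\<forall>c a b. kact c (a + b) = kact c a + kact c b) \<and>
     (\<forall>c g n. kact c (\<tau> g n) = \<tau> g (kn c n))"

text \<open>The image of \<open>z|m\<close>. As \<open>p y z = 0\<close> unless \<open>y \<le> z\<close>, the sum over \<open>D\<^sub>J\<close> is the finite sum over
  \<open>y \<le> z\<close>.\<close>
definition canon_gen ::
  "('w, 'q) monoid_scheme \<Rightarrow> 'w set \<Rightarrow> 'w set \<Rightarrow> ('w \<Rightarrow> 'h::ring_1) \<Rightarrow> ('w \<Rightarrow> 'w \<Rightarrow> int \<Rightarrow>\<^sub>0 'a) \<Rightarrow>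
     ('a::ring_1 \<Rightarrow> 'm \<Rightarrow> 'm) \<Rightarrow> ('h \<Rightarrow> (int \<Rightarrow>\<^sub>0 'm::ab_group_add) \<Rightarrow> 'i::ab_group_add) \<Rightarrow> 'w \<Rightarrow> 'm \<Rightarrow> 'i" where
  "canon_gen G S J t p act \<tau> z m =
     (\<Sum>y\<in>{y \<in> coset_reps G S J. bruhat_le G S y z}.
        \<tau> (T_elem G S t y) (lact act (p y z) (Poly_Mapping.single 0 m)))"

text \<open>Its \<open>k[\<Gamma>]\<close>-linear extension to \<open>k[\<Gamma>] \<otimes>\<^sub>k HY(M)\<close>.\<close>
definition canon ::
  "('w, 'q) monoid_scheme \<Rightarrow> 'w set \<Rightarrow> 'w set \<Rightarrow> ('w \<Rightarrow> 'h::ring_1) \<Rightarrow> ('w \<Rightarrow> 'w \<Rightarrow> int \<Rightarrow>\<^sub>0 'a) \<Rightarrow>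
     ('a::ring_1 \<Rightarrow> 'm \<Rightarrow> 'm) \<Rightarrow> ('h \<Rightarrow> (int \<Rightarrow>\<^sub>0 'm::ab_group_add) \<Rightarrow> 'i::ab_group_add) \<Rightarrow>
     ((int \<Rightarrow>\<^sub>0 'k::comm_ring_1) \<Rightarrow> 'i \<Rightarrow> 'i) \<Rightarrow> (int \<Rightarrow>\<^sub>0 'w \<Rightarrow>\<^sub>0 'm) \<Rightarrow> 'i" where
  "canon G S J t p act \<tau> kact f =
     (\<Sum>\<gamma>\<in>Poly_Mapping.keys f. kact (vpow \<gamma>)
        (\<Sum>z\<in>Poly_Mapping.keys (Poly_Mapping.lookup f \<gamma>). canon_gen G S J t p act \<tau> z (Poly_Mapping.lookup (Poly_Mapping.lookup f \<gamma>) z)))"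

end

theory Submission
  imports Defs
begin

text \<open>The induced module \<open>H \<otimes> \<int>[\<Gamma>]\<Omega>\<^sub>J\<close> over \<open>H\<^sub>J\<close> is free with basis \<open>T\<^sub>y\<close> (\<open>y \<in> D\<close>) and carries a
  bar involution, for which the elements \<open>c\<^sub>z = \<Sum> T\<^sub>y p\<^sub>y\<^sub>,\<^sub>z\<close> are invariant; an invariant element whose
  coefficients have only positive exponents vanishes. The eigenspace of \<open>T\<^sub>s\<close> for \<open>-v\<^sub>s\<^sup>-\<^sup>1\<close> is stable under
  the bar involution, and removing coefficients of maximal length one layer at a time shows that it
  contains \<open>c\<^sub>z\<close> for \<open>z \<in> D\<^sup>-\<close> and \<open>c\<^sub>z e\<close> for \<open>z \<in> D\<^sup>0\<close>, where \<open>e = e\<^sub>t\<close> with \<open>t = s\<^sup>z\<close>. (Constructing such elements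
  by solving \<open>a = b - b\<close>-bar for the coefficients would fail here, as \<open>\<Omega>\<^sub>J\<close> may have 2-torsion.)
  Comparing coefficients in this eigenspace gives \<open>\<mu>\<^sup>s\<^sub>x\<^sub>,\<^sub>z e\<^sub>t = 0\<close> (\<open>t = s\<^sup>z\<close>) and \<open>e\<^sub>t \<mu>\<^sup>s\<^sub>x\<^sub>,\<^sub>z = \<mu>\<^sup>s\<^sub>x\<^sub>,\<^sub>z\<close>
  (\<open>t = s\<^sup>x\<close>), and uniqueness then yields the formulas for \<open>C\<^sub>s c\<^sub>z\<close>, that is, the linearity of the
  canonicalisation. The relations of \<open>\<Omega>\<close> other than the braid relations are checked directly on
  \<open>z|m\<close>. The canonicalisation is unitriangular, hence injective, so the braid relations are inherited from
  the action of \<open>H\<close> on the induced module.\<close>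

section \<open>Finitely supported functions\<close>

\<comment> \<open>All facts about \<open>p\<close> and \<open>\<mu>\<close> are proved over the
  universal coefficients \<open>\<int>[\<Gamma>]\<Omega>\<^sub>J\<close> and evaluated at
  \<open>M\<close> only afterwards: the arguments multiply by \<open>e_t\<close> and
  \<open>C_t\<close> on the right, which a left module does not allow. The eigenspace closes two
  gaps. The relations \<open>e x = x\<close> and \<open>x e = 0\<close> demand
  \<open>e_t \<mu> = \<mu>\<close> and \<open>\<mu> e_t = 0\<close>, which the conditions defining
  \<open>\<mu>\<close> do not mention. Moreover these conditions are silent at positions
  \<open>u\<close> in \<open>D_plus\<close>, where positivity of the coefficients must come from
  elsewhere: an eigenvector has there \<open>- v_s\<close> times its coefficient at
  \<open>s u\<close>, and \<open>v_s\<close> is just enough to make \<open>\<mu>\<close> positive.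
  Since \<open>v_s + v_s^-1\<close> is not a zero divisor, the eigenvalue equation at
  \<open>D_zero\<close> becomes \<open>(1 - e_t) a = 0\<close> without any division. The group may
  be infinite and is known only through its presentation, and so is the Hecke algebra. Hence the
  exchange condition is derived from parities of reflections in words rather than from roots, and
  the independence of the \<open>T_w\<close> from an explicit regular representation.\<close>
alias lookup = Poly_Mapping.lookup
alias keys = Poly_Mapping.keys
alias single = Poly_Mapping.single

lemma additiveI [intro?]: "(\<And>x y. f (x + y) = f x + f y) \<Longrightarrow> additive f"
  by (simp add: additive_def)

lemma additive_comp: "additive f \<Longrightarrow> additive g \<Longrightarrow> additive (\<lambda>x. f (g x))"
  by (simp add: additive_def)

lemma additive_id: "additive (\<lambda>x. x)"
  by (simp add: additive_def)

lemma additive_const_0: "additive (\<lambda>x. 0)"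
  by (simp add: additive_def)

lemma additive_plus: "additive f \<Longrightarrow> additive g \<Longrightarrow> additive (\<lambda>x. f x + g x)"
  by (simp add: additive_def algebra_simps)

lemma additive_sum: "(\<And>i. i \<in> A \<Longrightarrow> additive (f i)) \<Longrightarrow> additive (\<lambda>x. \<Sum>i\<in>A. f i x)"
  by (simp add: additive_def sum.distrib)

lemma additive_single: "additive (single k)"
  by (simp add: additive_def single_add)

lemma additive_lookup: "additive (\<lambda>f. lookup f k)"
  by (simp add: additive_def lookup_add)

lemma additive_mult_left: "additive (\<lambda>x. a * x)" for a :: "'a::ring"
  by (simp add: additive_def algebra_simps)

lemma additive_mult_right: "additive (\<lambda>x. x * a)" for a :: "'a::ring"
  by (simp add: additive_def algebra_simps)

text \<open>Additive extension of maps given on monomials. Additivity is the common property of the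
  maps built below: \<open>iot\<close> is semilinear, \<open>hmul\<close> commutes with right
  multiplications, \<open>Phi\<close> is linear over another ring. Once they are written through
  \<open>plin\<close>, identities between them reduce to monomials by
  \<open>additive_eqI\<close>.\<close>

definition plin :: "('a \<Rightarrow> 'b \<Rightarrow> 'c) \<Rightarrow> ('a \<Rightarrow>\<^sub>0 'b::zero) \<Rightarrow> 'c::comm_monoid_add" where
  "plin g f = (\<Sum>k\<in>keys f. g k (lookup f k))"

lemma plin_superset:
  assumes "finite A" "keys f \<subseteq> A" "\<And>k. k \<in> A \<Longrightarrow> g k 0 = 0"
  shows "plin g f = (\<Sum>k\<in>A. g k (lookup f k))"
  unfolding plin_def
  by (rule sum.mono_neutral_left) (use assms in \<open>auto simp: in_keys_iff\<close>)

lemma additive_plin: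
  fixes g :: "'a \<Rightarrow> 'b::ab_group_add \<Rightarrow> 'c::ab_group_add"
  assumes g: "\<And>k. additive (g k)"
  shows "additive (plin g)"
proof
  fix f h :: "'a \<Rightarrow>\<^sub>0 'b"
  let ?A = "keys f \<union> keys h"
  have A: "finite ?A" "keys (f + h) \<subseteq> ?A" using keys_add[of f h] by auto
  have g0: "g k 0 = 0" for k using g additive.zero by blast
  have "plin g (f + h) = (\<Sum>k\<in>?A. g k (lookup (f + h) k))"
    using A g0 by (intro plin_superset) auto
  also have "\<dots> = (\<Sum>k\<in>?A. g k (lookup f k)) + (\<Sum>k\<in>?A. g k (lookup h k))"
    using g by (simp add: lookup_add additive_def sum.distrib)
  also have "\<dots> = plin g f + plin g h"
    using g0 plin_superset[of ?A f g] plin_superset[of ?A h g] by auto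
  finally show "plin g (f + h) = plin g f + plin g h" .
qed

lemma plin_single: "g k 0 = 0 \<Longrightarrow> plin g (single k c) = g k c"
  by (cases "c = 0") (simp_all add: plin_def)

lemma plin_single_additive: "additive (g k) \<Longrightarrow> plin g (single k c) = g k c"
  by (intro plin_single additive.zero)

lemma plin_0 [simp]: "plin g 0 = 0"
  by (simp add: plin_def)

lemma plin_cong: "(\<And>k. k \<in> keys f \<Longrightarrow> g k (lookup f k) = h k (lookup f k)) \<Longrightarrow> plin g f = plin h f"
  by (simp add: plin_def)

lemma additive_plin_fun:
  assumes "\<And>k b. additive (\<lambda>x. g x k b)"
  shows "additive (\<lambda>x. plin (g x) f)"
  unfolding plin_def by (intro additive_sum assms)

lemma sum_single_lookup: "(\<Sum>k\<in>keys f. single k (lookup f k)) = f" for f :: "'a \<Rightarrow>\<^sub>0 'b::comm_monoid_add"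
proof (rule poly_mapping_eqI)
  fix i
  have "lookup (\<Sum>k\<in>keys f. single k (lookup f k)) i = (\<Sum>k\<in>keys f. if k = i then lookup f i else 0)"
    by (auto simp: lookup_sum lookup_single when_def intro!: sum.cong)
  also have "\<dots> = lookup f i" by (simp add: in_keys_iff)
  finally show "lookup (\<Sum>k\<in>keys f. single k (lookup f k)) i = lookup f i" .
qed

text \<open>The monomial case ranges over the support of the given \<open>f\<close> but over all
  coefficients, so a support condition on \<open>f\<close> stays available while the coefficient is
  free.\<close>

lemma pm_induct [consumes 0, case_names zero single add]:
  fixes f :: "'a \<Rightarrow>\<^sub>0 'b::comm_monoid_add"
  assumes "P 0" "\<And>k c. k \<in> keys f \<Longrightarrow> P (single k c)" "\<And>a b. P a \<Longrightarrow> P b \<Longrightarrow> P (a + b)"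
  shows "P f"
proof -
  have "finite A \<Longrightarrow> A \<subseteq> keys f \<Longrightarrow> P (\<Sum>k\<in>A. single k (lookup f k))" for A
    by (induction A rule: finite_induct) (use assms in auto)
  from this[of "keys f"] show ?thesis by (simp add: sum_single_lookup)
qed

lemma additive_eqI:
  assumes "additive F" "additive G" "\<And>k c. k \<in> keys f \<Longrightarrow> F (single k c) = G (single k c)"
  shows "F f = G f"
  by (induction f rule: pm_induct)
    (use assms in \<open>simp_all add: additive.zero additive.add\<close>)

lemma keys_plin_subset: "keys (plin g f) \<subseteq> (\<Union>k\<in>keys f. keys (g k (lookup f k)))"
  unfolding plin_def by (rule keys_sum)

lemma additive_comp_plin:
  fixes h :: "'c::ab_group_add \<Rightarrow> 'd::ab_group_add"
  assumes "additive h"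
  shows "h (plin g f) = plin (\<lambda>k b. h (g k b)) f"
  unfolding plin_def by (rule additive.sum[OF assms])

lemma lookup_map_0: "f 0 = 0 \<Longrightarrow> lookup (Poly_Mapping.map f p) k = f (lookup p k)"
  by (simp add: Poly_Mapping.map.rep_eq when_def)

lemma additive_map:
  assumes "additive f" shows "additive (Poly_Mapping.map f)"
  by standard (rule poly_mapping_eqI, simp add: lookup_map_0 lookup_add additive.zero[OF assms] additive.add[OF assms])

text \<open>An additive projection onto the functions supported in \<open>D\<close>. It makes a
  total action out of operators that satisfy their relations only on such functions
  (\<open>action_exists\<close>).\<close>

definition pm_restrict :: "'a set \<Rightarrow> ('a \<Rightarrow>\<^sub>0 'b::ab_group_add) \<Rightarrow> 'a \<Rightarrow>\<^sub>0 'b" where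
  "pm_restrict D = plin (\<lambda>k b. if k \<in> D then single k b else 0)"

lemma additive_pm_restrict: "additive (pm_restrict D)"
  unfolding pm_restrict_def
  by (rule additive_plin) (auto simp: additive_def single_add)

lemma pm_restrict_single: "pm_restrict D (single k b) = (if k \<in> D then single k b else 0)"
  unfolding pm_restrict_def by (subst plin_single) auto

lemma keys_pm_restrict: "keys (pm_restrict D f) \<subseteq> D"
  unfolding pm_restrict_def using keys_plin_subset by (fastforce split: if_splits)

lemma pm_restrict_id: "keys f \<subseteq> D \<Longrightarrow> pm_restrict D f = f"
  by (rule additive_eqI[OF additive_pm_restrict additive_id]) (auto simp: pm_restrict_single)

subsection \<open>Actions on Laurent polynomials\<close>

definition biadditive :: "('a::ab_group_add \<Rightarrow> 'b::ab_group_add \<Rightarrow> 'c::ab_group_add) \<Rightarrow> bool" where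
  "biadditive act \<longleftrightarrow> (\<forall>a. additive (act a)) \<and> (\<forall>b. additive (\<lambda>a. act a b))"

lemma biadditiveD:
  assumes "biadditive act"
  shows "additive (act a)" "additive (\<lambda>a. act a b)"
  using assms by (auto simp: biadditive_def)

lemma biadditive_simps:
  assumes "biadditive act"
  shows "act (a + a') b = act a b + act a' b" "act a (b + b') = act a b + act a b'"
    "act (a - a') b = act a b - act a' b" "act a (b - b') = act a b - act a b'"
    "act (- a) b = - act a b" "act a (- b) = - act a b" "act 0 b = 0" "act a 0 = 0"
  using additive.add[OF biadditiveD(1)[OF assms]] additive.add[OF biadditiveD(2)[OF assms]]
    additive.diff[OF biadditiveD(1)[OF assms]] additive.diff[OF biadditiveD(2)[OF assms]]
    additive.minus[OF biadditiveD(1)[OF assms]] additive.minus[OF biadditiveD(2)[OF assms]]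
    additive.zero[OF biadditiveD(1)[OF assms]] additive.zero[OF biadditiveD(2)[OF assms]]
  by auto

lemma lact_plin: "lact act a f = plin (\<lambda>i x. plin (\<lambda>j y. single (i + j) (act x y)) f) a"
  by (simp add: lact_def plin_def)

lemma biadditive_lact:
  assumes "biadditive act" shows "biadditive (lact act)"
  unfolding biadditive_def lact_plin
proof (intro conjI allI)
  fix a :: "int \<Rightarrow>\<^sub>0 'a" and f :: "int \<Rightarrow>\<^sub>0 'b"
  have 1: "additive (\<lambda>y. single (i + j) (act x y))" for i j :: int and x
    by (rule additive_comp[OF additive_single biadditiveD(1)[OF assms]])
  have 2: "additive (\<lambda>x. single (i + j) (act x y))" for i j :: int and y
    by (rule additive_comp[OF additive_single biadditiveD(2)[OF assms]])
  show "additive (\<lambda>f. plin (\<lambda>i x. plin (\<lambda>j y. single (i + j) (act x y)) f) a)"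
    by (rule additive_plin_fun, rule additive_plin, rule 1)
  show "additive (plin (\<lambda>i x. plin (\<lambda>j y. single (i + j) (act x y)) f))"
    by (rule additive_plin, rule additive_plin_fun, rule 2)
qed

lemma lact_single_single:
  assumes "biadditive act"
  shows "lact act (single i x) (single j y) = single (i + j) (act x y)"
  unfolding lact_plin
  by (subst plin_single; (subst plin_single)?) (auto simp: biadditive_simps[OF assms] plin_def)

lemma lact_mult:
  assumes act: "biadditive act" and mult: "\<And>x y z. act (x * y) z = act x (act y z)"
  shows "lact act (a * b) f = lact act a (lact act b f)"
proof (induction a rule: pm_induct)
  case (single i x)
  show ?case
  proof (induction b rule: pm_induct)
    case (single j y)
    show ?case
    proof (induction f rule: pm_induct)
      case (single k z)
      then show ?case by (simp add: mult_single lact_single_single[OF act] mult add.assoc)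
    qed (simp_all add: biadditive_simps[OF biadditive_lact[OF act]])
  qed (simp_all add: algebra_simps biadditive_simps[OF biadditive_lact[OF act]])
qed (simp_all add: algebra_simps biadditive_simps[OF biadditive_lact[OF act]])

lemma lact_one:
  assumes act: "biadditive act" and one: "\<And>k. k \<in> keys f \<Longrightarrow> act 1 (lookup f k) = lookup f k"
  shows "lact act 1 f = f"
proof -
  have "lact act 1 f = plin (\<lambda>j y. single j (act 1 y)) f"
    unfolding lact_plin by (simp add: plin_def)
  also have "\<dots> = plin (\<lambda>j y. single j y) f" using one by (intro plin_cong) simp
  also have "\<dots> = f" by (simp add: plin_def sum_single_lookup)
  finally show ?thesis .
qed

lemma lact_commute:
  assumes act: "biadditive act" and act': "biadditive act'" and comm: "\<And>x y z. act x (act' y z) = act' y (act x z)"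
  shows "lact act a (lact act' b f) = lact act' b (lact act a f)"
proof (induction a rule: pm_induct)
  case (single i x)
  show ?case
  proof (induction b rule: pm_induct)
    case (single j y)
    show ?case
    proof (induction f rule: pm_induct)
      case (single k z)
      then show ?case by (simp add: lact_single_single[OF act] lact_single_single[OF act'] comm algebra_simps)
    qed (simp_all add: biadditive_simps[OF biadditive_lact[OF act]] biadditive_simps[OF biadditive_lact[OF act']])
  qed (simp_all add: biadditive_simps[OF biadditive_lact[OF act]] biadditive_simps[OF biadditive_lact[OF act']])
qed (simp_all add: biadditive_simps[OF biadditive_lact[OF act]] biadditive_simps[OF biadditive_lact[OF act']])

subsection \<open>Laurent polynomials: bar involution and degree bounds\<close>

lemma lookup_lbar: "lookup (lbar f) i = lookup f (- i)"
  unfolding lbar_def by (subst Poly_Mapping.map_key.rep_eq) auto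

lemma additive_lbar: "additive (lbar :: (int \<Rightarrow>\<^sub>0 'a::ab_group_add) \<Rightarrow> _)"
  by standard (rule poly_mapping_eqI, simp add: lookup_lbar lookup_add)

lemmas lbar_simps = additive.add[OF additive_lbar] additive.zero[OF additive_lbar]
  additive.minus[OF additive_lbar] additive.diff[OF additive_lbar]

lemma lbar_single [simp]: "lbar (single i a) = single (- i) a"
  by (rule poly_mapping_eqI) (auto simp: lookup_lbar lookup_single when_def)

lemma lbar_mult: "lbar (a * b) = lbar a * lbar b" for a b :: "int \<Rightarrow>\<^sub>0 'a::ring_1"
proof (induction a rule: pm_induct)
  case (single i x)
  show ?case
    by (induction b rule: pm_induct) (simp_all add: lbar_simps algebra_simps mult_single)
qed (simp_all add: lbar_simps algebra_simps)

text \<open>\<open>lnonneg\<close> and \<open>lpos\<close> are the cases \<open>k = 0\<close> and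
  \<open>k = 1\<close>. Further bounds occur because multiplication by \<open>C_s\<close> or a power
  of \<open>v\<close> shifts exponents; the bound \<open>1 - L s\<close> for \<open>\<mu>\<close> is
  the typical one.\<close>

definition lge :: "int \<Rightarrow> (int \<Rightarrow>\<^sub>0 'a::zero) set" where
  "lge k = {f. \<forall>i<k. lookup f i = 0}"

lemma lpos_eq_lge: "lpos = lge 1"
proof -
  have "(\<forall>\<gamma>\<in>keys f. \<gamma> > 0) = (\<forall>i<1. lookup f i = 0)" for f :: "int \<Rightarrow>\<^sub>0 'a::zero"
    by (metis in_keys_iff int_one_le_iff_zero_less linorder_not_less)
  then show ?thesis by (simp add: lpos_def lge_def)
qed

lemma lnonneg_eq_lge: "lnonneg = lge 0"
proof -
  have "(\<forall>\<gamma>\<in>keys f. \<gamma> \<ge> 0) = (\<forall>i<0. lookup f i = 0)" for f :: "int \<Rightarrow>\<^sub>0 'a::zero"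
    by (metis in_keys_iff linorder_not_less)
  then show ?thesis by (simp add: lnonneg_def lge_def)
qed

lemma lge_0 [simp]: "0 \<in> lge k"
  by (simp add: lge_def)

lemma lge_add: "f \<in> lge k \<Longrightarrow> g \<in> lge k \<Longrightarrow> f + g \<in> lge k" for f :: "int \<Rightarrow>\<^sub>0 'a::ab_group_add"
  by (simp add: lge_def lookup_add)

lemma lge_uminus: "f \<in> lge k \<Longrightarrow> - f \<in> lge k" for f :: "int \<Rightarrow>\<^sub>0 'a::ab_group_add"
  by (simp add: lge_def)

lemma lge_diff: "f \<in> lge k \<Longrightarrow> g \<in> lge k \<Longrightarrow> f - g \<in> lge k" for f :: "int \<Rightarrow>\<^sub>0 'a::ab_group_add"
  by (simp add: lge_def lookup_minus)

lemma lge_sum: "(\<And>i. i \<in> A \<Longrightarrow> f i \<in> lge k) \<Longrightarrow> sum f A \<in> lge k" for f :: "'b \<Rightarrow> int \<Rightarrow>\<^sub>0 'a::ab_group_add"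
  by (simp add: lge_def lookup_sum)

lemma lge_mono: "f \<in> lge k \<Longrightarrow> l \<le> k \<Longrightarrow> f \<in> lge l"
  by (simp add: lge_def)

lemma lge_single: "k \<le> i \<Longrightarrow> single i a \<in> lge k"
  by (auto simp: lge_def lookup_single when_def)

lemma lge_mult:
  fixes f g :: "int \<Rightarrow>\<^sub>0 'a::ring_1"
  assumes "f \<in> lge k" "g \<in> lge l" shows "f * g \<in> lge (k + l)"
proof -
  have "lookup (f * g) i = 0" if "i < k + l" for i
  proof (rule ccontr)
    assume "lookup (f * g) i \<noteq> 0"
    then have "i \<in> keys (f * g)" by (simp add: in_keys_iff)
    then obtain a b where "i = a + b" "a \<in> keys f" "b \<in> keys g" using keys_mult[of f g] by blast
    moreover have "a \<ge> k" "b \<ge> l"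
      using assms calculation by (auto simp: lge_def in_keys_iff intro: leI)
    ultimately show False using that by linarith
  qed
  then show ?thesis by (simp add: lge_def)
qed

lemma lge_mult':
  fixes f g :: "int \<Rightarrow>\<^sub>0 'a::ring_1"
  assumes "f \<in> lge k" "g \<in> lge l" "n = k + l" shows "f * g \<in> lge n"
  using lge_mult assms by blast

text \<open>The coefficients at \<open>i\<close> and \<open>- i\<close> agree, and one of these
  exponents is not positive. The uniqueness arguments rest on this, and nothing is divided by
  2.\<close>

lemma lge_lbar_zero:
  assumes "f \<in> lge 1" "lbar f = f" shows "f = 0"
proof (rule poly_mapping_eqI)
  fix i
  have "lookup f i = lookup f (- i)" using assms(2) lookup_lbar by metis
  moreover have "lookup f i = 0 \<or> lookup f (- i) = 0" using assms(1) by (cases "i < 1") (auto simp: lge_def)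
  ultimately show "lookup f i = lookup 0 i" by auto
qed

lemma vpow_commute: "vpow k * a = a * vpow k" for a :: "int \<Rightarrow>\<^sub>0 'a::ring_1"
  by (induction a rule: pm_induct) (simp_all add: mult_single algebra_simps)

lemma lookup_vpow_mult: "lookup (vpow k * a) i = lookup a (i - k)" for a :: "int \<Rightarrow>\<^sub>0 'a::ring_1"
  by (induction a rule: pm_induct) (auto simp: mult_single algebra_simps lookup_add lookup_single when_def)

lemma vpow_vpow: "vpow k * (vpow l * a) = vpow (k + l) * a" for a :: "int \<Rightarrow>\<^sub>0 'a::ring_1"
  by (simp add: mult.assoc[symmetric] mult_single)

lemma vpow_0: "vpow 0 = (1 :: int \<Rightarrow>\<^sub>0 'a::ring_1)"
  by simp

lemma lge_vpow_mult: "f \<in> lge k \<Longrightarrow> vpow l * f \<in> lge (l + k)" for f :: "int \<Rightarrow>\<^sub>0 'a::ring_1"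
  by (simp add: lge_def lookup_vpow_mult)

text \<open>A leading-term argument: it tolerates torsion and zero divisors among the coefficients
  because \<open>v^k + v^-k\<close> has leading coefficient 1.\<close>

lemma vpow_sum_cancel:
  fixes a :: "int \<Rightarrow>\<^sub>0 'a::ring_1"
  assumes "k > 0" "(vpow k + vpow (- k)) * a = 0" shows "a = 0"
proof (rule ccontr)
  assume "a \<noteq> 0"
  then have ne: "keys a \<noteq> {}" by simp
  define M where "M = Max (keys a)"
  \<comment> \<open>At \<open>M + k\<close> only the coefficients of \<open>a\<close> at
    \<open>M\<close> and \<open>M + 2 * k\<close> contribute, and the latter lies beyond the
    support.\<close>
  have "lookup ((vpow k + vpow (- k)) * a) (M + k) = 0" using assms by simp
  then have "lookup a M + lookup a (M + 2 * k) = 0"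
    by (simp add: distrib_right lookup_add lookup_vpow_mult algebra_simps)
  moreover have "lookup a (M + 2 * k) = 0"
    using Max_ge[of "keys a" "M + 2 * k"] assms(1) unfolding M_def
    by (auto simp: in_keys_iff)
  moreover have "lookup a M \<noteq> 0" using Max_in[OF _ ne] unfolding M_def by (simp add: in_keys_iff)
  ultimately show False by simp
qed

section \<open>Coxeter groups\<close>

declare in_listsD [rule del] in_listsI [rule del]

lemma lists_take [simp]: "ws \<in> lists A \<Longrightarrow> take i ws \<in> lists A"
  and lists_drop [simp]: "ws \<in> lists A \<Longrightarrow> drop i ws \<in> lists A"
  and lists_rev [simp]: "rev ws \<in> lists A \<longleftrightarrow> ws \<in> lists A"
  by (auto simp: in_lists_conv_set dest: in_set_takeD in_set_dropD)

lemma coxeter_system_group: "coxeter_system G S \<Longrightarrow> group G"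
  by (simp add: coxeter_system_def)

locale coxeter = group G for G :: "('w, 'q) monoid_scheme" (structure) +
  fixes S :: "'w set"
  assumes coxeter_system: "coxeter_system G S"
begin

abbreviation len :: "'w \<Rightarrow> nat" where "len \<equiv> cox_length G S"
abbreviation word :: "'w list \<Rightarrow> 'w" where "word \<equiv> wprod G"
abbreviation del :: "nat \<Rightarrow> 'w list \<Rightarrow> 'w list" where "del i ws \<equiv> take i ws @ drop (Suc i) ws"
abbreviation refls :: "'w set" where "refls \<equiv> reflections G S"

lemma S_closed [simp]: "s \<in> S \<Longrightarrow> s \<in> carrier G"
  and S_sq [simp]: "s \<in> S \<Longrightarrow> s \<otimes> s = \<one>"
  and S_gen: "generate G S = carrier G"
  and S_cong: "u \<in> lists S \<Longrightarrow> v \<in> lists S \<Longrightarrow> word u = word v \<Longrightarrow> coxeter_cong G S u v"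
  using coxeter_system unfolding coxeter_system_def by auto

lemma S_inv [simp]: "s \<in> S \<Longrightarrow> inv s = s"
  using inv_equality by auto

lemma inv_cancel [simp]:
  "x \<in> carrier G \<Longrightarrow> y \<in> carrier G \<Longrightarrow> inv x \<otimes> (x \<otimes> y) = y"
  "x \<in> carrier G \<Longrightarrow> y \<in> carrier G \<Longrightarrow> x \<otimes> (inv x \<otimes> y) = y"
  by (simp_all add: m_assoc[symmetric])

lemma S_cancel [simp]: "s \<in> S \<Longrightarrow> y \<in> carrier G \<Longrightarrow> s \<otimes> (s \<otimes> y) = y"
  by (simp add: m_assoc[symmetric])

lemma word_Nil [simp]: "word [] = \<one>" and word_Cons [simp]: "word (s # ws) = s \<otimes> word ws"
  by (simp_all add: wprod_def)

lemma word_closed [simp]: "ws \<in> lists S \<Longrightarrow> word ws \<in> carrier G"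
  by (induction ws) auto

lemma word_append [simp]: "u \<in> lists S \<Longrightarrow> v \<in> lists S \<Longrightarrow> word (u @ v) = word u \<otimes> word v"
  by (induction u) (auto simp: m_assoc)

lemma word_rev: "ws \<in> lists S \<Longrightarrow> word (rev ws) = inv (word ws)"
  by (induction ws) (auto simp: inv_mult_group)

lemma lists_del: "ws \<in> lists A \<Longrightarrow> del i ws \<in> lists A"
  by simp

lemma length_del: "i < length ws \<Longrightarrow> Suc (length (del i ws)) = length ws"
  by simp

lemma ex_word_generate:
  assumes "J \<subseteq> S" "w \<in> generate G J" shows "\<exists>ws\<in>lists J. word ws = w"
  using assms(2)
proof (induction rule: generate.induct)
  case one then show ?case by (intro bexI[of _ "[]"]) auto
next
  case (incl h) then show ?case using assms(1) by (intro bexI[of _ "[h]"]) auto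
next
  case (inv h) then show ?case using assms(1) by (intro bexI[of _ "[h]"]) (auto simp: subset_iff)
next
  case (eng h1 h2)
  then obtain u v where "u \<in> lists J" "v \<in> lists J" "word u = h1" "word v = h2" by blast
  moreover have "u \<in> lists S" "v \<in> lists S" using calculation lists_mono[OF assms(1)] by auto
  ultimately show ?case by (intro bexI[of _ "u @ v"]) auto
qed

lemma word_in_generate: "ws \<in> lists J \<Longrightarrow> word ws \<in> generate G J"
  by (induction ws) (auto intro: generate.intros)

lemma ex_word: "w \<in> carrier G \<Longrightarrow> \<exists>ws\<in>lists S. word ws = w"
  using ex_word_generate[of S] S_gen by auto

lemma len_le: "ws \<in> lists S \<Longrightarrow> len (word ws) \<le> length ws"
  unfolding cox_length_def by (rule Least_le) auto

lemma ex_reduced: assumes "w \<in> carrier G" shows "\<exists>ws. reduced_expr G S w ws"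
proof -
  obtain ws where "ws \<in> lists S" "word ws = w" using ex_word[OF assms] by auto
  then have "\<exists>n. \<exists>ws\<in>lists S. length ws = n \<and> word ws = w" by auto
  then have "\<exists>ws\<in>lists S. length ws = len w \<and> word ws = w"
    unfolding cox_length_def by (rule LeastI_ex)
  then show ?thesis unfolding reduced_expr_def by auto
qed

lemma reduced_exprE:
  assumes "w \<in> carrier G"
  obtains ws where "ws \<in> lists S" "word ws = w" "length ws = len w"
  using ex_reduced[OF assms] unfolding reduced_expr_def by auto

lemma len_one [simp]: "len \<one> = 0"
  using len_le[of "[]"] by simp

lemma len_mult_le: assumes "x \<in> carrier G" "y \<in> carrier G" shows "len (x \<otimes> y) \<le> len x + len y"
proof -
  obtain u v where "u \<in> lists S" "word u = x" "length u = len x" "v \<in> lists S" "word v = y" "length v = len y"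
    using assms reduced_exprE by metis
  then show ?thesis using len_le[of "u @ v"] by simp
qed

lemma len_inv_le: assumes "x \<in> carrier G" shows "len (inv x) \<le> len x"
proof -
  obtain u where "u \<in> lists S" "word u = x" "length u = len x" using assms reduced_exprE by metis
  then show ?thesis using len_le[of "rev u"] word_rev[of u] by simp
qed

lemma len_inv [simp]: "x \<in> carrier G \<Longrightarrow> len (inv x) = len x"
  using len_inv_le[of x] len_inv_le[of "inv x"] by simp

lemma len_S_le: "s \<in> S \<Longrightarrow> len s \<le> 1"
  using len_le[of "[s]"] by simp

lemma len_S_mult_le: "s \<in> S \<Longrightarrow> w \<in> carrier G \<Longrightarrow> len (s \<otimes> w) \<le> Suc (len w)"
  "s \<in> S \<Longrightarrow> w \<in> carrier G \<Longrightarrow> len (w \<otimes> s) \<le> Suc (len w)"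
  using len_mult_le[of s w] len_mult_le[of w s] len_S_le[of s] by auto

lemma len_eq_0: assumes "w \<in> carrier G" "len w = 0" shows "w = \<one>"
  using reduced_exprE[OF assms(1)] assms(2) by auto

subsection \<open>Reflections and the exchange condition\<close>

lemma reflsE:
  assumes "r \<in> refls" obtains w s where "r = w \<otimes> s \<otimes> inv w" "w \<in> carrier G" "s \<in> S"
  using assms unfolding reflections_def by blast

lemma refls_closed [simp]: "r \<in> refls \<Longrightarrow> r \<in> carrier G"
  by (auto simp: reflections_def)

lemma S_refls: "s \<in> S \<Longrightarrow> s \<in> refls"
  unfolding reflections_def by (rule CollectI, rule exI[of _ \<one>], rule exI[of _ s]) simp

lemma refls_sq [simp]: assumes "r \<in> refls" shows "r \<otimes> r = \<one>"
proof -
  obtain w s where "r = w \<otimes> s \<otimes> inv w" "w \<in> carrier G" "s \<in> S" using assms by (rule reflsE)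
  then show ?thesis by (simp add: m_assoc)
qed

lemma refls_cancel [simp]: "r \<in> refls \<Longrightarrow> y \<in> carrier G \<Longrightarrow> r \<otimes> (r \<otimes> y) = y"
  by (simp add: m_assoc[symmetric])

lemma refls_conj: "r \<in> refls \<Longrightarrow> g \<in> carrier G \<Longrightarrow> g \<otimes> r \<otimes> inv g \<in> refls"
proof -
  assume g: "g \<in> carrier G" and "r \<in> refls"
  then obtain w s where "r = w \<otimes> s \<otimes> inv w" "w \<in> carrier G" "s \<in> S" by (elim reflsE)
  then have "g \<otimes> r \<otimes> inv g = (g \<otimes> w) \<otimes> s \<otimes> inv (g \<otimes> w)" using g by (simp add: m_assoc inv_mult_group)
  then show ?thesis unfolding reflections_def using g \<open>w \<in> carrier G\<close> \<open>s \<in> S\<close> by blast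
qed

text \<open>The reflections \<open>s\<^sub>1 \<cdots> s\<^sub>i \<cdots> s\<^sub>1\<close> of a word; the parity of their multiplicities depends only on the
  group element.\<close>
primrec rl :: "'w list \<Rightarrow> 'w list" where
  "rl [] = []"
| "rl (s # ws) = s # map (\<lambda>t. s \<otimes> t \<otimes> s) (rl ws)"

lemma length_rl [simp]: "length (rl ws) = length ws"
  by (induction ws) auto

lemma rl_refls: "ws \<in> lists S \<Longrightarrow> set (rl ws) \<subseteq> refls"
proof (induction ws)
  case (Cons s ws)
  then have "s \<otimes> t \<otimes> s \<in> refls" if "t \<in> set (rl ws)" for t
    using refls_conj[of t s] that by auto
  then show ?case using Cons by (auto intro: S_refls)
qed simp

text \<open>The cocycle rule: a prefix conjugates the reflections of what follows it.\<close>

lemma rl_append: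
  assumes "u \<in> lists S" "v \<in> lists S"
  shows "rl (u @ v) = rl u @ map (\<lambda>t. word u \<otimes> t \<otimes> inv (word u)) (rl v)"
  using assms(1)
proof (induction u)
  case Nil
  have "map (\<lambda>t. \<one> \<otimes> t \<otimes> inv \<one>) (rl v) = map id (rl v)"
    using rl_refls[OF assms(2)] by (intro map_cong) auto
  then show ?case by simp
next
  case (Cons s u)
  have "s \<otimes> (word u \<otimes> t \<otimes> inv word u) \<otimes> s = (s \<otimes> word u) \<otimes> t \<otimes> inv (s \<otimes> word u)" if "t \<in> set (rl v)" for t
    using that rl_refls[OF assms(2)] Cons by (auto simp: m_assoc inv_mult_group subset_iff)
  then show ?case using Cons by (auto simp: comp_def)
qed

lemma count_conj:
  assumes "set xs \<subseteq> carrier G" "r \<in> carrier G" "g \<in> carrier G"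
  shows "count_list (map (\<lambda>t. g \<otimes> t \<otimes> inv g) xs) r = count_list xs (inv g \<otimes> r \<otimes> g)"
  using assms
proof (induction xs)
  case (Cons x xs)
  have "g \<otimes> x \<otimes> inv g = r \<longleftrightarrow> x = inv g \<otimes> r \<otimes> g"
    using Cons.prems by (auto simp: m_assoc)
  then show ?case using Cons by auto
qed simp

lemma count_rl_append:
  assumes "u \<in> lists S" "v \<in> lists S" "r \<in> carrier G"
  shows "count_list (rl (u @ v)) r = count_list (rl u) r + count_list (rl v) (inv (word u) \<otimes> r \<otimes> word u)"
proof -
  have "set (rl v) \<subseteq> carrier G" using rl_refls[OF assms(2)] by auto
  then show ?thesis using assms by (simp add: rl_append count_conj)
qed

lemma alt_word_Suc: "alt_word (Suc n) s t = s # alt_word n t s"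
  unfolding alt_word_def by (simp add: upt_conv_Cons map_Suc_upt[symmetric] del: upt_Suc)

lemma alt_word_0 [simp]: "alt_word 0 s t = []"
  by (simp add: alt_word_def)

lemma length_alt_word [simp]: "length (alt_word n s t) = n"
  by (simp add: alt_word_def)

lemma alt_word_lists [simp]: "s \<in> A \<Longrightarrow> t \<in> A \<Longrightarrow> alt_word n s t \<in> lists A"
  by (auto simp: alt_word_def in_lists_conv_set)

lemma pow_conj: "x \<in> carrier G \<Longrightarrow> y \<in> carrier G \<Longrightarrow> x \<otimes> (y \<otimes> x) [^] i = (x \<otimes> y) [^] i \<otimes> x" for i :: nat
proof (induction i)
  case (Suc i)
  have "x \<otimes> (y \<otimes> x) [^] Suc i = (x \<otimes> (y \<otimes> x) [^] i) \<otimes> (y \<otimes> x)" using Suc.prems by (simp add: m_assoc)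
  also have "\<dots> = (x \<otimes> y) [^] i \<otimes> (x \<otimes> y) \<otimes> x" using Suc by (simp add: m_assoc)
  finally show ?case by simp
qed simp

lemma rl_alt_word:
  assumes "s \<in> S" "t \<in> S"
  shows "rl (alt_word n s t) = map (\<lambda>i. (s \<otimes> t) [^] i \<otimes> s) [0..<n]"
  using assms
proof (induction n arbitrary: s t)
  case (Suc n)
  have *: "s \<otimes> (t \<otimes> s) [^] i = (s \<otimes> t) [^] i \<otimes> s" for i :: nat
    by (rule pow_conj) (use Suc.prems in auto)
  have "s \<otimes> ((t \<otimes> s) [^] i \<otimes> t) \<otimes> s = (s \<otimes> t) [^] Suc i \<otimes> s" for i :: nat
    using *[of i] Suc.prems by (simp add: m_assoc[symmetric])
  then show ?case using Suc
    by (simp add: alt_word_Suc upt_conv_Cons map_Suc_upt[symmetric] del: upt_Suc nat_pow_Suc)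
qed simp

lemma word_alt_even: "s \<in> S \<Longrightarrow> t \<in> S \<Longrightarrow> word (alt_word (2 * n) s t) = (s \<otimes> t) [^] n"
proof (induction n)
  case (Suc n)
  then have "word (alt_word (2 * Suc n) s t) = (s \<otimes> t) \<otimes> (s \<otimes> t) [^] n" by (simp add: alt_word_Suc m_assoc)
  then show ?case using Suc.prems by (metis S_closed m_closed nat_pow_Suc2)
qed simp

lemma word_alt_odd:
  assumes "s \<in> S" "t \<in> S" shows "word (alt_word (Suc (2 * n)) s t) = (s \<otimes> t) [^] n \<otimes> s"
  using word_alt_even[of t s n] pow_conj[of s t n] assms by (simp add: alt_word_Suc)

text \<open>Only the defining relators need checking. In the relator of length \<open>2 * m\<close>
  each \<open>(st)^i s\<close> with \<open>i < m\<close> occurs in both halves because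
  \<open>(st)^m = 1\<close>, so all multiplicities are even. The relator has value 1, hence the
  reflections contributed by the suffix do not change.\<close>

lemma cong_parity:
  assumes "coxeter_cong G S u v"
  shows "(u \<in> lists S \<longleftrightarrow> v \<in> lists S) \<and> (u \<in> lists S \<longrightarrow> word u = word v \<and>
    (\<forall>r\<in>carrier G. even (count_list (rl u) r) = even (count_list (rl v) r)))"
  using assms
proof (induction rule: coxeter_cong.induct)
  case (rel s t m u v)
  let ?a = "alt_word (2 * m) s t"
  have a: "?a \<in> lists S" using rel by simp
  have wa: "word ?a = \<one>" using rel word_alt_even by simp
  have "rl ?a = map (\<lambda>i. (s \<otimes> t) [^] i \<otimes> s) ([0..<m] @ map (\<lambda>i. i + m) [0..<m])"
    using rel rl_alt_word[of s t "2 * m"] upt_add_eq_append[of 0 m m]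
    by (simp add: mult_2 map_add_upt)
  also have "\<dots> = map (\<lambda>i. (s \<otimes> t) [^] i \<otimes> s) [0..<m] @ map (\<lambda>i. (s \<otimes> t) [^] i \<otimes> s) [0..<m]"
    using rel by (simp add: nat_pow_mult[symmetric])
  finally have "even (count_list (rl ?a) r)" for r by simp
  moreover have "word (u @ ?a) = word u" using rel a wa by simp
  ultimately have "even (count_list (rl (u @ ?a @ v)) r) = even (count_list (rl (u @ v)) r)" if "r \<in> carrier G" for r
    using rel a that count_rl_append[of "u @ ?a" v r] count_rl_append[of u ?a r] count_rl_append[of u v r]
    by simp
  then show ?case using rel a wa by simp
next
  case (sym u v) show ?case using sym.IH by (cases "u \<in> lists S") simp_all
next
  case (trans u v w) show ?case using trans.IH by (cases "u \<in> lists S") simp_all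
next
  case (refl u) show ?case by (intro conjI impI ballI HOL.refl)
qed

lemma word_parity:
  assumes "u \<in> lists S" "v \<in> lists S" "word u = word v" "r \<in> carrier G"
  shows "even (count_list (rl u) r) = even (count_list (rl v) r)"
  using cong_parity[OF S_cong[OF assms(1-3)]] assms by auto

text \<open>By \<open>word_parity\<close> every word for \<open>w\<close> gives the same answer.
  This is the reflection cocycle, which plays the part of the set of positive roots made
  negative.\<close>

definition inversion :: "'w \<Rightarrow> 'w \<Rightarrow> bool" where
  "inversion w r \<longleftrightarrow> (\<exists>ws\<in>lists S. word ws = w \<and> odd (count_list (rl ws) r))"

lemma inversion_word: "ws \<in> lists S \<Longrightarrow> r \<in> carrier G \<Longrightarrow> inversion (word ws) r = odd (count_list (rl ws) r)"
  unfolding inversion_def using word_parity by blast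

text \<open>For inversion sets: \<open>N(xy)\<close> is the symmetric difference of
  \<open>N(x)\<close> and \<open>x N(y) x^-1\<close>.\<close>

lemma inversion_mult:
  assumes "x \<in> carrier G" "y \<in> carrier G" "r \<in> carrier G"
  shows "inversion (x \<otimes> y) r = (inversion x r \<noteq> inversion y (inv x \<otimes> r \<otimes> x))"
proof -
  obtain u v where "u \<in> lists S" "word u = x" "v \<in> lists S" "word v = y"
    using assms ex_word by metis
  then show ?thesis using inversion_word[of u r] inversion_word[of v "inv x \<otimes> r \<otimes> x"] inversion_word[of "u @ v" r]
      count_rl_append[of u v r] assms by auto
qed

lemma inversion_S: "s \<in> S \<Longrightarrow> r \<in> carrier G \<Longrightarrow> inversion s r = (r = s)"
  using inversion_word[of "[s]" r] by auto

lemma inversion_one: "r \<in> carrier G \<Longrightarrow> \<not> inversion \<one> r"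
  using inversion_word[of "[]" r] by auto

text \<open>Split \<open>r = w s w^-1\<close> by the cocycle rule. The contributions of
  \<open>w\<close> and \<open>w^-1\<close> cancel, since their product 1 has no inversions, and what
  remains is that \<open>s\<close> is an inversion of itself.\<close>

lemma inversion_refl: assumes "r \<in> refls" shows "inversion r r"
proof -
  obtain w s where r: "r = w \<otimes> s \<otimes> inv w" and w: "w \<in> carrier G" and s: "s \<in> S"
    using assms by (rule reflsE)
  have "inv w \<otimes> r \<otimes> w = s" using w s by (simp add: r m_assoc)
  moreover have "inversion \<one> r = (inversion w r \<noteq> inversion (inv w) (inv w \<otimes> r \<otimes> w))"
    using inversion_mult[of w "inv w" r] w assms by simp
  moreover have "inversion r r = (inversion w r \<noteq> inversion (s \<otimes> inv w) (inv w \<otimes> r \<otimes> w))"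
    using inversion_mult[of w "s \<otimes> inv w" r] w s assms by (simp add: r m_assoc)
  moreover have "inversion (s \<otimes> inv w) s = (inversion s s \<noteq> inversion (inv w) s)"
    using inversion_mult[of s "inv w" s] w s by simp
  ultimately show ?thesis using inversion_S[of s s] inversion_one[of r] assms s by auto
qed

text \<open>The \<open>i\<close>-th reflection of the word is \<open>s_1 ... s_i ... s_1\<close>, so
  multiplying by it cancels the letter \<open>s_i\<close>.\<close>

lemma rl_deletion:
  assumes "ws \<in> lists S" "r \<in> set (rl ws)"
  shows "\<exists>i<length ws. r \<otimes> word ws = word (del i ws)"
  using assms
proof (induction ws arbitrary: r rule: list.induct)
  case (Cons s ws)
  show ?case
  proof (cases "r = s")
    case True
    then show ?thesis using Cons by (intro exI[of _ 0]) auto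
  next
    case False
    then obtain t where t: "t \<in> set (rl ws)" "r = s \<otimes> t \<otimes> s" using Cons.prems by auto
    then obtain i where i: "i < length ws" "t \<otimes> word ws = word (del i ws)" using Cons by auto
    have ws: "s \<in> S" "ws \<in> lists S" using Cons.prems by simp_all
    have "t \<in> carrier G" using t(1) rl_refls[OF ws(2)] by auto
    then have "r \<otimes> word (s # ws) = word (del (Suc i) (s # ws))"
      using Cons.prems t i by (auto simp: m_assoc)
    then show ?thesis using i by (intro exI[of _ "Suc i"]) auto
  qed
qed simp

lemma inversion_deletion:
  assumes "ws \<in> lists S" "r \<in> carrier G" "inversion (word ws) r"
  shows "\<exists>i<length ws. r \<otimes> word ws = word (del i ws)"
  using assms inversion_word[of ws r] count_list_0_iff[of "rl ws" r]
  by (intro rl_deletion) (auto intro: ccontr)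

lemma inversion_less: assumes "w \<in> carrier G" "r \<in> carrier G" "inversion w r" shows "len (r \<otimes> w) < len w"
proof -
  obtain ws where ws: "ws \<in> lists S" "word ws = w" "length ws = len w" using reduced_exprE[OF assms(1)] .
  obtain i where i: "i < length ws" "r \<otimes> w = word (del i ws)" using inversion_deletion[of ws r] ws assms by auto
  show ?thesis using len_le[OF lists_del[OF ws(1), of i]] length_del[OF i(1)] i(2) ws(3) by simp
qed

text \<open>As \<open>r\<close> is an inversion of itself, the cocycle rule makes it an inversion of
  exactly one of \<open>w\<close> and \<open>r w\<close>; so the previous bound applies to
  \<open>r w\<close>.\<close>

lemma not_inversion_less: assumes "w \<in> carrier G" "r \<in> refls" "\<not> inversion w r" shows "len w < len (r \<otimes> w)"
proof -
  have "inv r = r" using assms(2) by (intro inv_equality) auto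
  then have "inversion (r \<otimes> w) r" using inversion_mult[of r w r] inversion_refl[of r] assms by (simp add: m_assoc)
  then show ?thesis using inversion_less[of "r \<otimes> w" r] assms by simp
qed

lemma inversion_iff: "w \<in> carrier G \<Longrightarrow> r \<in> refls \<Longrightarrow> inversion w r \<longleftrightarrow> len (r \<otimes> w) < len w"
  using inversion_less[of w r] not_inversion_less[of w r] by fastforce

lemma refl_len_neq: "w \<in> carrier G \<Longrightarrow> r \<in> refls \<Longrightarrow> len (r \<otimes> w) \<noteq> len w"
  using inversion_less[of w r] not_inversion_less[of w r] by fastforce

text \<open>The strong exchange condition: \<open>r\<close> is any reflection and the word need not
  be reduced.\<close>

lemma exchange_left:
  assumes "ws \<in> lists S" "r \<in> refls" "len (r \<otimes> word ws) < len (word ws)"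
  shows "\<exists>i<length ws. r \<otimes> word ws = word (del i ws)"
  using assms inversion_deletion inversion_iff by auto

lemma refl_right_eq:
  assumes "w \<in> carrier G" "r \<in> refls"
  shows "w \<otimes> r = (w \<otimes> r \<otimes> inv w) \<otimes> w" "w \<otimes> r \<otimes> inv w \<in> refls"
  using assms refls_conj by (simp_all add: m_assoc)

lemma refl_right_len_neq: "w \<in> carrier G \<Longrightarrow> r \<in> refls \<Longrightarrow> len (w \<otimes> r) \<noteq> len w"
  using refl_len_neq refl_right_eq by metis

lemma exchange_right:
  assumes "ws \<in> lists S" "r \<in> refls" "len (word ws \<otimes> r) < len (word ws)"
  shows "\<exists>i<length ws. word ws \<otimes> r = word (del i ws)"
  using assms exchange_left[of ws "word ws \<otimes> r \<otimes> inv (word ws)"] refl_right_eq[of "word ws" r] by auto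

lemma len_S_left_cases:
  assumes "s \<in> S" "w \<in> carrier G"
  shows "len (s \<otimes> w) = Suc (len w) \<or> len w = Suc (len (s \<otimes> w))"
  using len_S_mult_le(1)[of s w] len_S_mult_le(1)[of s "s \<otimes> w"] refl_len_neq[of w s] assms S_refls[of s]
  by fastforce

lemma len_S_right_cases:
  assumes "s \<in> S" "w \<in> carrier G"
  shows "len (w \<otimes> s) = Suc (len w) \<or> len w = Suc (len (w \<otimes> s))"
proof -
  have "w \<otimes> s \<otimes> s = w" using assms by (simp add: m_assoc)
  then show ?thesis
    using len_S_mult_le(2)[of s w] len_S_mult_le(2)[of s "w \<otimes> s"] refl_right_len_neq[of w s] assms S_refls[of s]
    by fastforce
qed

text \<open>Exchange only deletes letters, so shortening a word in \<open>J\<close> never leaves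
  \<open>J\<close>. Hence the length function of \<open>(W_J, J)\<close> is the restriction of the
  given one.\<close>

lemma ex_reduced_generate:
  assumes "J \<subseteq> S" "w \<in> generate G J"
  shows "\<exists>ws\<in>lists J. word ws = w \<and> length ws = len w"
proof -
  have "ws \<in> lists J \<Longrightarrow> \<exists>us\<in>lists J. word us = word ws \<and> length us = len (word ws)" for ws
  proof (induction "length ws" arbitrary: ws rule: less_induct)
    case less
    show ?case
    proof (cases "length ws = len (word ws)")
      case True then show ?thesis using less.prems by auto
    next
      case False
      have wsS: "ws \<in> lists S" using less.prems lists_mono[OF assms(1)] by auto
      have "\<exists>us\<in>lists J. length us < length ws \<and> word us = word ws"
        using less.prems wsS False
      proof (induction ws rule: list.induct)
        case (Cons s v)
        have v: "v \<in> lists J" "v \<in> lists S" "s \<in> J" "s \<in> S" using Cons.prems by auto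
        show ?case
        proof (cases "length v = len (word v)")
          \<comment> \<open>With a reduced tail \<open>v\<close>, the letter \<open>s\<close> must
            shorten the value of \<open>v\<close>; exchange then absorbs \<open>s\<close> by
            deleting a letter of \<open>v\<close>.\<close>
          case True
          have "len (word (s # v)) < Suc (len (word v))"
            using Cons.prems True len_le[of "s # v"] by auto
          then have "len (s \<otimes> word v) < len (word v)" using len_S_left_cases[of s "word v"] v by auto
          then obtain i where "i < length v" "s \<otimes> word v = word (del i v)"
            using exchange_left[of v s] v S_refls by auto
          then show ?thesis using lists_del[OF v(1), of i] by (intro bexI[of _ "del i v"]) auto
        next
          case False
          then obtain us where "us \<in> lists J" "length us < length v" "word us = word v" using Cons.IH v by auto
          then show ?thesis using v by (intro bexI[of _ "s # us"]) auto
        qed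
      qed simp
      then show ?thesis using less.hyps by metis
    qed
  qed
  then show ?thesis using ex_word_generate[OF assms] by metis
qed

subsection \<open>Matsumoto's theorem\<close>

lemma count_list_distinct: "distinct xs \<Longrightarrow> x \<in> set xs \<Longrightarrow> count_list xs x = 1"
  by (induction xs) auto

text \<open>A multiplicity of 1 is odd, so by \<open>word_parity\<close> each reflection of the word
  also occurs for a shortest expression, which therefore has at least as many letters.\<close>

lemma distinct_rl_reduced:
  assumes "ws \<in> lists S" "distinct (rl ws)" shows "len (word ws) = length ws"
proof -
  obtain u where u: "u \<in> lists S" "word u = word ws" "length u = len (word ws)"
    using reduced_exprE[of "word ws"] assms by auto
  have "set (rl ws) \<subseteq> set (rl u)"
  proof
    fix r assume r: "r \<in> set (rl ws)"
    then have "count_list (rl ws) r = 1" using assms(2) by (intro count_list_distinct)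
    then have "odd (count_list (rl u) r)"
      using word_parity[OF u(1) assms(1) u(2), of r] r rl_refls[OF assms(1)] by auto
    then show "r \<in> set (rl u)" using count_list_0_iff[of "rl u" r] by (auto intro: ccontr)
  qed
  then have "card (set (rl ws)) \<le> card (set (rl u))" by (intro card_mono) auto
  also have "\<dots> \<le> length u" using card_length[of "rl u"] by simp
  finally have "length ws \<le> length u" using distinct_card[OF assms(2)] by simp
  then show ?thesis using u(3) len_le[OF assms(1)] by simp
qed

lemma alt_word_reduced:
  assumes "s \<in> S" "t \<in> S" "ord (s \<otimes> t) = 0 \<or> n \<le> ord (s \<otimes> t)"
  shows "len (word (alt_word n s t)) = n"
proof -
  have False if "i < j" "j < n" "(s \<otimes> t) [^] i \<otimes> s = (s \<otimes> t) [^] j \<otimes> s" for i j :: nat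
  proof -
    have "(s \<otimes> t) [^] i \<otimes> \<one> = (s \<otimes> t) [^] i \<otimes> (s \<otimes> t) [^] (j - i)"
      using that assms nat_pow_mult[of "s \<otimes> t" i "j - i"] by simp
    then have "(s \<otimes> t) [^] (j - i) = \<one>" using assms by (metis S_closed inv_cancel(1) m_closed nat_pow_closed one_closed)
    then have "ord (s \<otimes> t) dvd j - i" using pow_eq_id assms by simp
    then show False using assms(3) that by (auto dest: dvd_imp_le)
  qed
  then have "inj_on (\<lambda>i. (s \<otimes> t) [^] i \<otimes> s) {0..<n}"
    by (intro linorder_inj_onI') force+
  then have "distinct (rl (alt_word n s t))" using assms by (simp add: rl_alt_word distinct_map)
  then show ?thesis using distinct_rl_reduced[of "alt_word n s t"] assms by simp
qed

lemma ord_commute: assumes "s \<in> S" "t \<in> S" shows "ord (t \<otimes> s) = ord (s \<otimes> t)"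
  using ord_inv[of "s \<otimes> t"] assms by (simp add: inv_mult_group)

lemma word_alt_braid:
  assumes "s \<in> S" "t \<in> S"
  shows "word (alt_word (ord (s \<otimes> t)) s t) = word (alt_word (ord (s \<otimes> t)) t s)"
proof -
  define m where "m = ord (s \<otimes> t)"
  have one: "(s \<otimes> t) [^] m = \<one>" using assms unfolding m_def by simp
  have inv: "(t \<otimes> s) [^] k = inv ((s \<otimes> t) [^] k)" for k :: nat
    using nat_pow_inv[of "s \<otimes> t" k] assms by (simp add: inv_mult_group)
  show ?thesis
  proof (cases "even m")
    case True
    then obtain k where k: "m = 2 * k" by (auto elim: evenE)
    have "(s \<otimes> t) [^] k \<otimes> (s \<otimes> t) [^] k = \<one>" using one assms by (simp add: k nat_pow_mult mult_2)
    then have "(s \<otimes> t) [^] k = inv ((s \<otimes> t) [^] k)" using assms by (intro inv_equality[symmetric]) auto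
    then show ?thesis using assms inv[of k] by (simp add: m_def[symmetric] k word_alt_even)
  next
    case False
    then obtain k where k: "m = Suc (2 * k)" by (auto elim: oddE)
    have "(s \<otimes> t) [^] k \<otimes> (s \<otimes> t) \<otimes> (s \<otimes> t) [^] k = \<one>"
    proof -
      have "(s \<otimes> t) [^] (Suc k + k) = \<one>" using one k by (simp add: mult_2)
      then show ?thesis using assms by (subst (asm) nat_pow_mult[symmetric]) auto
    qed
    then have "((s \<otimes> t) [^] k \<otimes> (s \<otimes> t)) = inv ((s \<otimes> t) [^] k)" using assms by (intro inv_equality[symmetric]) auto
    then have "(s \<otimes> t) [^] k \<otimes> s \<otimes> t \<otimes> t = inv ((s \<otimes> t) [^] k) \<otimes> t" using assms by (simp add: m_assoc)
    then have "(s \<otimes> t) [^] k \<otimes> s = (t \<otimes> s) [^] k \<otimes> t" using assms by (simp add: inv m_assoc)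
    then show ?thesis using assms by (simp add: m_def[symmetric] k word_alt_odd)
  qed
qed

text \<open>Induction on \<open>n\<close> with the roles of \<open>s\<close> and \<open>t\<close>
  exchanged: start from an expression beginning with the alternating word that opens with
  \<open>t\<close> and apply exchange with \<open>s\<close>. The deleted letter lies behind the
  alternating prefix.\<close>

lemma dihedral_descent:
  assumes st: "s \<in> S" "t \<in> S" and w: "w \<in> carrier G" and d: "len (s \<otimes> w) < len w" "len (t \<otimes> w) < len w"
    and n: "ord (s \<otimes> t) = 0 \<or> n \<le> ord (s \<otimes> t)"
  shows "\<exists>rest\<in>lists S. reduced_expr G S w (alt_word n s t @ rest)"
  using st d n
proof (induction n arbitrary: s t)
  case 0
  then show ?case using ex_reduced[OF w] by (auto simp: reduced_expr_def)
next
  case (Suc k)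
  have "ord (t \<otimes> s) = 0 \<or> k \<le> ord (t \<otimes> s)" using Suc.prems ord_commute by auto
  then obtain rest where rest: "rest \<in> lists S" "reduced_expr G S w (alt_word k t s @ rest)"
    using Suc by metis
  let ?a = "alt_word k t s"
  have wd: "word (?a @ rest) = w" "k + length rest = len w" using rest by (auto simp: reduced_expr_def)
  have a: "?a \<in> lists S" using Suc.prems by simp
  have "\<exists>i<length (?a @ rest). s \<otimes> word (?a @ rest) = word (del i (?a @ rest))"
    using Suc.prems S_refls rest(1) a wd by (intro exchange_left) auto
  then obtain i where i: "i < k + length rest" "s \<otimes> w = word (del i (?a @ rest))" using wd by auto
  \<comment> \<open>A deletion inside the prefix would shorten the alternating word of length
    \<open>Suc k\<close>, which is reduced by the bound on \<open>n\<close>.\<close>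
  have "\<not> i < k"
  proof
    assume "i < k"
    then have "s \<otimes> (word ?a \<otimes> word rest) = word (del i ?a) \<otimes> word rest"
      using i wd(1) rest(1) a by (simp add: m_assoc)
    then have "s \<otimes> word ?a = word (del i ?a)"
      using a rest Suc.prems lists_del[OF a, of i] by (simp add: m_assoc[symmetric] del: word_append)
    then have "word (alt_word (Suc k) s t) = word (del i ?a)" by (simp add: alt_word_Suc)
    then have "Suc k \<le> length (del i ?a)"
      using alt_word_reduced[of s t "Suc k"] len_le[OF lists_del[OF a, of i]] Suc.prems by simp
    then show False using \<open>i < k\<close> by simp
  qed
  then have "del i (?a @ rest) = ?a @ del (i - k) rest" using i by (simp add: Suc_diff_le)
  then have "s \<otimes> w = word (?a @ del (i - k) rest)" using i by simp
  then have "w = word (s # ?a @ del (i - k) rest)" using Suc.prems w by (metis S_cancel word_Cons)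
  then have "word (alt_word (Suc k) s t @ del (i - k) rest) = w" by (simp add: alt_word_Suc)
  moreover have "length (alt_word (Suc k) s t @ del (i - k) rest) = len w"
    using i(1) wd(2) \<open>\<not> i < k\<close> by simp
  moreover have "alt_word (Suc k) s t @ del (i - k) rest \<in> lists S" using Suc.prems rest(1) by simp
  ultimately have "reduced_expr G S w (alt_word (Suc k) s t @ del (i - k) rest)"
    unfolding reduced_expr_def by blast
  then show ?case using lists_del[OF rest(1), of "i - k"] by blast
qed

lemma prod_list_alt_word: "prod_list (map f (alt_word n s t)) = alt_prod n (f s) (f t)"
  by (induction n arbitrary: s t) (auto simp: alt_word_Suc)

lemma reduced_tail:
  assumes "reduced_expr G S w (s # u)"
  shows "reduced_expr G S (s \<otimes> w) u" "s \<in> S" "u \<in> lists S" "w \<in> carrier G" "len (s \<otimes> w) < len w" "w = s \<otimes> word u"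
proof -
  have *: "s \<in> S" "u \<in> lists S" "w = s \<otimes> word u" "Suc (length u) = len w" using assms by (auto simp: reduced_expr_def)
  then have "word u = s \<otimes> w" "w \<in> carrier G" by auto
  moreover from this have "len (s \<otimes> w) = length u" using len_le[of u] len_S_left_cases[of s w] * by auto
  ultimately show "reduced_expr G S (s \<otimes> w) u" "s \<in> S" "u \<in> lists S" "w \<in> carrier G" "len (s \<otimes> w) < len w" "w = s \<otimes> word u"
    using * by (auto simp: reduced_expr_def)
qed

text \<open>Expressions with the same first letter are compared by induction. For different first
  letters \<open>s\<close> and \<open>t\<close>, pass through the two reduced expressions that begin
  with the full alternating words; they share their remaining letters and differ by a single braid
  move.\<close>

theorem matsumoto:
  fixes f :: "'w \<Rightarrow> 'h::monoid_mult"
  assumes braid: "\<And>s t. s \<in> S \<Longrightarrow> t \<in> S \<Longrightarrow> ord (s \<otimes> t) \<noteq> 0 \<Longrightarrow>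
      alt_prod (ord (s \<otimes> t)) (f s) (f t) = alt_prod (ord (s \<otimes> t)) (f t) (f s)"
    and "reduced_expr G S w u" "reduced_expr G S w v"
  shows "prod_list (map f u) = prod_list (map f v)"
  using assms(2-)
proof (induction "length u" arbitrary: w u v rule: less_induct)
  case less
  have luv: "length u = length v" using less.prems by (simp add: reduced_expr_def)
  show ?case
  proof (cases u)
    case Nil then show ?thesis using luv by simp
  next
    case (Cons s u')
    then obtain t v' where v: "v = t # v'" using luv by (cases v) auto
    note u = Cons
    have ru: "reduced_expr G S (s \<otimes> w) u'" "s \<in> S" "len (s \<otimes> w) < len w" "w \<in> carrier G"
      using reduced_tail[of w s u'] less.prems u by auto
    have rv: "reduced_expr G S (t \<otimes> w) v'" "t \<in> S" "len (t \<otimes> w) < len w"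
      using reduced_tail[of w t v'] less.prems v by auto
    have same_head: "prod_list (map f (a # x)) = prod_list (map f (a # y))"
      if "reduced_expr G S w (a # x)" "reduced_expr G S w (a # y)" for a x y
    proof -
      have "length x < length u" using that(1) less.prems(1) by (auto simp: reduced_expr_def)
      then show ?thesis
        using less.hyps[of x "a \<otimes> w" y] reduced_tail(1)[OF that(1)] reduced_tail(1)[OF that(2)] by simp
    qed
    show ?thesis
    proof (cases "s = t")
      case True then show ?thesis using same_head[of s u' v'] less.prems u v by simp
    next
      case False
      define m where "m = ord (s \<otimes> t)"
      \<comment> \<open>Infinite order would give a reduced expression of \<open>w\<close> whose
        alternating prefix is longer than \<open>w\<close>.\<close>
      have m0: "m \<noteq> 0"
      proof
        assume "m = 0"
        then obtain rest where "reduced_expr G S w (alt_word (Suc (len w)) s t @ rest)"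
          using dihedral_descent[of s t w "Suc (len w)"] ru rv by (auto simp: m_def)
        then show False by (simp add: reduced_expr_def)
      qed
      then obtain k where k: "m = Suc k" by (cases m) auto
      obtain rest where rest: "rest \<in> lists S" "reduced_expr G S w (alt_word m s t @ rest)"
        using dihedral_descent[of s t w m] ru rv by (auto simp: m_def)
      then have rest': "reduced_expr G S w (alt_word m t s @ rest)"
        using ru rv word_alt_braid[of s t] by (auto simp: reduced_expr_def m_def)
      have "prod_list (map f u) = prod_list (map f (alt_word m s t @ rest))"
        using same_head[of s u' "alt_word k t s @ rest"] rest less.prems u by (simp add: k alt_word_Suc)
      also have "\<dots> = prod_list (map f (alt_word m t s @ rest))"
        using braid[of s t] ru rv m0 by (simp add: prod_list_alt_word m_def)
      also have "\<dots> = prod_list (map f v)"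
        using same_head[of t "alt_word k s t @ rest" v'] rest' less.prems v by (simp add: k alt_word_Suc)
      finally show ?thesis .
    qed
  qed
qed

end

subsection \<open>Bruhat order\<close>

context coxeter
begin

abbreviation ble :: "'w \<Rightarrow> 'w \<Rightarrow> bool" where "ble \<equiv> bruhat_le G S"
abbreviation bless :: "'w \<Rightarrow> 'w \<Rightarrow> bool" where "bless \<equiv> bruhat_less G S"

lemma ble_refl [simp]: "ble w w"
  by (simp add: bruhat_le_def)

lemma ble_trans: "ble u v \<Longrightarrow> ble v w \<Longrightarrow> ble u w"
  unfolding bruhat_le_def by (rule rtranclp_trans)

lemma ble_reflection: "u \<in> carrier G \<Longrightarrow> r \<in> refls \<Longrightarrow> len u < len (u \<otimes> r) \<Longrightarrow> ble u (u \<otimes> r)"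
  unfolding bruhat_le_def by (rule r_into_rtranclp) blast

lemma ble_cases: assumes "ble u w" shows "u = w \<or> (u \<in> carrier G \<and> w \<in> carrier G \<and> len u < len w)"
  using assms unfolding bruhat_le_def
proof (induction rule: rtranclp_induct)
  case (step y z)
  then have "z \<in> carrier G" by auto
  then show ?case using step by auto
qed simp

lemma ble_len: "ble u w \<Longrightarrow> len u \<le> len w"
  using ble_cases[of u w] by auto

lemma bless_len: "bless u w \<Longrightarrow> len u < len w"
  using ble_cases[of u w] unfolding bruhat_less_def by auto

lemma ble_iff: "ble u w \<longleftrightarrow> u = w \<or> bless u w"
  by (auto simp: bruhat_less_def)

lemma bless_irrefl [simp]: "\<not> bless w w"
  by (simp add: bruhat_less_def)

lemma bless_trans: "bless u v \<Longrightarrow> ble v w \<Longrightarrow> bless u w" "ble u v \<Longrightarrow> bless v w \<Longrightarrow> bless u w"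
  using ble_trans bless_len ble_len unfolding bruhat_less_def by (metis linorder_not_less)+

lemma left_as_reflection:
  assumes "s \<in> S" "w \<in> carrier G"
  shows "s \<otimes> w = w \<otimes> (inv w \<otimes> s \<otimes> w)" "inv w \<otimes> s \<otimes> w \<in> refls"
  using assms refls_conj[OF S_refls[of s], of "inv w"] by (simp_all add: m_assoc)

lemma bless_left: "s \<in> S \<Longrightarrow> w \<in> carrier G \<Longrightarrow> bless w (s \<otimes> w) \<longleftrightarrow> len w < len (s \<otimes> w)"
  using bless_len[of w "s \<otimes> w"] ble_reflection[of w "inv w \<otimes> s \<otimes> w"] left_as_reflection[of s w]
  unfolding bruhat_less_def by auto

lemma bless_left': "s \<in> S \<Longrightarrow> w \<in> carrier G \<Longrightarrow> bless (s \<otimes> w) w \<longleftrightarrow> len (s \<otimes> w) < len w"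
  using bless_left[of s "s \<otimes> w"] by simp

text \<open>The lifting property for one step of the Bruhat order. If left multiplication by
  \<open>s\<close> reverses the lengths, these are determined up to the length of \<open>u\<close>,
  and exchange in a reduced expression of \<open>u r\<close> that starts with \<open>s\<close> must
  remove that \<open>s\<close>.\<close>

lemma left_mult_reflection:
  assumes s: "s \<in> S" and u: "u \<in> carrier G" and r: "r \<in> refls" and less: "len u < len (u \<otimes> r)"
  shows "ble (s \<otimes> u) (s \<otimes> (u \<otimes> r)) \<or> s \<otimes> u = u \<otimes> r"
proof (cases "len (s \<otimes> u) < len (s \<otimes> (u \<otimes> r))")
  case True
  then show ?thesis using ble_reflection[of "s \<otimes> u" r] s u r by (simp add: m_assoc)
next
  case False
  define y where "y = u \<otimes> r"
  have y: "y \<in> carrier G" "u = y \<otimes> r" using u r by (simp_all add: y_def m_assoc)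
  have "len (s \<otimes> y) \<noteq> len (s \<otimes> u)"
    using refl_right_len_neq[of "s \<otimes> u" r] s u r by (simp add: y_def m_assoc)
  then have "len (s \<otimes> y) < len (s \<otimes> u)" using False by (simp add: y_def)
  then have l: "len (s \<otimes> y) = len u" "len y = Suc (len u)" "len (s \<otimes> u) = Suc (len u)"
    using len_S_left_cases[of s u] len_S_left_cases[of s y] s u y less[folded y_def] by auto
  obtain v where v: "v \<in> lists S" "word v = s \<otimes> y" "length v = len u"
    using reduced_exprE[of "s \<otimes> y"] s y l by auto
  have wy: "word (s # v) = y" using v s y by simp
  have "\<exists>i<length (s # v). word (s # v) \<otimes> r = word (del i (s # v))"
  proof (rule exchange_right)
    show "s # v \<in> lists S" using v s by simp
    show "len (word (s # v) \<otimes> r) < len (word (s # v))" unfolding wy y(2)[symmetric] using l by simp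
  qed (rule r)
  then obtain i where i: "i < length (s # v)" "u = word (del i (s # v))"
    unfolding wy y(2)[symmetric] by blast
  \<comment> \<open>Deleting a letter behind the leading \<open>s\<close> would make
    \<open>s \<otimes> u\<close> no longer than \<open>u\<close>.\<close>
  have "i = 0"
  proof (cases i)
    case (Suc k)
    then have "u = s \<otimes> word (del k v)" using i by simp
    then have "s \<otimes> u = word (del k v)" using s v(1) lists_del[of v S k] by simp
    then have "len (s \<otimes> u) \<le> length (del k v)" using len_le[of "del k v"] v(1) by simp
    moreover have "length (del k v) \<le> len u" using v(3) by simp
    ultimately show ?thesis using l(3) by linarith
  qed simp
  then have "u = s \<otimes> y" using i(2) v(2) by simp
  then have "s \<otimes> u = y" using S_cancel[OF s y(1)] by (rule ssubst)
  then show ?thesis unfolding y_def by (rule disjI2)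
qed

lemma ble_left_mult:
  assumes "ble u w" "s \<in> S" "w \<in> carrier G"
  shows "ble (s \<otimes> u) w \<or> ble (s \<otimes> u) (s \<otimes> w)"
  using assms(1) unfolding bruhat_le_def
proof (induction rule: converse_rtranclp_induct)
  case base then show ?case by simp
next
  case (step u y)
  then obtain r where r: "r \<in> refls" "y = u \<otimes> r" "u \<in> carrier G" "len u < len y" by auto
  have "ble y w" using step(2) by (simp add: bruhat_le_def)
  then show ?case
    using left_mult_reflection[OF assms(2) r(3) r(1)] r ble_trans step(3) unfolding bruhat_le_def[symmetric] by metis
qed

lemma ble_left_mult_up:
  assumes "ble u w" "s \<in> S" "w \<in> carrier G" "len w < len (s \<otimes> w)"
  shows "ble (s \<otimes> u) (s \<otimes> w)" "ble u (s \<otimes> w)"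
proof -
  have *: "ble w (s \<otimes> w)" using bless_left[of s w] assms by (simp add: bruhat_less_def)
  then show "ble (s \<otimes> u) (s \<otimes> w)" using ble_left_mult[OF assms(1-3)] ble_trans by blast
  show "ble u (s \<otimes> w)" using * assms(1) ble_trans by blast
qed

text \<open>By exchange every immediate predecessor of \<open>w\<close> arises from one fixed word
  by deleting a letter, so there are finitely many; the rest is induction on the length.\<close>

lemma finite_below: assumes "w \<in> carrier G" shows "finite {u. ble u w}"
  using assms
proof (induction "len w" arbitrary: w rule: less_induct)
  case less
  define B where "B = {u \<in> carrier G. \<exists>r\<in>refls. w = u \<otimes> r \<and> len u < len w}"
  obtain ws where ws: "ws \<in> lists S" "word ws = w" using ex_word[OF less.prems] by auto
  have "B \<subseteq> (\<lambda>i. word (del i ws)) ` {..<length ws}"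
  proof
    fix u assume "u \<in> B"
    then obtain r where r: "r \<in> refls" "u \<in> carrier G" "w = u \<otimes> r" "len u < len w" by (auto simp: B_def)
    then have "u = w \<otimes> r" by (simp add: m_assoc)
    moreover have "\<exists>i<length ws. word ws \<otimes> r = word (del i ws)"
      by (rule exchange_right) (use ws r \<open>u = w \<otimes> r\<close>[symmetric] in simp_all)
    ultimately obtain i where "i < length ws" "u = word (del i ws)" unfolding ws(2) by auto
    then show "u \<in> (\<lambda>i. word (del i ws)) ` {..<length ws}" by blast
  qed
  then have B: "finite B" by (rule finite_subset) simp
  have "{u. ble u w} \<subseteq> insert w (\<Union>y\<in>B. {u. ble u y})"
  proof
    fix u assume "u \<in> {u. ble u w}"
    then have "ble u w" by simp
    then show "u \<in> insert w (\<Union>y\<in>B. {u. ble u y})"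
    proof (cases "u = w")
      case False
      then obtain y where "ble u y" "y \<in> B"
        using \<open>ble u w\<close> unfolding bruhat_le_def B_def by (auto elim: rtranclp.cases)
      then show ?thesis by blast
    qed simp
  qed
  moreover have "finite (\<Union>y\<in>B. {u. ble u y})" using B less.hyps by (auto simp: B_def)
  ultimately show ?case by (meson finite.insertI finite_subset)
qed

end

subsection \<open>Minimal coset representatives\<close>

locale parabolic = coxeter +
  fixes J :: "'a set"
  assumes J_subset: "J \<subseteq> S"
begin

abbreviation WJ :: "'a set" where "WJ \<equiv> generate G J"
abbreviation D :: "'a set" where "D \<equiv> coset_reps G S J"

lemma J_S [simp]: "s \<in> J \<Longrightarrow> s \<in> S"
  using J_subset by auto

lemma WJ_subgroup: "subgroup WJ G"
  using J_subset by (intro generate_is_subgroup) auto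

lemma WJ_closed [simp]: "y \<in> WJ \<Longrightarrow> y \<in> carrier G"
  using subgroup.mem_carrier[OF WJ_subgroup] .

lemma WJ_mult [simp]: "x \<in> WJ \<Longrightarrow> y \<in> WJ \<Longrightarrow> x \<otimes> y \<in> WJ"
  using subgroup.m_closed[OF WJ_subgroup] .

lemma WJ_inv [simp]: "x \<in> WJ \<Longrightarrow> inv x \<in> WJ"
  using subgroup.m_inv_closed[OF WJ_subgroup] .

lemma WJ_one [simp]: "\<one> \<in> WJ"
  using subgroup.one_closed[OF WJ_subgroup] .

lemma J_WJ [simp]: "s \<in> J \<Longrightarrow> s \<in> WJ"
  by (rule generate.incl)

lemma lists_J_S: "ws \<in> lists J \<Longrightarrow> ws \<in> lists S"
  using lists_mono[OF J_subset] by auto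

lemma WJ_reducedE:
  assumes "y \<in> WJ" obtains ws where "ws \<in> lists J" "ws \<in> lists S" "word ws = y" "length ws = len y"
  using ex_reduced_generate[OF J_subset assms] lists_J_S by auto

text \<open>Apply exchange to a reduced word of \<open>x\<close> followed by one in
  \<open>J\<close>: deleting a letter of the first would give a shorter element of the coset,
  deleting one of the second would contradict its reducedness.\<close>

lemma minimal_in_coset_len:
  assumes x: "x \<in> carrier G" and min: "\<And>y. y \<in> WJ \<Longrightarrow> len x \<le> len (x \<otimes> y)" and y: "y \<in> WJ"
  shows "len (x \<otimes> y) = len x + len y"
proof -
  obtain u where u: "u \<in> lists S" "word u = x" "length u = len x" using reduced_exprE[OF x] .
  have "ws \<in> lists J \<Longrightarrow> length ws = len (word ws) \<Longrightarrow> len (x \<otimes> word ws) = len x + length ws" for ws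
  proof (induction ws rule: rev_induct)
    case Nil then show ?case using x by simp
  next
    case (snoc t ws)
    have ws: "ws \<in> lists J" "ws \<in> lists S" "t \<in> J" "t \<in> S" "word ws \<in> carrier G" "word ws \<in> WJ"
      using snoc.prems lists_J_S word_in_generate by auto
    have "length ws = len (word ws)"
      using len_S_right_cases[of t "word ws"] len_le[of ws] snoc.prems ws by auto
    then have IH: "len (x \<otimes> word ws) = len x + length ws" using snoc.IH ws by simp
    have "\<not> len (x \<otimes> word ws \<otimes> t) < len (x \<otimes> word ws)"
    proof
      assume "len (x \<otimes> word ws \<otimes> t) < len (x \<otimes> word ws)"
      then obtain i where i: "i < length (u @ ws)" "x \<otimes> word ws \<otimes> t = word (del i (u @ ws))"
        using exchange_right[of "u @ ws" t] u ws S_refls by auto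
      show False
      proof (cases "i < length u")
        case True
        then have "x \<otimes> word ws \<otimes> t = word (del i u) \<otimes> word ws" using i u ws by (simp add: m_assoc)
        then have "word (del i u) = x \<otimes> word ws \<otimes> t \<otimes> inv (word ws)"
          using u ws x lists_del[of u S i] by (simp add: m_assoc del: word_append)
        then have "word (del i u) = x \<otimes> (word ws \<otimes> t \<otimes> inv (word ws))" using x ws by (simp add: m_assoc)
        then have "len x \<le> len (word (del i u))" using min[of "word ws \<otimes> t \<otimes> inv (word ws)"] ws by simp
        then show False using len_le[OF lists_del[OF u(1), of i]] u True by simp
      next
        case False
        then have "del i (u @ ws) = u @ del (i - length u) ws" by (simp add: Suc_diff_le)
        then have "x \<otimes> word ws \<otimes> t = x \<otimes> word (del (i - length u) ws)"
          using i u ws lists_del[of ws S "i - length u"] by (simp del: append_take_drop_id)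
        then have "word ws \<otimes> t = word (del (i - length u) ws)"
          using x ws lists_del[of ws S "i - length u"] by (simp add: m_assoc del: word_append)
        then have "len (word ws \<otimes> t) \<le> length (del (i - length u) ws)"
          using len_le[OF lists_del[OF ws(2), of "i - length u"]] by simp
        then show False using snoc.prems ws i False by simp
      qed
    qed
    then show ?case using len_S_right_cases[of t "x \<otimes> word ws"] IH ws x by (simp add: m_assoc)
  qed
  then show ?thesis using WJ_reducedE[OF y] by metis
qed

lemma ex_minimal_in_coset:
  assumes x: "x \<in> carrier G"
  shows "\<exists>x0\<in>carrier G. \<exists>y\<in>WJ. x = x0 \<otimes> y \<and> (\<forall>y\<in>WJ. len x0 \<le> len (x0 \<otimes> y))"
proof -
  obtain y0 where y0: "y0 \<in> WJ" "\<And>y. y \<in> WJ \<Longrightarrow> len (x \<otimes> y0) \<le> len (x \<otimes> y)"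
    using ex_has_least_nat[of "\<lambda>y. y \<in> WJ" \<one> "\<lambda>y. len (x \<otimes> y)"] by auto
  show ?thesis
  proof (intro bexI conjI ballI)
    show "x = x \<otimes> y0 \<otimes> inv y0" using x y0 by (simp add: m_assoc)
    show "len (x \<otimes> y0) \<le> len (x \<otimes> y0 \<otimes> y)" if "y \<in> WJ" for y
      using y0(2)[of "y0 \<otimes> y"] x y0(1) that by (simp add: m_assoc)
  qed (use x y0 in auto)
qed

lemma D_carrier [simp]: "x \<in> D \<Longrightarrow> x \<in> carrier G"
  by (simp add: coset_reps_def)

lemma D_less: "x \<in> D \<Longrightarrow> s \<in> J \<Longrightarrow> len x < len (x \<otimes> s)"
  unfolding coset_reps_def by blast

lemma not_DE: assumes "x \<in> carrier G" "x \<notin> D" obtains t where "t \<in> J" "\<not> len x < len (x \<otimes> t)"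
  using assms unfolding coset_reps_def by blast

lemma minimal_in_D:
  assumes "x \<in> carrier G" "\<forall>y\<in>WJ. len x \<le> len (x \<otimes> y)" shows "x \<in> D"
proof -
  have "len (x \<otimes> s) > len x" if "s \<in> J" for s
    using assms(2) that refl_right_len_neq[of x s] assms(1) S_refls[of s] by (simp add: order_less_le)
  then show ?thesis using assms(1) unfolding coset_reps_def by blast
qed

text \<open>\<open>D\<close> excludes only single descents in \<open>J\<close>. Write
  \<open>x = x0 z\<close> with \<open>x0\<close> minimal in the coset; lengths add there, so the
  last letter of a nonempty reduced word of \<open>z\<close> would be such a descent.\<close>

lemma D_minimal:
  assumes "x \<in> D" "y \<in> WJ" shows "len x \<le> len (x \<otimes> y)"
proof -
  obtain x0 z where x0: "x0 \<in> carrier G" "z \<in> WJ" "x = x0 \<otimes> z" "\<forall>y\<in>WJ. len x0 \<le> len (x0 \<otimes> y)"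
    using ex_minimal_in_coset[of x] assms(1) by auto
  have lx: "len (x0 \<otimes> y) = len x0 + len y" if "y \<in> WJ" for y
    using minimal_in_coset_len[of x0 y] x0 that by auto
  obtain ws where ws: "ws \<in> lists J" "ws \<in> lists S" "word ws = z" "length ws = len z" using WJ_reducedE[OF x0(2)] .
  have "ws = []"
  proof (cases ws rule: rev_cases)
    case (snoc vs t)
    have vs: "vs \<in> lists S" "vs \<in> lists J" "t \<in> J" using ws snoc by auto
    have z: "z = word vs \<otimes> t" using ws(3) vs unfolding snoc by simp
    have xt: "x \<otimes> t = x0 \<otimes> word vs" unfolding x0(3) z using vs x0(1) by (simp add: m_assoc)
    have lz: "len z = Suc (length vs)" using ws(4) snoc by simp
    have "len (x \<otimes> t) = len x0 + len (word vs)" unfolding xt by (intro lx word_in_generate vs)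
    also have "\<dots> < len x0 + len z" using len_le[OF vs(1)] lz by simp
    also have "\<dots> = len x" unfolding x0(3) by (rule lx[OF x0(2), symmetric])
    finally have "len (x \<otimes> t) < len x" .
    then show ?thesis using D_less[OF assms(1) vs(3)] by simp
  qed simp
  then have "x = x0" using ws x0 by simp
  then show ?thesis using x0 assms(2) by simp
qed

lemma D_len: "x \<in> D \<Longrightarrow> y \<in> WJ \<Longrightarrow> len (x \<otimes> y) = len x + len y"
  using minimal_in_coset_len[of x y] D_minimal by auto

lemma ex_coset_decomp: assumes "w \<in> carrier G" shows "\<exists>x\<in>D. \<exists>y\<in>WJ. w = x \<otimes> y"
  using ex_minimal_in_coset[OF assms] minimal_in_D by metis

lemma coset_decomp_unique:
  assumes x: "x \<in> D" "x' \<in> D" and y: "y \<in> WJ" "y' \<in> WJ" and eq: "x \<otimes> y = x' \<otimes> y'"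
  shows "x = x' \<and> y = y'"
proof -
  define z where "z = y \<otimes> inv y'"
  have z: "z \<in> WJ" using y by (simp add: z_def)
  have "x \<otimes> z = (x \<otimes> y) \<otimes> inv y'" using x y by (simp add: z_def m_assoc)
  also have "\<dots> = x'" unfolding eq using x y by (simp add: m_assoc)
  finally have xz: "x \<otimes> z = x'" .
  have "x' \<otimes> inv z = x" unfolding xz[symmetric] using x z by (simp add: m_assoc)
  then have "len x = len x' + len z" using D_len[of x' "inv z"] x z by simp
  moreover have "len x' = len x + len z" using D_len[of x z] x z unfolding xz by simp
  ultimately have "z = \<one>" using len_eq_0[of z] z by simp
  then have xx: "x = x'" using xz x by simp
  have "y = inv x \<otimes> (x \<otimes> y)" using x y by simp
  also have "\<dots> = y'" unfolding eq unfolding xx using x y by simp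
  finally show ?thesis using xx by simp
qed

lemma one_D: "\<one> \<in> D"
  by (rule minimal_in_D) auto

text \<open>Deodhar's lemma.\<close>
lemma left_mult_D:
  assumes "x \<in> D" "s \<in> S" "s \<otimes> x \<notin> D"
  shows "inv x \<otimes> s \<otimes> x \<in> J" "len x < len (s \<otimes> x)"
proof -
  have x: "x \<in> carrier G" using assms by simp
  then obtain t where t: "t \<in> J" "\<not> len (s \<otimes> x) < len (s \<otimes> x \<otimes> t)"
    using not_DE[of "s \<otimes> x"] assms(2,3) by auto
  have xt: "len (x \<otimes> t) = Suc (len x)"
    using D_less[OF assms(1) t(1)] t(1) len_S_right_cases[of t x] x by auto
  have sxt: "len (s \<otimes> x) = Suc (len (s \<otimes> x \<otimes> t))"
    using t len_S_right_cases[of t "s \<otimes> x"] x assms by auto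
  have assoc: "s \<otimes> x \<otimes> t = s \<otimes> (x \<otimes> t)" using x t(1) assms(2) by (simp add: m_assoc)
  have 1: "len (s \<otimes> (x \<otimes> t)) = Suc (len (x \<otimes> t)) \<or> len (x \<otimes> t) = Suc (len (s \<otimes> (x \<otimes> t)))"
    and 2: "len (s \<otimes> x) = Suc (len x) \<or> len x = Suc (len (s \<otimes> x))"
    using len_S_left_cases[of s "x \<otimes> t"] len_S_left_cases[of s x] x t(1) assms(2) by simp_all
  show *: "len x < len (s \<otimes> x)" using 1 2 xt sxt[unfolded assoc] by linarith
  have "len (s \<otimes> (x \<otimes> t)) < len (x \<otimes> t)" using 1 2 xt sxt[unfolded assoc] by linarith
  then have "inversion (x \<otimes> t) s" using inversion_iff[of "x \<otimes> t" s] x t assms S_refls by simp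
  moreover have "\<not> inversion x s" using inversion_iff[of x s] x assms S_refls * by simp
  ultimately have "inversion t (inv x \<otimes> s \<otimes> x)" using inversion_mult[of x t s] x t assms by simp
  then show "inv x \<otimes> s \<otimes> x \<in> J" using inversion_S[of t "inv x \<otimes> s \<otimes> x"] x t assms by simp
qed

abbreviation Dp :: "'a \<Rightarrow> 'a set" where "Dp \<equiv> D_plus G S J"
abbreviation Dz :: "'a \<Rightarrow> 'a set" where "Dz \<equiv> D_zero G S J"
abbreviation Dm :: "'a \<Rightarrow> 'a set" where "Dm \<equiv> D_minus G S J"
abbreviation sc :: "'a \<Rightarrow> 'a \<Rightarrow> 'a" where "sc \<equiv> sconj G"

lemma Dp_iff: "s \<in> S \<Longrightarrow> w \<in> Dp s \<longleftrightarrow> w \<in> D \<and> len w < len (s \<otimes> w) \<and> s \<otimes> w \<in> D"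
  unfolding D_plus_def using bless_left by auto

lemma Dz_iff: "s \<in> S \<Longrightarrow> w \<in> Dz s \<longleftrightarrow> w \<in> D \<and> s \<otimes> w \<notin> D"
  unfolding D_zero_def using bless_left left_mult_D by auto

text \<open>That \<open>s \<otimes> w\<close> stays in \<open>D\<close> comes from Deodhar's lemma:
  multiplication by \<open>s\<close> leaves \<open>D\<close> only upwards.\<close>

lemma Dm_iff: "s \<in> S \<Longrightarrow> w \<in> Dm s \<longleftrightarrow> w \<in> D \<and> len (s \<otimes> w) < len w \<and> s \<otimes> w \<in> D"
  unfolding D_minus_def using bless_left' left_mult_D(2) by fastforce

lemma D_cases:
  assumes "s \<in> S" "w \<in> D"
  obtains (plus) "w \<in> Dp s" | (zero) "w \<in> Dz s" | (minus) "w \<in> Dm s"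
proof -
  have "len (s \<otimes> w) \<noteq> len w" using refl_len_neq[of w s] S_refls assms by simp
  then show thesis using that assms Dp_iff Dz_iff Dm_iff by (meson linorder_neqE_nat)
qed

lemma D_disjoint:
  assumes "s \<in> S"
  shows "w \<in> Dp s \<Longrightarrow> w \<notin> Dz s" "w \<in> Dp s \<Longrightarrow> w \<notin> Dm s" "w \<in> Dz s \<Longrightarrow> w \<notin> Dm s"
    "w \<in> Dz s \<Longrightarrow> w \<notin> Dp s" "w \<in> Dm s \<Longrightarrow> w \<notin> Dp s" "w \<in> Dm s \<Longrightarrow> w \<notin> Dz s"
  using Dp_iff Dz_iff Dm_iff assms by auto

lemma Dp_D: "w \<in> Dp s \<Longrightarrow> w \<in> D" and Dz_D: "w \<in> Dz s \<Longrightarrow> w \<in> D" and Dm_D: "w \<in> Dm s \<Longrightarrow> w \<in> D"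
  by (auto simp: D_plus_def D_zero_def D_minus_def)

lemma Dp_mult: "s \<in> S \<Longrightarrow> w \<in> Dp s \<Longrightarrow> s \<otimes> w \<in> Dm s"
  by (auto simp: Dp_iff Dm_iff)

lemma Dm_mult: "s \<in> S \<Longrightarrow> w \<in> Dm s \<Longrightarrow> s \<otimes> w \<in> Dp s"
  by (auto simp: Dp_iff Dm_iff)

lemma Dz_sc:
  assumes "s \<in> S" "w \<in> Dz s"
  shows "sc s w \<in> J" "s \<otimes> w = w \<otimes> sc s w" "len w < len (s \<otimes> w)"
  using assms left_mult_D[of w s] unfolding sconj_def by (auto simp: Dz_iff m_assoc)

end

section \<open>Modules over algebras given by generators and relations\<close>

lemma letters_plus [simp]: "letters (u + v) = letters u @ letters v"
  by (simp add: plus_fmon_def)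

lemma letters_zero [simp]: "letters 0 = []"
  by (simp add: zero_fmon_def)

fun alt_fun :: "nat \<Rightarrow> ('n \<Rightarrow> 'n) \<Rightarrow> ('n \<Rightarrow> 'n) \<Rightarrow> 'n \<Rightarrow> 'n" where
  "alt_fun 0 F K n = n"
| "alt_fun (Suc m) F K n = F (alt_fun m K F n)"

lemma additive_alt_fun: "additive F \<Longrightarrow> additive K \<Longrightarrow> additive (alt_fun m F K)"
  by (induction m arbitrary: F K) (auto simp: additive_def)

text \<open>Operators for the generators on the whole type, subject to no relations, so that the
  free algebra acts. Relations are imposed only later and only on a subset.\<close>

locale free_action =
  fixes \<sigma> :: "'c::comm_ring_1 \<Rightarrow> 'n::ab_group_add \<Rightarrow> 'n" and \<theta> :: "'g \<Rightarrow> 'n \<Rightarrow> 'n"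
  assumes scal: "biadditive \<sigma>" "\<sigma> (c * d) n = \<sigma> c (\<sigma> d n)" "\<sigma> 1 n = n"
    and gen: "additive (\<theta> g)" "\<theta> g (\<sigma> c n) = \<sigma> c (\<theta> g n)"
begin

definition pact :: "('g fmon \<Rightarrow>\<^sub>0 'c) \<Rightarrow> 'n \<Rightarrow> 'n" where
  "pact f n = plin (\<lambda>w c. \<sigma> c (foldr \<theta> (letters w) n)) f"

lemma additive_foldr: "additive (foldr \<theta> gs)"
  by (induction gs) (auto simp: additive_def additive.add[OF gen(1)])

lemma foldr_scal: "foldr \<theta> gs (\<sigma> c n) = \<sigma> c (foldr \<theta> gs n)"
  by (induction gs) (auto simp: gen)

lemma biadditive_pact: "biadditive pact"
  unfolding biadditive_def pact_def
proof (intro conjI allI)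
  show "additive (\<lambda>n. plin (\<lambda>w c. \<sigma> c (foldr \<theta> (letters w) n)) f)" for f
    by (rule additive_plin_fun, rule additive_comp[OF biadditiveD(1)[OF scal(1)] additive_foldr])
  show "additive (plin (\<lambda>w c. \<sigma> c (foldr \<theta> (letters w) n)))" for n
    by (rule additive_plin, rule biadditiveD(2)[OF scal(1)])
qed

lemmas pact_simps = biadditive_simps[OF biadditive_pact]

lemma pact_single: "pact (single w c) n = \<sigma> c (foldr \<theta> (letters w) n)"
  unfolding pact_def by (rule plin_single_additive, rule biadditiveD(2)[OF scal(1)])

lemma pact_mult: "pact (f * h) n = pact f (pact h n)"
proof (induction f rule: pm_induct)
  case (single u c)
  show ?case
    by (induction h rule: pm_induct)
      (simp_all add: pact_simps distrib_left mult_single pact_single scal(2) foldr_scal)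
qed (simp_all add: pact_simps distrib_right)

lemma pact_one: "pact 1 n = n"
  using pact_single[of 0 1 n] by (simp add: scal)

lemma pact_fgen: "pact (fgen g) n = \<theta> g n"
  by (simp add: fgen_def pact_single scal)

lemma pact_fscalar: "pact (fscalar c) n = \<sigma> c n"
  by (simp add: fscalar_def pact_single scal)

lemma pact_alt_prod: "pact (alt_prod m a b) n = alt_fun m (pact a) (pact b) n"
  by (induction m arbitrary: a b) (simp_all add: pact_one pact_mult)

end

lemma free_alg_add: "f \<in> free_alg X \<Longrightarrow> g \<in> free_alg X \<Longrightarrow> f + g \<in> free_alg X"
  using keys_add[of f g] unfolding free_alg_def by blast

lemma free_alg_uminus: "f \<in> free_alg X \<Longrightarrow> - f \<in> free_alg X"
  by (simp add: free_alg_def in_keys_iff)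

lemma free_alg_diff: "f \<in> free_alg X \<Longrightarrow> g \<in> free_alg X \<Longrightarrow> f - g \<in> free_alg X"
  using free_alg_add[of f X "- g"] free_alg_uminus[of g X] by simp

lemma free_alg_mult: "f \<in> free_alg X \<Longrightarrow> g \<in> free_alg X \<Longrightarrow> f * g \<in> free_alg X"
  using keys_mult[of f g] unfolding free_alg_def by fastforce

lemma free_alg_one: "1 \<in> free_alg X"
  by (simp add: free_alg_def)

lemma free_alg_fgen: "g \<in> X \<Longrightarrow> fgen g \<in> free_alg X"
  by (simp add: free_alg_def fgen_def)

lemma free_alg_fscalar: "fscalar c \<in> free_alg X"
  by (simp add: free_alg_def fscalar_def)

locale presentation =
  fixes \<eta> :: "'c::comm_ring_1 \<Rightarrow> 'a::ring_1" and t :: "'g \<Rightarrow> 'a" and X :: "'g set" and rels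
  assumes presented: "presented_algebra \<eta> t X rels"
begin

lemma eta: "\<eta> 1 = 1" "\<eta> (c + d) = \<eta> c + \<eta> d" "\<eta> (c * d) = \<eta> c * \<eta> d" "\<eta> c * a = a * \<eta> c"
  using presented unfolding presented_algebra_def by blast+

lemma additive_eta: "additive \<eta>"
  by (simp add: additive_def eta)

lemma additive_feval: "additive (feval \<eta> t)"
proof -
  have "feval \<eta> t = plin (\<lambda>w c. \<eta> c * prod_list (map t (letters w)))"
    by (rule ext) (simp add: feval_def plin_def)
  then show ?thesis using additive_comp[OF additive_mult_right additive_eta] by (auto intro: additive_plin)
qed

lemmas feval_simps = additive.add[OF additive_feval] additive.diff[OF additive_feval]
  additive.minus[OF additive_feval] additive.zero[OF additive_feval]

lemma feval_single: "feval \<eta> t (single w c) = \<eta> c * prod_list (map t (letters w))"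
  by (cases "c = 0") (auto simp: feval_def additive.zero[OF additive_eta])

lemma feval_mult: "feval \<eta> t (f * h) = feval \<eta> t f * feval \<eta> t h"
proof (induction f rule: pm_induct)
  case (single u c)
  have "\<eta> c * a * (\<eta> d * b) = \<eta> c * (\<eta> d * (a * b))" for a b d
    by (metis eta(4) mult.assoc)
  then show ?case
    by (induction h rule: pm_induct) (simp_all add: feval_simps distrib_left mult_single feval_single eta(3) mult.assoc)
qed (simp_all add: feval_simps distrib_right)

lemma feval_one: "feval \<eta> t 1 = 1"
  using feval_single[of 0 1] by (simp add: eta)

lemma feval_fgen: "feval \<eta> t (fgen g) = t g"
  by (simp add: fgen_def feval_single eta)

lemma feval_fscalar: "feval \<eta> t (fscalar c) = \<eta> c"
  by (simp add: fscalar_def feval_single)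

lemma feval_alt_prod: "feval \<eta> t (alt_prod m a b) = alt_prod m (feval \<eta> t a) (feval \<eta> t b)"
  by (induction m arbitrary: a b) (simp_all add: feval_one feval_mult)

lemma feval_surj: "\<exists>f\<in>free_alg X. feval \<eta> t f = a"
proof -
  have "a \<in> feval \<eta> t ` free_alg X" using presented unfolding presented_algebra_def by simp
  then show ?thesis by blast
qed

lemma feval_eq_0_iff: "f \<in> free_alg X \<Longrightarrow> feval \<eta> t f = 0 \<longleftrightarrow> f \<in> ideal_gen (free_alg X) rels"
  using presented unfolding presented_algebra_def by blast

lemma feval_rel: assumes "r \<in> rels" shows "feval \<eta> t r = 0"
proof -
  have "0 + 1 * r * 1 \<in> ideal_gen (free_alg X) rels"
    using assms free_alg_one by (intro ideal_gen.intros) auto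
  moreover have "ideal_gen (free_alg X) rels = {f \<in> free_alg X. feval \<eta> t f = 0}"
    using presented unfolding presented_algebra_def by simp
  ultimately show ?thesis by auto
qed

text \<open>The action is a total function that first projects to \<open>N\<close>; therefore its
  values always lie in \<open>N\<close>, while 1 acts as the identity only on
  \<open>N\<close>.\<close>

definition is_action_on ::
  "'n::ab_group_add set \<Rightarrow> ('c \<Rightarrow> 'n \<Rightarrow> 'n) \<Rightarrow> ('g \<Rightarrow> 'n \<Rightarrow> 'n) \<Rightarrow> ('a \<Rightarrow> 'n \<Rightarrow> 'n) \<Rightarrow> bool" where
  "is_action_on N \<sigma> \<theta> act \<longleftrightarrow>
    biadditive act \<and> (\<forall>a b n. act (a * b) n = act a (act b n)) \<and> (\<forall>n\<in>N. act 1 n = n) \<and>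
    (\<forall>a n. act a n \<in> N) \<and> (\<forall>c. \<forall>n\<in>N. act (\<eta> c) n = \<sigma> c n) \<and> (\<forall>g\<in>X. \<forall>n\<in>N. act (t g) n = \<theta> g n)"

lemma is_action_onD:
  assumes "is_action_on N \<sigma> \<theta> act"
  shows "biadditive act" "act (a * b) n = act a (act b n)" "n \<in> N \<Longrightarrow> act 1 n = n" "act a n \<in> N"
    "n \<in> N \<Longrightarrow> act (\<eta> c) n = \<sigma> c n" "g \<in> X \<Longrightarrow> n \<in> N \<Longrightarrow> act (t g) n = \<theta> g n"
  using assms unfolding is_action_on_def by blast+

text \<open>Relators that kill \<open>N\<close> let the action of the free algebra on
  \<open>N\<close> descend to the presented algebra. The clause about \<open>\<delta>\<close>
  carries symmetries of the generators over to the whole action; it later yields commutation with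
  the scalars from \<open>k\<close>.\<close>

lemma action_exists:
  fixes \<sigma> :: "'c \<Rightarrow> 'n::ab_group_add \<Rightarrow> 'n" and \<theta> :: "'g \<Rightarrow> 'n \<Rightarrow> 'n"
  assumes fa: "free_action \<sigma> \<theta>"
    and pi: "additive \<pi>" "\<And>n. \<pi> n \<in> N" "\<And>n. n \<in> N \<Longrightarrow> \<pi> n = n"
    and N: "\<And>c n. n \<in> N \<Longrightarrow> \<sigma> c n \<in> N" "\<And>g n. g \<in> X \<Longrightarrow> n \<in> N \<Longrightarrow> \<theta> g n \<in> N"
    and rels: "\<And>r n. r \<in> rels \<Longrightarrow> n \<in> N \<Longrightarrow> free_action.pact \<sigma> \<theta> r n = 0"
  shows "\<exists>act. is_action_on N \<sigma> \<theta> act \<and>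
    (\<forall>\<delta>. additive \<delta> \<longrightarrow> (\<forall>n. \<delta> (\<pi> n) = \<pi> (\<delta> n)) \<longrightarrow> (\<forall>c n. \<delta> (\<sigma> c n) = \<sigma> c (\<delta> n)) \<longrightarrow>
       (\<forall>g n. \<delta> (\<theta> g n) = \<theta> g (\<delta> n)) \<longrightarrow> (\<forall>a n. act a (\<delta> n) = \<delta> (act a n)))"
proof -
  interpret free_action \<sigma> \<theta> by (rule fa)
  have N_add: "a + b \<in> N" if "a \<in> N" "b \<in> N" for a b
    using that pi by (metis additive.add)
  have N_0: "0 \<in> N" using pi by (metis additive.zero)
  have pact_N: "pact f n \<in> N" if f: "f \<in> free_alg X" and n: "n \<in> N" for f n
  proof (induction f rule: pm_induct)
    case zero show ?case by (simp add: pact_simps N_0)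
  next
    case (single w c)
    have "set gs \<subseteq> X \<Longrightarrow> foldr \<theta> gs n \<in> N" for gs by (induction gs) (use n N in auto)
    then have "foldr \<theta> (letters w) n \<in> N" using f single by (auto simp: free_alg_def)
    then show ?case by (simp add: pact_single N)
  next
    case (add a b) then show ?case by (simp add: pact_simps N_add)
  qed
  have ideal: "pact f n = 0" if "f \<in> ideal_gen (free_alg X) rels" "n \<in> N" for f n
    using that
  proof (induction rule: ideal_gen.induct)
    case (add f r a b)
    then show ?case using rels pact_N by (simp add: pact_simps pact_mult)
  qed (simp add: pact_simps)
  \<comment> \<open>This makes \<open>act\<close> independent of the chosen preimages
    \<open>pre a\<close>.\<close>
  have well: "pact f n = pact h n"
    if "f \<in> free_alg X" "h \<in> free_alg X" "feval \<eta> t f = feval \<eta> t h" "n \<in> N" for f h n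
  proof -
    have "f - h \<in> free_alg X" using that(1,2) by (rule free_alg_diff)
    then have "f - h \<in> ideal_gen (free_alg X) rels"
      using that(3) feval_eq_0_iff[of "f - h"] by (simp add: feval_simps)
    then show ?thesis using ideal[of "f - h" n] that by (simp add: pact_simps)
  qed
  define pre where "pre a = (SOME f. f \<in> free_alg X \<and> feval \<eta> t f = a)" for a
  have pre: "pre a \<in> free_alg X" "feval \<eta> t (pre a) = a" for a
    using someI_ex[of "\<lambda>f. f \<in> free_alg X \<and> feval \<eta> t f = a"] feval_surj[of a] unfolding pre_def by auto
  define act where "act a n = pact (pre a) (\<pi> n)" for a n
  have act_eq: "act (feval \<eta> t f) n = pact f n" if "f \<in> free_alg X" "n \<in> N" for f n
    unfolding act_def pi(3)[OF that(2)] by (rule well[OF pre(1) that(1) pre(2) that(2)])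
  have act_N: "act a n \<in> N" for a n unfolding act_def using pact_N pre pi by simp
  have add1: "additive (\<lambda>a. act a n)" for n
  proof
    fix a b
    have "pact (pre (a + b)) (\<pi> n) = pact (pre a + pre b) (\<pi> n)"
      by (rule well) (use pre pi in \<open>auto intro: free_alg_add simp: feval_simps\<close>)
    then show "act (a + b) n = act a n + act b n" by (simp add: act_def pact_simps)
  qed
  have add2: "additive (act a)" for a
    unfolding act_def by (rule additive_comp[OF biadditiveD(1)[OF biadditive_pact] pi(1)])
  have mult: "act (a * b) n = act a (act b n)" for a b n
  proof -
    have "pact (pre (a * b)) (\<pi> n) = pact (pre a * pre b) (\<pi> n)"
      by (rule well) (use pre pi in \<open>auto intro: free_alg_mult simp: feval_mult\<close>)
    moreover have "\<pi> (pact (pre b) (\<pi> n)) = pact (pre b) (\<pi> n)" using pact_N pre pi by simp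
    ultimately show ?thesis by (simp add: act_def pact_mult)
  qed
  have comm: "act a (\<delta> n) = \<delta> (act a n)"
    if d: "additive \<delta>" "\<forall>n. \<delta> (\<pi> n) = \<pi> (\<delta> n)" "\<forall>c n. \<delta> (\<sigma> c n) = \<sigma> c (\<delta> n)" "\<forall>g n. \<delta> (\<theta> g n) = \<theta> g (\<delta> n)"
    for \<delta> a n
  proof -
    have f: "foldr \<theta> gs (\<delta> n) = \<delta> (foldr \<theta> gs n)" for gs n by (induction gs) (use d in auto)
    have "pact f (\<delta> n) = \<delta> (pact f n)" for f n
      unfolding pact_def additive_comp_plin[OF d(1)] using d f by simp
    then show ?thesis using d by (simp add: act_def flip: d(2))
  qed
  have "act 1 n = n" if "n \<in> N" for n using act_eq[OF free_alg_one that] by (simp add: feval_one pact_one)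
  moreover have "act (\<eta> c) n = \<sigma> c n" if "n \<in> N" for c n
    using act_eq[OF free_alg_fscalar that, of c] by (simp add: feval_fscalar pact_fscalar)
  moreover have "act (t g) n = \<theta> g n" if "g \<in> X" "n \<in> N" for g n
    using act_eq[OF free_alg_fgen[OF that(1)] that(2)] by (simp add: feval_fgen pact_fgen)
  ultimately show ?thesis
    using add1 add2 mult act_N comm by (intro exI[of _ act]) (auto simp: biadditive_def is_action_on_def)
qed

end

section \<open>The standard basis of the Hecke algebra\<close>

locale hecke = coxeter +
  fixes L :: "'a \<Rightarrow> int" and \<eta> :: "(int \<Rightarrow>\<^sub>0 int) \<Rightarrow> 'h::ring_1" and t :: "'a \<Rightarrow> 'h"
  assumes weight: "weight_function G S L"
    and hecke_algebra: "is_hecke_algebra G S L \<eta> t"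
begin

sublocale pres: presentation \<eta> t S "hecke_rels G S L"
  by unfold_locales (use hecke_algebra in \<open>simp add: is_hecke_algebra_def\<close>)

lemma L_mult: "x \<in> carrier G \<Longrightarrow> y \<in> carrier G \<Longrightarrow> len (x \<otimes> y) = len x + len y \<Longrightarrow> L (x \<otimes> y) = L x + L y"
  using weight unfolding weight_function_def by blast

lemma len_S [simp]: "s \<in> S \<Longrightarrow> len s = 1"
  using len_S_left_cases[of s \<one>] by auto

text \<open>If \<open>s\<close> raises \<open>w\<close>, compare the weights of \<open>s w\<close>
  and \<open>w u\<close>. Otherwise replace \<open>w\<close> by \<open>s w\<close>, which satisfies
  the same equation.\<close>

lemma L_conj:
  assumes "s \<in> S" "u \<in> S" "w \<in> carrier G" "s \<otimes> w = w \<otimes> u" shows "L s = L u"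
proof -
  have *: "L s = L u" if w: "w \<in> carrier G" "s \<otimes> w = w \<otimes> u" "len w < len (s \<otimes> w)" for w
  proof -
    have "L (s \<otimes> w) = L s + L w" using L_mult[of s w] len_S_left_cases[of s w] w(1,3) assms(1) by auto
    moreover have "L (w \<otimes> u) = L w + L u"
      using L_mult[of w u] len_S_right_cases[of u w] w(1) w(3)[unfolded w(2)] assms(2) by auto
    ultimately show ?thesis using w(2) by simp
  qed
  have sw: "s \<otimes> w \<in> carrier G" using assms(1,3) by simp
  have "s \<otimes> w \<otimes> u = w" unfolding assms(4) using assms(2,3) by (simp add: m_assoc)
  then have eq: "s \<otimes> (s \<otimes> w) = s \<otimes> w \<otimes> u" using assms(1,3) by simp
  show ?thesis
  proof (cases "len w < len (s \<otimes> w)")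
    case True then show ?thesis by (rule *[OF assms(3,4)])
  next
    case False
    then have "len (s \<otimes> w) < len (s \<otimes> (s \<otimes> w))" using len_S_left_cases[of s w] assms(1,3) by auto
    then show ?thesis by (rule *[OF sw eq])
  qed
qed

section \<open>Left and right regular representations on the free module with basis the
  group\<close>

definition q :: "'a \<Rightarrow> int \<Rightarrow>\<^sub>0 int" where "q s = vpow (L s) - vpow (- L s)"

text \<open>\<open>lam s\<close> and \<open>rho s\<close> are left and right multiplication by
  \<open>T_s\<close> written in the expected basis \<open>T_w\<close>. That \<open>lam\<close>
  satisfies the relations of the Hecke algebra is what proves the \<open>T_w\<close> independent;
  \<open>rho\<close> serves to spread the braid relation from the identity to all
  \<open>w\<close>.\<close>

definition lam :: "'a \<Rightarrow> ('a \<Rightarrow>\<^sub>0 int \<Rightarrow>\<^sub>0 int) \<Rightarrow> ('a \<Rightarrow>\<^sub>0 int \<Rightarrow>\<^sub>0 int)" where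
  "lam s = plin (\<lambda>w c. single (s \<otimes> w) c + (if len w < len (s \<otimes> w) then 0 else single w (q s * c)))"

definition rho :: "'a \<Rightarrow> ('a \<Rightarrow>\<^sub>0 int \<Rightarrow>\<^sub>0 int) \<Rightarrow> ('a \<Rightarrow>\<^sub>0 int \<Rightarrow>\<^sub>0 int)" where
  "rho s = plin (\<lambda>w c. single (w \<otimes> s) c + (if len w < len (w \<otimes> s) then 0 else single w (q s * c)))"

lemma additive_lam: "additive (lam s)" and additive_rho: "additive (rho s)"
  unfolding lam_def rho_def
  by (rule additive_plin, simp add: additive_def single_add algebra_simps)+

lemmas lam_simps = additive.add[OF additive_lam] additive.zero[OF additive_lam]
lemmas rho_simps = additive.add[OF additive_rho] additive.zero[OF additive_rho]

lemma lam_single: "lam s (single w c) = single (s \<otimes> w) c + (if len w < len (s \<otimes> w) then 0 else single w (q s * c))"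
  and rho_single: "rho s (single w c) = single (w \<otimes> s) c + (if len w < len (w \<otimes> s) then 0 else single w (q s * c))"
  unfolding lam_def rho_def by (rule plin_single, simp)+

definition F :: "('a \<Rightarrow>\<^sub>0 int \<Rightarrow>\<^sub>0 int) set" where "F = {f. keys f \<subseteq> carrier G}"

lemma F_iff: "f \<in> F \<longleftrightarrow> keys f \<subseteq> carrier G"
  by (simp add: F_def)

lemma F_zero [simp]: "0 \<in> F"
  by (simp add: F_def)

lemma F_add: "f \<in> F \<Longrightarrow> g \<in> F \<Longrightarrow> f + g \<in> F"
  using keys_add[of f g] by (auto simp: F_def)

lemma F_single [simp]: "w \<in> carrier G \<Longrightarrow> single w c \<in> F"
  by (simp add: F_def)

lemma lam_F: assumes "s \<in> S" "f \<in> F" shows "lam s f \<in> F"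
proof (induction f rule: pm_induct)
  case (single w c)
  then have "w \<in> carrier G" using assms by (auto simp: F_iff)
  then show ?case using assms by (simp add: lam_single F_add)
qed (simp_all add: lam_simps F_add)

text \<open>When \<open>s w = w u\<close>, the two scalar corrections fall on the same basis
  elements and agree because \<open>L s = L u\<close>. In all other cases the descent behaviour on
  the two sides is independent.\<close>

lemma lam_rho_commute_single:
  assumes s: "s \<in> S" and u: "u \<in> S" and w: "w \<in> carrier G"
  shows "lam s (rho u (single w c)) = rho u (lam s (single w c))"
proof -
  have assoc: "s \<otimes> w \<otimes> u = s \<otimes> (w \<otimes> u)" using s u w by (simp add: m_assoc)
  have len: "len (s \<otimes> w) = Suc (len w) \<or> len w = Suc (len (s \<otimes> w))"
    "len (w \<otimes> u) = Suc (len w) \<or> len w = Suc (len (w \<otimes> u))"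
    "len (s \<otimes> (w \<otimes> u)) = Suc (len (w \<otimes> u)) \<or> len (w \<otimes> u) = Suc (len (s \<otimes> (w \<otimes> u)))"
    "len (s \<otimes> (w \<otimes> u)) = Suc (len (s \<otimes> w)) \<or> len (s \<otimes> w) = Suc (len (s \<otimes> (w \<otimes> u)))"
    using len_S_left_cases[of s w] len_S_right_cases[of u w] len_S_left_cases[of s "w \<otimes> u"]
      len_S_right_cases[of u "s \<otimes> w"] s u w assoc by auto
  have lr: "lam s (rho u (single w c)) = single (s \<otimes> (w \<otimes> u)) c +
      (if len (w \<otimes> u) < len (s \<otimes> (w \<otimes> u)) then 0 else single (w \<otimes> u) (q s * c)) +
      (if len w < len (w \<otimes> u) then 0 else single (s \<otimes> w) (q u * c) +
         (if len w < len (s \<otimes> w) then 0 else single w (q s * (q u * c))))"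
    by (simp add: rho_single lam_single lam_simps)
  have rl: "rho u (lam s (single w c)) = single (s \<otimes> (w \<otimes> u)) c +
      (if len (s \<otimes> w) < len (s \<otimes> (w \<otimes> u)) then 0 else single (s \<otimes> w) (q u * c)) +
      (if len w < len (s \<otimes> w) then 0 else single (w \<otimes> u) (q s * c) +
         (if len w < len (w \<otimes> u) then 0 else single w (q u * (q s * c))))"
    by (simp add: rho_single lam_single rho_simps assoc)
  show ?thesis
  proof (cases "s \<otimes> w = w \<otimes> u")
    case True
    have "q s = q u" using L_conj[OF s u w True] by (simp add: q_def)
    moreover have "s \<otimes> (w \<otimes> u) = w" using True s w by (simp flip: True)
    ultimately show ?thesis unfolding lr rl True using len by auto
  next
    case False
    \<comment> \<open>By the cocycle rule, right multiplication by \<open>u\<close> then does not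
      change whether \<open>s\<close> is an inversion.\<close>
    have "inv w \<otimes> s \<otimes> w \<noteq> u"
    proof
      assume a: "inv w \<otimes> s \<otimes> w = u"
      have "w \<otimes> u = s \<otimes> w" unfolding a[symmetric] using s w by (simp add: m_assoc)
      then show False using False by simp
    qed
    then have "\<not> inversion u (inv w \<otimes> s \<otimes> w)" using inversion_S[of u "inv w \<otimes> s \<otimes> w"] s u w by simp
    then have "inversion (w \<otimes> u) s = inversion w s" using inversion_mult[of w u s] s u w by simp
    then have "len (s \<otimes> (w \<otimes> u)) < len (w \<otimes> u) \<longleftrightarrow> len (s \<otimes> w) < len w"
      using inversion_iff[of "w \<otimes> u" s] inversion_iff[of w s] s u w S_refls by simp
    then have "len (w \<otimes> u) < len (s \<otimes> (w \<otimes> u)) \<longleftrightarrow> len w < len (s \<otimes> w)"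
      "len (s \<otimes> w) < len (s \<otimes> (w \<otimes> u)) \<longleftrightarrow> len w < len (w \<otimes> u)"
      using len by linarith+
    then show ?thesis unfolding lr rl by (simp add: algebra_simps)
  qed
qed

lemma lam_rho_commute: assumes "s \<in> S" "u \<in> S" "f \<in> F" shows "lam s (rho u f) = rho u (lam s f)"
  by (rule additive_eqI[OF additive_comp[OF additive_lam additive_rho] additive_comp[OF additive_rho additive_lam]])
    (use assms lam_rho_commute_single in \<open>auto simp: F_iff\<close>)

definition scal :: "(int \<Rightarrow>\<^sub>0 int) \<Rightarrow> ('a \<Rightarrow>\<^sub>0 int \<Rightarrow>\<^sub>0 int) \<Rightarrow> 'a \<Rightarrow>\<^sub>0 int \<Rightarrow>\<^sub>0 int" where
  "scal c = Poly_Mapping.map ((*) c)"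

lemma lookup_scal [simp]: "lookup (scal c f) w = c * lookup f w"
  by (simp add: scal_def lookup_map_0)

lemma scal_single [simp]: "scal c (single w d) = single w (c * d)"
  by (simp add: scal_def)

lemma biadditive_scal: "biadditive scal"
  unfolding biadditive_def additive_def
  by (intro conjI allI poly_mapping_eqI) (simp_all add: lookup_add algebra_simps)

lemma lam_quadratic: assumes "s \<in> S" "f \<in> F" shows "lam s (lam s f) = f + scal (q s) (lam s f)"
proof (rule additive_eqI[where f = f])
  show "additive (\<lambda>f. lam s (lam s f))" by (rule additive_comp[OF additive_lam additive_lam])
  show "additive (\<lambda>f. f + scal (q s) (lam s f))"
    by (rule additive_plus[OF additive_id additive_comp[OF biadditiveD(1)[OF biadditive_scal] additive_lam]])
  fix w c assume "w \<in> keys f"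
  then have w: "w \<in> carrier G" using assms by (auto simp: F_iff)
  then have "len w < len (s \<otimes> w) \<longleftrightarrow> \<not> len (s \<otimes> w) < len w" using refl_len_neq[of w s] S_refls assms(1) by auto
  then show "lam s (lam s (single w c)) = single w c + scal (q s) (lam s (single w c))"
    using w assms(1)
    by (cases "len w < len (s \<otimes> w)") (simp_all add: lam_single lam_simps biadditive_simps[OF biadditive_scal])
qed

lemma alt_fun_lam_F: "s \<in> S \<Longrightarrow> u \<in> S \<Longrightarrow> f \<in> F \<Longrightarrow> alt_fun m (lam s) (lam u) f \<in> F"
  by (induction m arbitrary: s u) (simp_all add: lam_F)

lemma alt_fun_lam_rho:
  assumes "s \<in> S" "u \<in> S" "r \<in> S" "f \<in> F"
  shows "alt_fun m (lam s) (lam u) (rho r f) = rho r (alt_fun m (lam s) (lam u) f)"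
  using assms(1,2)
proof (induction m arbitrary: s u)
  case (Suc m)
  then show ?case using lam_rho_commute[OF Suc.prems(1) assms(3) alt_fun_lam_F[OF Suc.prems(2,1) assms(4)]] by simp
qed simp

lemma alt_fun_lam_one:
  assumes "s \<in> S" "u \<in> S" "ord (s \<otimes> u) = 0 \<or> m \<le> ord (s \<otimes> u)"
  shows "alt_fun m (lam s) (lam u) (single \<one> c) = single (word (alt_word m s u)) c"
  using assms
proof (induction m arbitrary: s u)
  case (Suc m)
  have o: "ord (u \<otimes> s) = ord (s \<otimes> u)" using ord_commute Suc.prems by simp
  have "alt_fun m (lam u) (lam s) (single \<one> c) = single (word (alt_word m u s)) c"
    using Suc o by auto
  moreover have "len (word (alt_word m u s)) < len (s \<otimes> word (alt_word m u s))"
    using alt_word_reduced[of u s m] alt_word_reduced[of s u "Suc m"] Suc.prems o by (auto simp: alt_word_Suc)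
  ultimately show ?case by (simp add: lam_single alt_word_Suc)
qed simp

text \<open>At the identity both sides produce the same alternating product, since no reduction
  occurs along the way. Every other basis element arises from a shorter one by some
  \<open>rho r\<close>, which commutes with all \<open>lam\<close>.\<close>

lemma lam_braid:
  assumes "s \<in> S" "u \<in> S" "f \<in> F" "m = ord (s \<otimes> u)"
  shows "alt_fun m (lam s) (lam u) f = alt_fun m (lam u) (lam s) f"
proof (rule additive_eqI[where f = f])
  show "additive (alt_fun m (lam s) (lam u))" "additive (alt_fun m (lam u) (lam s))"
    by (intro additive_alt_fun additive_lam)+
  fix w c assume "w \<in> keys f"
  then have "w \<in> carrier G" using assms by (auto simp: F_iff)
  show "alt_fun m (lam s) (lam u) (single w c) = alt_fun m (lam u) (lam s) (single w c)"
    using \<open>w \<in> carrier G\<close>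
  proof (induction "len w" arbitrary: w)
    case 0
    then have "w = \<one>" using len_eq_0 by simp
    moreover have "word (alt_word m s u) = word (alt_word m u s)" using word_alt_braid assms by simp
    ultimately show ?case using alt_fun_lam_one[of s u m c] alt_fun_lam_one[of u s m c] assms ord_commute by simp
  next
    case (Suc n)
    obtain ws where ws: "ws \<in> lists S" "word ws = w" "length ws = len w" using reduced_exprE[OF Suc.prems] .
    then obtain vs r where v: "ws = vs @ [r]" using Suc.hyps(2) by (cases ws rule: rev_cases) auto
    then have r: "r \<in> S" "vs \<in> lists S" and w: "w = word vs \<otimes> r" using ws by auto
    have l: "len (word vs) = n"
      using len_le[OF r(2)] len_S_mult_le(2)[OF r(1), of "word vs"] r(2) Suc.hyps(2) ws(3) v
      unfolding w by simp
    have F: "single (word vs) c \<in> F" using r by simp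
    have "single w c = rho r (single (word vs) c)" using l Suc.hyps(2) by (simp add: rho_single w)
    then show ?case
      using Suc.hyps(1)[OF l[symmetric]] r alt_fun_lam_rho[OF _ _ r(1) F] assms by simp
  qed
qed

lemma hecke_free_action: "free_action scal lam"
proof
  show "lam g (scal c n) = scal c (lam g n)" for g c n
    by (rule additive_eqI[OF additive_comp[OF additive_lam biadditiveD(1)[OF biadditive_scal]]
          additive_comp[OF biadditiveD(1)[OF biadditive_scal] additive_lam]])
      (simp add: lam_single biadditive_simps[OF biadditive_scal] algebra_simps)
  show "scal (c * d) n = scal c (scal d n)" "scal 1 n = n" for c d n
    by (rule poly_mapping_eqI, simp add: mult.assoc)+
qed (simp_all add: biadditive_scal lam_simps)

lemma ex_hecke_action: "\<exists>act. pres.is_action_on F scal lam act"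
proof -
  interpret fa: free_action scal lam by (rule hecke_free_action)
  have fg: "fa.pact (fgen g) = lam g" for g by (rule ext) (simp add: fa.pact_fgen)
  have rels: "fa.pact r n = 0" if r: "r \<in> hecke_rels G S L" and n: "n \<in> F" for r n
  proof -
    consider s where "r = fgen s * fgen s - 1 - fscalar (q s) * fgen s" "s \<in> S"
      | s u where "r = alt_prod (ord (s \<otimes> u)) (fgen s) (fgen u) - alt_prod (ord (s \<otimes> u)) (fgen u) (fgen s)" "s \<in> S" "u \<in> S"
      using r unfolding hecke_rels_def q_def by blast
    then show ?thesis
    proof cases
      case 1
      then show ?thesis using lam_quadratic[of s n] n
        by (simp add: fa.pact_simps fa.pact_mult fa.pact_fgen fa.pact_fscalar fa.pact_one)
    next
      case 2
      then show ?thesis using lam_braid[of s u n] n by (simp add: fa.pact_simps fa.pact_alt_prod fg)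
    qed
  qed
  have "\<exists>act. pres.is_action_on F scal lam act \<and>
    (\<forall>\<delta>. additive \<delta> \<longrightarrow> (\<forall>n. \<delta> (pm_restrict (carrier G) n) = pm_restrict (carrier G) (\<delta> n)) \<longrightarrow>
       (\<forall>c n. \<delta> (scal c n) = scal c (\<delta> n)) \<longrightarrow>
       (\<forall>g n. \<delta> (lam g n) = lam g (\<delta> n)) \<longrightarrow> (\<forall>a n. act a (\<delta> n) = \<delta> (act a n)))"
  proof (rule pres.action_exists[OF hecke_free_action additive_pm_restrict])
    show "scal c n \<in> F" if "n \<in> F" for c n using that by (auto simp: F_iff in_keys_iff)
  qed (simp_all add: F_iff keys_pm_restrict pm_restrict_id lam_F[unfolded F_iff] rels[unfolded F_iff])
  then show ?thesis by blast
qed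

definition hact :: "'h \<Rightarrow> ('a \<Rightarrow>\<^sub>0 int \<Rightarrow>\<^sub>0 int) \<Rightarrow> 'a \<Rightarrow>\<^sub>0 int \<Rightarrow>\<^sub>0 int" where
  "hact = (SOME act. pres.is_action_on F scal lam act)"

lemmas hact = pres.is_action_onD[OF someI_ex[OF ex_hecke_action, folded hact_def]]

section \<open>The basis \<open>T_w\<close> and its coordinates\<close>

abbreviation T :: "'a \<Rightarrow> 'h" where "T \<equiv> T_elem G S t"

lemma hecke_braid: "s \<in> S \<Longrightarrow> u \<in> S \<Longrightarrow> ord (s \<otimes> u) \<noteq> 0 \<Longrightarrow>
    alt_prod (ord (s \<otimes> u)) (t s) (t u) = alt_prod (ord (s \<otimes> u)) (t u) (t s)"
proof -
  assume *: "s \<in> S" "u \<in> S" "ord (s \<otimes> u) \<noteq> 0"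
  have "alt_prod (ord (s \<otimes> u)) (fgen s) (fgen u) - alt_prod (ord (s \<otimes> u)) (fgen u) (fgen s) \<in> hecke_rels G S L"
    using * unfolding hecke_rels_def by blast
  from pres.feval_rel[OF this] show ?thesis
    by (simp add: pres.feval_simps pres.feval_alt_prod pres.feval_fgen)
qed

lemma hecke_quadratic: "s \<in> S \<Longrightarrow> t s * t s = 1 + \<eta> (q s) * t s"
proof -
  assume *: "s \<in> S"
  have "fgen s * fgen s - 1 - fscalar (q s) * fgen s \<in> hecke_rels G S L"
    using * unfolding hecke_rels_def q_def by blast
  from pres.feval_rel[OF this] show ?thesis
    by (simp add: pres.feval_simps pres.feval_mult pres.feval_fgen pres.feval_one pres.feval_fscalar algebra_simps)
qed

lemma T_word: assumes "reduced_expr G S w ws" shows "T w = prod_list (map t ws)"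
proof -
  have "reduced_expr G S w (SOME ws. reduced_expr G S w ws)" using assms by (rule someI)
  then show ?thesis unfolding T_elem_def using matsumoto[OF hecke_braid] assms by blast
qed

lemma T_one [simp]: "T \<one> = 1"
  using T_word[of \<one> "[]"] by (simp add: reduced_expr_def)

lemma T_mult:
  assumes "x \<in> carrier G" "y \<in> carrier G" "len (x \<otimes> y) = len x + len y"
  shows "T (x \<otimes> y) = T x * T y"
proof -
  obtain u v where "reduced_expr G S x u" "reduced_expr G S y v" using assms ex_reduced by metis
  moreover from this have "reduced_expr G S (x \<otimes> y) (u @ v)" using assms by (auto simp: reduced_expr_def)
  ultimately show ?thesis using T_word by simp
qed

lemma T_S [simp]: "s \<in> S \<Longrightarrow> T s = t s"
  using T_word[of s "[s]"] by (simp add: reduced_expr_def)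

lemma t_T_up: "s \<in> S \<Longrightarrow> w \<in> carrier G \<Longrightarrow> len w < len (s \<otimes> w) \<Longrightarrow> t s * T w = T (s \<otimes> w)"
  using T_mult[of s w] len_S_left_cases[of s w] by auto

lemma t_T_down:
  assumes "s \<in> S" "w \<in> carrier G" "\<not> len w < len (s \<otimes> w)" shows "t s * T w = T (s \<otimes> w) + \<eta> (q s) * T w"
proof -
  have "T w = t s * T (s \<otimes> w)" using t_T_up[of s "s \<otimes> w"] len_S_left_cases[of s w] assms by auto
  then show ?thesis using hecke_quadratic[OF assms(1)]
    by (metis (no_types, lifting) mult.assoc distrib_right mult_1_left)
qed

definition Tsum :: "('a \<Rightarrow>\<^sub>0 int \<Rightarrow>\<^sub>0 int) \<Rightarrow> 'h" where "Tsum = plin (\<lambda>w c. \<eta> c * T w)"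

text \<open>Coordinates in the basis \<open>T_w\<close>: let \<open>h\<close> act on the basis
  vector of the identity. \<open>kap_Tsum\<close> and \<open>Tsum_kap\<close> say that
  \<open>kap\<close> and \<open>Tsum\<close> are mutually inverse.\<close>

definition kap :: "'h \<Rightarrow> 'a \<Rightarrow>\<^sub>0 int \<Rightarrow>\<^sub>0 int" where "kap h = hact h (single \<one> 1)"

lemma additive_Tsum: "additive Tsum"
  unfolding Tsum_def by (rule additive_plin, rule additive_comp[OF additive_mult_right pres.additive_eta])

lemma additive_kap: "additive kap"
  unfolding kap_def by (rule biadditiveD(2)[OF hact(1)])

lemma Tsum_single: "Tsum (single w c) = \<eta> c * T w"
  unfolding Tsum_def by (rule plin_single_additive, rule additive_comp[OF additive_mult_right pres.additive_eta])

lemmas Tsum_simps = additive.add[OF additive_Tsum] additive.zero[OF additive_Tsum]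
lemmas kap_simps = additive.add[OF additive_kap] additive.zero[OF additive_kap]
  additive.minus[OF additive_kap] additive.diff[OF additive_kap]

lemma kap_F: "kap h \<in> F"
  unfolding kap_def by (rule hact(4))

lemma keys_kap: "keys (kap h) \<subseteq> carrier G"
  using kap_F by (simp add: F_iff)

lemma kap_eta_mult: "kap (\<eta> c * h) = scal c (kap h)"
  using kap_F[of h] by (simp add: kap_def hact(2,5))

lemma kap_t_mult: "s \<in> S \<Longrightarrow> kap (t s * h) = lam s (kap h)"
  using kap_F[of h] by (simp add: kap_def hact(2,6))

lemma kap_one: "kap 1 = single \<one> 1"
  unfolding kap_def by (rule hact(3)) simp

lemma kap_T: "w \<in> carrier G \<Longrightarrow> kap (T w) = single w 1"
proof (induction "len w" arbitrary: w)
  case 0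
  then show ?case using len_eq_0[of w] by (simp add: kap_one)
next
  case (Suc n)
  obtain ws where ws: "reduced_expr G S w ws" using ex_reduced[OF Suc.prems] by auto
  then obtain s vs where v: "ws = s # vs" using Suc.hyps(2) by (cases ws) (auto simp: reduced_expr_def)
  note tail = reduced_tail[OF ws[unfolded v]]
  have "len (s \<otimes> w) = n" using len_S_left_cases[of s w] tail Suc.hyps(2) by auto
  then have "kap (T (s \<otimes> w)) = single (s \<otimes> w) 1" using Suc.hyps(1)[of "s \<otimes> w"] tail by simp
  moreover have "T w = t s * T (s \<otimes> w)" using t_T_up[of s "s \<otimes> w"] tail(2,4,5) by simp
  ultimately show ?case using tail(2,4,5) by (simp add: kap_t_mult lam_single)
qed

lemma kap_Tsum: assumes "f \<in> F" shows "kap (Tsum f) = f"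
  by (rule additive_eqI[OF additive_comp[OF additive_kap additive_Tsum] additive_id])
    (use assms in \<open>auto simp: F_iff Tsum_single kap_eta_mult kap_T\<close>)

lemma t_Tsum: assumes "s \<in> S" "f \<in> F" shows "t s * Tsum f = Tsum (lam s f)"
proof (rule additive_eqI[where f = f])
  show "additive (\<lambda>f. t s * Tsum f)" "additive (\<lambda>f. Tsum (lam s f))"
    by (intro additive_comp[OF additive_mult_left additive_Tsum] additive_comp[OF additive_Tsum additive_lam])+
  fix w c assume "w \<in> keys f"
  then have w: "w \<in> carrier G" using assms by (auto simp: F_iff)
  have "t s * (\<eta> c * T w) = \<eta> c * (t s * T w)" by (metis pres.eta(4) mult.assoc)
  then show "t s * Tsum (single w c) = Tsum (lam s (single w c))"
    using t_T_up[OF assms(1) w] t_T_down[OF assms(1) w]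
    by (auto simp: Tsum_single lam_single Tsum_simps distrib_left pres.eta(3) mult.assoc)
      (metis pres.eta(4) mult.assoc)
qed

lemma ex_Tsum: "\<exists>f\<in>F. h = Tsum f"
proof -
  obtain a where a: "a \<in> free_alg S" "h = feval \<eta> t a" using pres.feval_surj by metis
  have mon: "set gs \<subseteq> S \<Longrightarrow> \<exists>f\<in>F. prod_list (map t gs) = Tsum f" for gs
  proof (induction gs)
    case Nil show ?case by (rule bexI[of _ "single \<one> 1"]) (auto simp: Tsum_single pres.eta)
  next
    case (Cons s gs)
    then obtain f where "f \<in> F" "prod_list (map t gs) = Tsum f" by auto
    then show ?case using Cons.prems t_Tsum[of s f] lam_F[of s f] by auto
  qed
  have "\<exists>f\<in>F. feval \<eta> t a = Tsum f"
  proof (induction a rule: pm_induct)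
    case zero then show ?case by (intro bexI[of _ 0]) (auto simp: pres.feval_simps Tsum_simps)
  next
    case (add a b)
    then obtain f g where "f \<in> F" "g \<in> F" "feval \<eta> t a = Tsum f" "feval \<eta> t b = Tsum g" by blast
    then show ?case by (intro bexI[of _ "f + g"] F_add) (auto simp: pres.feval_simps Tsum_simps)
  next
    case (single w c)
    then have "set (letters w) \<subseteq> S" using a by (auto simp: free_alg_def)
    then obtain f where f: "f \<in> F" "prod_list (map t (letters w)) = Tsum f" using mon by blast
    have "\<eta> c * Tsum f = Tsum (scal c f)"
      by (rule additive_eqI[OF additive_comp[OF additive_mult_left additive_Tsum]
            additive_comp[OF additive_Tsum biadditiveD(1)[OF biadditive_scal]]])
        (simp add: Tsum_single pres.eta(3) mult.assoc)
    moreover have "scal c f \<in> F" using f by (auto simp: F_iff in_keys_iff)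
    ultimately show ?case using f by (auto simp: pres.feval_single)
  qed
  then show ?thesis using a by simp
qed

lemma Tsum_kap: "Tsum (kap h) = h"
  using ex_Tsum[of h] kap_Tsum by auto

lemma hecke_comb_Tsum:
  assumes "finite A" shows "hecke_comb G S \<eta> t A c = Tsum (\<Sum>w\<in>A. single w (c w))"
  unfolding hecke_comb_def additive.sum[OF additive_Tsum] by (simp add: Tsum_single)

lemma hecke_induct [case_names zero T add]:
  assumes "P 0" "\<And>w c. w \<in> keys (kap h) \<Longrightarrow> P (\<eta> c * T w)" "\<And>a b. P a \<Longrightarrow> P b \<Longrightarrow> P (a + b)"
  shows "P h"
proof -
  have "P (Tsum f)" if "keys f \<subseteq> keys (kap h)" for f
    by (induction f rule: pm_induct) (use assms that in \<open>auto simp: Tsum_simps Tsum_single\<close>)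
  from this[of "kap h"] show ?thesis by (simp add: Tsum_kap)
qed

end

section \<open>Parabolic subalgebras and induced modules\<close>

locale parabolic_hecke = hecke G S L \<eta> t + parabolic G S J
  for G :: "('w, 'q) monoid_scheme" (structure) and S L and \<eta> :: "(int \<Rightarrow>\<^sub>0 int) \<Rightarrow> 'h::ring_1" and t J
begin

abbreviation HJ :: "'h set" where "HJ \<equiv> hecke_parabolic G S \<eta> t J"

lemma HJ_iff: "h \<in> HJ \<longleftrightarrow> keys (kap h) \<subseteq> WJ"
proof
  assume "h \<in> HJ"
  then obtain A c where A: "finite A" "A \<subseteq> WJ" "h = hecke_comb G S \<eta> t A c"
    unfolding hecke_parabolic_def by blast
  define f where "f = (\<Sum>w\<in>A. single w (c w))"
  have "keys f \<subseteq> WJ" using keys_sum[of "\<lambda>w. single w (c w)" A] A unfolding f_def by (auto split: if_splits)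
  moreover from this have "f \<in> F" using WJ_closed by (auto simp: F_iff)
  then have "kap h = f" unfolding A(3) hecke_comb_Tsum[OF A(1)] f_def[symmetric] by (rule kap_Tsum)
  ultimately show "keys (kap h) \<subseteq> WJ" by simp
next
  assume *: "keys (kap h) \<subseteq> WJ"
  have "h = hecke_comb G S \<eta> t (keys (kap h)) (lookup (kap h))"
    using hecke_comb_Tsum[of "keys (kap h)" "lookup (kap h)"] by (simp add: sum_single_lookup Tsum_kap)
  then show "h \<in> HJ" using * unfolding hecke_parabolic_def
    by (intro CollectI exI[of _ "keys (kap h)"] exI[of _ "lookup (kap h)"]) simp
qed

lemma HJ_add: "a \<in> HJ \<Longrightarrow> b \<in> HJ \<Longrightarrow> a + b \<in> HJ"
  using keys_add[of "kap a" "kap b"] by (auto simp: HJ_iff kap_simps)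

lemma HJ_minus: "a \<in> HJ \<Longrightarrow> - a \<in> HJ"
  by (simp add: HJ_iff kap_simps)

lemma HJ_0 [simp]: "0 \<in> HJ"
  by (simp add: HJ_iff kap_simps)

lemma HJ_eta_mult: "a \<in> HJ \<Longrightarrow> \<eta> c * a \<in> HJ"
  by (auto simp: HJ_iff kap_eta_mult in_keys_iff subset_iff)

lemma HJ_T [simp]: "w \<in> WJ \<Longrightarrow> T w \<in> HJ"
  by (simp add: HJ_iff kap_T)

lemma HJ_1 [simp]: "1 \<in> HJ"
  using HJ_T[of \<one>] by simp

lemma HJ_eta [simp]: "\<eta> c \<in> HJ"
  using HJ_eta_mult[of 1 c] by simp

lemma HJ_t [simp]: "s \<in> J \<Longrightarrow> t s \<in> HJ"
  using HJ_T[of s] by simp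

lemma HJ_t_mult: assumes "s \<in> J" "a \<in> HJ" shows "t s * a \<in> HJ"
proof -
  have "keys (lam s f) \<subseteq> WJ" if "keys f \<subseteq> WJ" for f
  proof (induction f rule: pm_induct)
    case (single w c)
    then have "w \<in> WJ" using that by auto
    then show ?case
      using assms keys_add[of "single (s \<otimes> w) c" "single w (q s * c)"] by (auto simp: lam_single split: if_splits)
  next
    case (add a b) then show ?case using keys_add[of "lam s a" "lam s b"] by (auto simp: lam_simps)
  qed (simp add: lam_simps)
  then show ?thesis using assms by (simp add: HJ_iff kap_t_mult)
qed

lemma T_J_word: assumes "w \<in> WJ" obtains ws where "ws \<in> lists J" "T w = prod_list (map t ws)"
proof -
  obtain ws where "ws \<in> lists J" "ws \<in> lists S" "word ws = w" "length ws = len w" using WJ_reducedE[OF assms] .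
  then show thesis using that T_word[of w ws] by (simp add: reduced_expr_def)
qed

lemma HJ_induct [consumes 1, case_names T add]:
  assumes "h \<in> HJ" "\<And>w c. w \<in> WJ \<Longrightarrow> P (\<eta> c * T w)" "\<And>a b. P a \<Longrightarrow> P b \<Longrightarrow> P (a + b)"
  shows "P h"
proof (induction h rule: hecke_induct)
  case zero
  show ?case using assms(2)[of \<one> 0] by (simp add: additive.zero[OF pres.additive_eta])
next
  case (T w c) then show ?case using assms(1,2) by (auto simp: HJ_iff)
next
  case (add a b) then show ?case by (rule assms(3))
qed

lemma HJ_mult: assumes "a \<in> HJ" "b \<in> HJ" shows "a * b \<in> HJ"
  using assms(1)
proof (induction a rule: HJ_induct)
  case (T w c)
  obtain ws where ws: "ws \<in> lists J" "T w = prod_list (map t ws)" using T_J_word[OF T] .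
  have "prod_list (map t ws) * b \<in> HJ"
    using ws(1) by (induction ws) (simp_all add: assms(2) HJ_t_mult mult.assoc)
  then show ?case using HJ_eta_mult[of "prod_list (map t ws) * b" c] by (simp add: ws mult.assoc)
next
  case (add a a') then show ?case by (simp add: distrib_right HJ_add)
qed

section \<open>The Hecke algebra as a free right module over its parabolic subalgebra\<close>

definition dpart :: "'w \<Rightarrow> 'w" where "dpart w = (SOME x. x \<in> D \<and> (\<exists>y\<in>WJ. w = x \<otimes> y))"
definition jpart :: "'w \<Rightarrow> 'w" where "jpart w = inv (dpart w) \<otimes> w"

lemma dpart_mult [simp]: assumes "x \<in> D" "y \<in> WJ" shows "dpart (x \<otimes> y) = x" "jpart (x \<otimes> y) = y"
proof -
  show "dpart (x \<otimes> y) = x" unfolding dpart_def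
    by (rule some_equality) (use assms coset_decomp_unique in blast)+
  then show "jpart (x \<otimes> y) = y" using assms by (simp add: jpart_def)
qed

lemma decomp:
  assumes "w \<in> carrier G"
  shows "dpart w \<in> D" "jpart w \<in> WJ" "dpart w \<otimes> jpart w = w" "T w = T (dpart w) * T (jpart w)"
proof -
  obtain x y where xy: "x \<in> D" "y \<in> WJ" "w = x \<otimes> y" using ex_coset_decomp[OF assms] by blast
  show "dpart w \<in> D" "jpart w \<in> WJ" "dpart w \<otimes> jpart w = w" "T w = T (dpart w) * T (jpart w)"
    using xy(1,2) T_mult[of x y] D_len[OF xy(1,2)] unfolding xy(3) by simp_all
qed

text \<open>\<open>comp h\<close> consists of the coefficients of \<open>h\<close> in the basis \<open>(T\<^sub>y)\<close>, \<open>y \<in> D\<close>, of the right \<open>H\<^sub>J\<close>-module \<open>H\<close>.\<close>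
definition comp :: "'h \<Rightarrow> 'w \<Rightarrow>\<^sub>0 'h" where
  "comp h = plin (\<lambda>w c. single (dpart w) (\<eta> c * T (jpart w))) (kap h)"

lemma additive_comp_summand: "additive (\<lambda>c. single (dpart w) (\<eta> c * T (jpart w)))"
  by (rule additive_comp[OF additive_single additive_comp[OF additive_mult_right pres.additive_eta]])

lemma additive_comp_fun: "additive comp"
  unfolding comp_def by (rule additive_comp[OF additive_plin[OF additive_comp_summand] additive_kap])

lemmas comp_simps = additive.add[OF additive_comp_fun] additive.zero[OF additive_comp_fun]
  additive.minus[OF additive_comp_fun] additive.diff[OF additive_comp_fun]

lemma comp_eta_T: "w \<in> carrier G \<Longrightarrow> comp (\<eta> c * T w) = single (dpart w) (\<eta> c * T (jpart w))"
  unfolding comp_def by (simp add: kap_eta_mult kap_T plin_single additive.zero[OF pres.additive_eta])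

lemma comp_T_mult: assumes "x \<in> D" "b \<in> HJ" shows "comp (T x * b) = single x b"
  using assms(2)
proof (induction b rule: HJ_induct)
  case (T y c)
  have "T x * (\<eta> c * T y) = \<eta> c * T (x \<otimes> y)"
    using T_mult[of x y] D_len[of x y] assms T by simp (metis pres.eta(4) mult.assoc)
  then show ?case using assms T comp_eta_T[of "x \<otimes> y" c] by simp
next
  case (add a b) then show ?case by (simp add: distrib_left comp_simps single_add)
qed

lemma coset_induct [case_names zero T add]:
  assumes "P 0" "\<And>x b. x \<in> D \<Longrightarrow> b \<in> HJ \<Longrightarrow> P (T x * b)" "\<And>a b. P a \<Longrightarrow> P b \<Longrightarrow> P (a + b)"
  shows "P h"
proof (induction h rule: hecke_induct)
  case (T w c)
  then have w: "w \<in> carrier G" using keys_kap by blast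
  have "\<eta> c * T w = T (dpart w) * (\<eta> c * T (jpart w))"
    unfolding decomp(4)[OF w] by (metis pres.eta(4) mult.assoc)
  then show ?case using assms(2)[of "dpart w" "\<eta> c * T (jpart w)"] decomp[OF w] HJ_eta_mult by simp
qed (use assms in auto)

lemma lookup_comp_HJ [simp]: "lookup (comp h) y \<in> HJ"
  by (induction h rule: coset_induct) (auto simp: comp_simps comp_T_mult lookup_single when_def lookup_add HJ_add)

lemma keys_comp: "keys (comp h) \<subseteq> D"
proof (induction h rule: coset_induct)
  case (add a b) then show ?case using keys_add[of "comp a" "comp b"] by (auto simp: comp_simps)
qed (auto simp: comp_simps comp_T_mult)

lemma comp_mult: assumes "b \<in> HJ" shows "comp (h * b) = Poly_Mapping.map (\<lambda>a. a * b) (comp h)"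
proof (induction h rule: coset_induct)
  case (T x a)
  then show ?case using assms comp_T_mult[of x "a * b"] comp_T_mult[of x a] HJ_mult[of a b]
    by (simp add: mult.assoc)
next
  case (add g h)
  then show ?case by (simp add: distrib_right comp_simps additive.add[OF additive_map[OF additive_mult_right]])
qed (simp add: comp_simps additive.zero[OF additive_map[OF additive_mult_right]])

lemma comp_HJ: "b \<in> HJ \<Longrightarrow> comp b = single \<one> b"
  using comp_T_mult[OF one_D, of b] by simp

text \<open>Composing with this projection makes the embedding of \<open>H\<^sub>J\<close>, which is only additive on \<open>H\<^sub>J\<close>, additive everywhere.\<close>
definition proj :: "'h \<Rightarrow> 'h" where "proj h = lookup (comp h) \<one>"

lemma additive_proj: "additive proj"
  unfolding proj_def by (rule additive_comp[OF additive_lookup additive_comp_fun])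

lemma proj_HJ [simp]: "proj h \<in> HJ"
  by (simp add: proj_def)

lemma proj_id [simp]: "b \<in> HJ \<Longrightarrow> proj b = b"
  by (simp add: proj_def comp_HJ)

lemma D_ble_mult: assumes x: "x \<in> D" and y: "y \<in> WJ" shows "ble x (x \<otimes> y)"
proof -
  have "ws \<in> lists J \<Longrightarrow> length ws = len (word ws) \<Longrightarrow> ble x (x \<otimes> word ws)" for ws
  proof (induction ws rule: rev_induct)
    case Nil then show ?case using x by simp
  next
    case (snoc r ws)
    have ws: "ws \<in> lists J" "ws \<in> lists S" "r \<in> J" using snoc.prems lists_J_S by auto
    have wW: "word ws \<in> WJ" "word ws \<otimes> r \<in> WJ" using word_in_generate[OF ws(1)] ws(3) by simp_all
    have w: "word (ws @ [r]) = word ws \<otimes> r" using ws by simp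
    have l: "len (word ws \<otimes> r) = Suc (length ws)" using snoc.prems(2) w by simp
    then have lw: "length ws = len (word ws)"
      using len_S_right_cases[of r "word ws"] len_le[OF ws(2)] ws by auto
    then have "ble x (x \<otimes> word ws)" using snoc.IH ws by simp
    moreover have "ble (x \<otimes> word ws) (x \<otimes> word ws \<otimes> r)"
    proof (rule ble_reflection)
      have "len (x \<otimes> word ws \<otimes> r) = len x + len (word ws \<otimes> r)" using D_len[OF x wW(2)] x ws by (simp add: m_assoc)
      then show "len (x \<otimes> word ws) < len (x \<otimes> word ws \<otimes> r)" using D_len[OF x wW(1)] l lw by simp
    qed (use x ws S_refls in auto)
    ultimately show ?case using ble_trans x ws unfolding w by (simp add: m_assoc[symmetric])
  qed
  then show ?thesis using WJ_reducedE[OF y] by metis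
qed

lemma lookup_lam:
  assumes "s \<in> S" "f \<in> F" "z \<in> carrier G"
  shows "lookup (lam s f) z = lookup f (s \<otimes> z) + (if len z < len (s \<otimes> z) then 0 else q s * lookup f z)"
proof (induction f rule: pm_induct)
  case (single w c)
  then have "w \<in> carrier G" using assms(2) by (auto simp: F_iff)
  then have "s \<otimes> w = z \<longleftrightarrow> w = s \<otimes> z" using assms S_cancel by metis
  then show ?case by (auto simp: lam_single lookup_add lookup_single when_def)
qed (auto simp: lam_simps lookup_add algebra_simps)

end

subsection \<open>The bar involution of the Hecke algebra\<close>

locale hecke_bar = parabolic_hecke G S L \<eta> t J
  for G :: "('w, 'q) monoid_scheme" (structure) and S L and \<eta> :: "(int \<Rightarrow>\<^sub>0 int) \<Rightarrow> 'h::ring_1" and t J +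
  fixes \<iota> :: "'h \<Rightarrow> 'h"
  assumes bar: "is_hecke_bar S \<eta> t \<iota>"
begin

lemma iota: "\<iota> 1 = 1" "\<iota> (a + b) = \<iota> a + \<iota> b" "\<iota> (a * b) = \<iota> a * \<iota> b" "\<iota> (\<eta> c) = \<eta> (lbar c)"
   "s \<in> S \<Longrightarrow> \<iota> (t s) * t s = 1"
  using bar unfolding is_hecke_bar_def by blast+

lemma additive_iota: "additive \<iota>"
  by (simp add: additive_def iota)

lemmas iota_simps = additive.minus[OF additive_iota] additive.zero[OF additive_iota] additive.diff[OF additive_iota]

lemma iota_t: assumes "s \<in> S" shows "\<iota> (t s) = t s - \<eta> (q s)"
proof -
  have "t s * (t s - \<eta> (q s)) = 1"
    using hecke_quadratic[OF assms] pres.eta(4)[of "q s" "t s"] by (simp add: algebra_simps)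
  then have "\<iota> (t s) * (t s * (t s - \<eta> (q s))) = \<iota> (t s)" by simp
  then show ?thesis using iota(5)[OF assms] by (simp flip: mult.assoc)
qed

lemma iota_HJ: assumes "b \<in> HJ" shows "\<iota> b \<in> HJ"
  using assms
proof (induction b rule: HJ_induct)
  case (T w c)
  obtain ws where ws: "ws \<in> lists J" "T w = prod_list (map t ws)" using T_J_word[OF T] .
  have "\<iota> (prod_list (map t ws)) \<in> HJ"
    using ws(1)
  proof (induction ws)
    case (Cons s ws)
    have "\<iota> (t s) \<in> HJ" using Cons HJ_add[of "t s" "- \<eta> (q s)"] by (simp add: iota_t HJ_minus)
    then show ?case using Cons by (simp add: iota HJ_mult)
  qed (simp add: iota)
  then show ?case by (simp add: iota ws HJ_eta_mult)
qed (simp add: iota HJ_add)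

text \<open>Split off a left descent, \<open>z = s y\<close>, so that \<open>\<iota> (T z)\<close>
  is \<open>T_s - q_s\<close> times \<open>\<iota> (T y)\<close>. The lifting property keeps the
  support below \<open>z\<close>, and the coefficient at \<open>z\<close> is inherited from that at
  \<open>y\<close>.\<close>

lemma kap_iota_T:
  assumes "z \<in> carrier G"
  shows "(\<forall>w\<in>keys (kap (\<iota> (T z))). ble w z) \<and> lookup (kap (\<iota> (T z))) z = 1"
  using assms
proof (induction "len z" arbitrary: z)
  case 0
  then have "z = \<one>" using len_eq_0 by simp
  then show ?case by (simp add: iota kap_one)
next
  case (Suc n)
  obtain ws where ws: "reduced_expr G S z ws" using ex_reduced[OF Suc.prems] by auto
  then obtain s vs where v: "ws = s # vs" using Suc.hyps(2) by (cases ws) (auto simp: reduced_expr_def)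
  note tail = reduced_tail[OF ws[unfolded v]]
  define y where "y = s \<otimes> z"
  define f where "f = kap (\<iota> (T y))"
  have y: "y \<in> carrier G" "len y < len (s \<otimes> y)" "s \<otimes> y = z" "len y = n"
  proof -
    show 1: "y \<in> carrier G" "s \<otimes> y = z" using tail(2,4) by (simp_all add: y_def)
    show "len y < len (s \<otimes> y)" unfolding 1(2) using tail(5) by (simp add: y_def)
    show "len y = n" using len_S_left_cases[OF tail(2,4)] tail(5) Suc.hyps(2) unfolding y_def by linarith
  qed
  have IH: "\<forall>w\<in>keys f. ble w y" "lookup f y = 1" using Suc.hyps(1)[OF y(4)[symmetric] y(1)] unfolding f_def by blast+
  have Tz: "T z = t s * T y" unfolding t_T_up[OF tail(2) y(1,2)] y(3) ..
  have "\<iota> (T z) = t s * \<iota> (T y) - \<eta> (q s) * \<iota> (T y)"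
    unfolding Tz using tail(2) by (simp add: iota iota_t left_diff_distrib)
  then have k: "kap (\<iota> (T z)) = lam s f - scal (q s) f"
    using tail(2) by (simp add: kap_simps kap_t_mult kap_eta_mult f_def)
  have fF: "f \<in> F" unfolding f_def by (rule kap_F)
  \<comment> \<open>Thus the terms with \<open>q s\<close> do not disturb the coefficient at
    \<open>z\<close>.\<close>
  have sz: "lookup f z = 0"
  proof (rule ccontr)
    assume "lookup f z \<noteq> 0"
    then have "ble z y" using IH by (simp add: in_keys_iff)
    then show False using ble_len[of z y] y by simp
  qed
  have "ble w z" if "w \<in> keys (kap (\<iota> (T z)))" for w
  proof -
    have "w \<in> keys (lam s f) \<or> w \<in> keys f"
      using that k by (auto simp: in_keys_iff lookup_minus)
    then have "w \<in> keys f \<or> s \<otimes> w \<in> keys f \<and> w \<in> carrier G"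
      using lookup_lam[OF tail(2) fF, of w] lam_F[OF tail(2) fF] by (auto simp: F_iff in_keys_iff split: if_splits)
    then consider "ble w y" | "ble (s \<otimes> w) y" "w \<in> carrier G" using IH by auto
    then show ?thesis
    proof cases
      case 1 then show ?thesis using ble_left_mult_up(2)[of w y s] tail(2) y by simp
    next
      case 2 then show ?thesis using ble_left_mult_up(1)[of "s \<otimes> w" y s] tail(2) y by simp
    qed
  qed
  moreover have "lookup (kap (\<iota> (T z))) z = 1"
    unfolding k using lookup_lam[OF tail(2) fF Suc.prems] sz IH(2) by (simp add: lookup_minus y_def)
  ultimately show ?case by blast
qed

lemma comp_iota_T_ble:
  assumes "y \<in> D" "x \<in> keys (comp (\<iota> (T y)))" shows "ble x y"
proof -
  obtain w where w: "w \<in> keys (kap (\<iota> (T y)))" "x = dpart w"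
    using assms(2) keys_plin_subset unfolding comp_def by (fastforce split: if_splits)
  then have wc: "w \<in> carrier G" using keys_kap by blast
  have "ble w y" using kap_iota_T[of y] w assms by simp
  moreover have "ble x w" using D_ble_mult[OF decomp(1,2)[OF wc]] decomp(3)[OF wc] w by simp
  ultimately show ?thesis using ble_trans by blast
qed

lemma comp_iota_T_diag: assumes "y \<in> D" shows "lookup (comp (\<iota> (T y))) y = 1"
proof -
  let ?f = "kap (\<iota> (T y))"
  have y: "dpart y = y" "jpart y = \<one>" using dpart_mult[OF assms WJ_one] assms by auto
  have "lookup (comp (\<iota> (T y))) y = (\<Sum>w\<in>keys ?f. lookup (single (dpart w) (\<eta> (lookup ?f w) * T (jpart w))) y)"
    unfolding comp_def plin_def by (simp add: lookup_sum)
  also have "\<dots> = (\<Sum>w\<in>keys ?f. if w = y then 1 else 0)"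
  proof (rule sum.cong)
    fix w assume w: "w \<in> keys ?f"
    then have wc: "w \<in> carrier G" using keys_kap by blast
    have "ble w y" using kap_iota_T[of y] w assms by simp
    \<comment> \<open>Such a \<open>w\<close> exceeds \<open>y\<close> in length by the length of
      \<open>jpart w\<close>, yet it lies below \<open>y\<close>.\<close>
    have "w = y" if "dpart w = y"
    proof -
      have "len w = len y + len (jpart w)" using D_len[OF decomp(1,2)[OF wc]] decomp(3)[OF wc] that by simp
      then have "len (jpart w) = 0" using ble_len[OF \<open>ble w y\<close>] by simp
      then have "jpart w = \<one>" using len_eq_0 decomp(2)[OF wc] by simp
      then show ?thesis using decomp(3)[OF wc] that assms by simp
    qed
    then show "lookup (single (dpart w) (\<eta> (lookup ?f w) * T (jpart w))) y = (if w = y then 1 else 0)"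
      using y kap_iota_T[of y] assms by (auto simp: lookup_single when_def pres.eta)
  qed simp
  also have "\<dots> = 1" using kap_iota_T[of y] assms by (simp add: in_keys_iff)
  finally show ?thesis .
qed

lemma kap_iota_R:
  assumes "is_R_family G S \<eta> t \<iota> R" "z \<in> carrier G" "w \<in> carrier G" shows "lookup (kap (\<iota> (T z))) w = R w z"
proof -
  let ?A = "{w \<in> carrier G. R w z \<noteq> 0}"
  define f where "f = (\<Sum>w\<in>?A. single w (R w z))"
  have R: "finite ?A" "\<iota> (T z) = hecke_comb G S \<eta> t ?A (\<lambda>w. R w z)"
    using assms unfolding is_R_family_def by auto
  have "keys f \<subseteq> carrier G"
    using keys_sum[of "\<lambda>w. single w (R w z)" ?A] unfolding f_def by (auto split: if_splits)
  then have "kap (\<iota> (T z)) = f" unfolding R(2) hecke_comb_Tsum[OF R(1)] f_def[symmetric]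
    by (intro kap_Tsum) (simp add: F_iff)
  moreover have "lookup f w = (\<Sum>u\<in>?A. if u = w then R w z else 0)"
    unfolding f_def by (auto simp: lookup_sum lookup_single when_def intro!: sum.cong)
  ultimately show ?thesis using R(1) assms(3) by auto
qed

text \<open>Grouping the expansion of \<open>\<iota> (T z)\<close> by the cosets
  \<open>x W_J\<close> identifies the \<open>r_elem\<close> as the matrix of the bar involution over
  \<open>HJ\<close>. This turns the equation defining \<open>p\<close> into an invariance statement
  (\<open>iot_cc\<close>).\<close>

lemma comp_iota_r_elem:
  assumes R: "is_R_family G S \<eta> t \<iota> R" and x: "x \<in> D" and z: "z \<in> D"
  shows "lookup (comp (\<iota> (T z))) x = r_elem G S \<eta> t R J x z"
proof -
  let ?f = "kap (\<iota> (T z))"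
  let ?Y = "{y \<in> WJ. R (x \<otimes> y) z \<noteq> 0}"
  let ?K = "{w \<in> keys ?f. dpart w = x}"
  have "lookup (comp (\<iota> (T z))) x = (\<Sum>w\<in>keys ?f. lookup (single (dpart w) (\<eta> (lookup ?f w) * T (jpart w))) x)"
    unfolding comp_def plin_def by (simp add: lookup_sum)
  also have "\<dots> = (\<Sum>w\<in>?K. \<eta> (lookup ?f w) * T (jpart w))"
    by (simp add: sum.inter_filter lookup_single when_def)
  also have "?K = (\<lambda>y. x \<otimes> y) ` ?Y"
  proof
    show "?K \<subseteq> (\<lambda>y. x \<otimes> y) ` ?Y"
    proof
      fix w assume "w \<in> ?K"
      then have w: "w \<in> keys ?f" "dpart w = x" by auto
      then have wc: "w \<in> carrier G" using keys_kap by blast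
      have "w = x \<otimes> jpart w" using decomp(3)[OF wc] w by simp
      moreover have "R w z \<noteq> 0" using kap_iota_R[OF R, of z w] w wc z by (simp add: in_keys_iff)
      ultimately show "w \<in> (\<lambda>y. x \<otimes> y) ` ?Y" using decomp(2)[OF wc] by auto
    qed
    show "(\<lambda>y. x \<otimes> y) ` ?Y \<subseteq> ?K"
      using x z kap_iota_R[OF R, of z] by (auto simp: in_keys_iff)
  qed
  also have "(\<Sum>w\<in>(\<lambda>y. x \<otimes> y) ` ?Y. \<eta> (lookup ?f w) * T (jpart w)) = (\<Sum>y\<in>?Y. \<eta> (R (x \<otimes> y) z) * T y)"
  proof (subst sum.reindex)
    show "inj_on (\<lambda>y. x \<otimes> y) ?Y"
      using dpart_mult(2)[OF x] by (intro inj_on_inverseI[of _ jpart]) auto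
    show "(sum ((\<lambda>w. \<eta> (lookup ?f w) * T (jpart w)) \<circ> (\<lambda>y. x \<otimes> y)) ?Y) = (\<Sum>y\<in>?Y. \<eta> (R (x \<otimes> y) z) * T y)"
      using x z kap_iota_R[OF R, of z] by (intro sum.cong) auto
  qed
  finally show ?thesis by (simp add: r_elem_def hecke_comb_def)
qed

end

subsection \<open>Relations in the W-graph algebra\<close>

lemma wgraph_relations:
  assumes "is_wgraph_algebra G J L e x"
  shows "s \<in> J \<Longrightarrow> e s * e s = e s" "s \<in> J \<Longrightarrow> u \<in> J \<Longrightarrow> e s * e u = e u * e s"
    "s \<in> J \<Longrightarrow> - L s < \<gamma> \<Longrightarrow> \<gamma> < L s \<Longrightarrow> e s * x s \<gamma> = x s \<gamma>"
    "s \<in> J \<Longrightarrow> - L s < \<gamma> \<Longrightarrow> \<gamma> < L s \<Longrightarrow> x s \<gamma> * e s = 0"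
    "s \<in> J \<Longrightarrow> - L s < \<gamma> \<Longrightarrow> \<gamma> < L s \<Longrightarrow> x s \<gamma> = x s (- \<gamma>)"
proof -
  interpret presentation of_int "\<lambda>g. case g of GE s \<Rightarrow> e s | GX s \<gamma> \<Rightarrow> x s \<gamma>" "wgens J L" "wgraph_rels G J L"
    by unfold_locales (use assms in \<open>simp add: is_wgraph_algebra_def\<close>)
  show "e s * e s = e s" if "s \<in> J"
  proof -
    have "fE s * fE s - fE s \<in> wgraph_rels G J L" using that unfolding wgraph_rels_def by blast
    from feval_rel[OF this] show ?thesis by (simp add: feval_simps feval_mult feval_fgen)
  qed
  show "e s * e u = e u * e s" if "s \<in> J" "u \<in> J"
  proof -
    have "fE s * fE u - fE u * fE s \<in> wgraph_rels G J L" using that unfolding wgraph_rels_def by blast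
    from feval_rel[OF this] show ?thesis by (simp add: feval_simps feval_mult feval_fgen)
  qed
  show "e s * x s \<gamma> = x s \<gamma>" if "s \<in> J" "- L s < \<gamma>" "\<gamma> < L s"
  proof -
    have "fE s * fX s \<gamma> - fX s \<gamma> \<in> wgraph_rels G J L" using that unfolding wgraph_rels_def by blast
    from feval_rel[OF this] show ?thesis by (simp add: feval_simps feval_mult feval_fgen)
  qed
  show "x s \<gamma> * e s = 0" if "s \<in> J" "- L s < \<gamma>" "\<gamma> < L s"
  proof -
    have "fX s \<gamma> * fE s \<in> wgraph_rels G J L" using that unfolding wgraph_rels_def by blast
    from feval_rel[OF this] show ?thesis by (simp add: feval_simps feval_mult feval_fgen)
  qed
  show "x s \<gamma> = x s (- \<gamma>)" if "s \<in> J" "- L s < \<gamma>" "\<gamma> < L s"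
  proof -
    have "fX s \<gamma> - fX s (- \<gamma>) \<in> wgraph_rels G J L" using that unfolding wgraph_rels_def by blast
    from feval_rel[OF this] show ?thesis by (simp add: feval_simps feval_mult feval_fgen)
  qed
qed

lemma lookup_x_elem: "lookup (x_elem L x s) \<gamma> = (if - L s < \<gamma> \<and> \<gamma> < L s then x s \<gamma> else 0)"
proof -
  have "lookup (x_elem L x s) \<gamma> = (\<Sum>i\<in>{- L s<..<L s}. if i = \<gamma> then x s \<gamma> else 0)"
    unfolding x_elem_def by (auto simp: lookup_sum lookup_single when_def intro!: sum.cong)
  then show ?thesis by simp
qed

section \<open>The induced module and its bar involution\<close>

locale induced = hecke_bar G S L \<eta> t J \<iota>
  for G :: "('w, 'q) monoid_scheme" (structure) and S L and \<eta> :: "(int \<Rightarrow>\<^sub>0 int) \<Rightarrow> 'h::ring_1" and t J \<iota> +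
  fixes eJ :: "'w \<Rightarrow> 'oj::ring_1" and xJ :: "'w \<Rightarrow> int \<Rightarrow> 'oj" and jJ :: "'h \<Rightarrow> int \<Rightarrow>\<^sub>0 'oj"
  assumes wgraph_J: "is_wgraph_algebra G J L eJ xJ"
    and incl_J: "is_hecke_inclusion G S L \<eta> t J eJ xJ jJ"
    and L_pos: "s \<in> S \<Longrightarrow> L s > 0"
begin

abbreviation jTJ :: "'w \<Rightarrow> int \<Rightarrow>\<^sub>0 'oj" where "jTJ \<equiv> jT L eJ xJ"
abbreviation CJ :: "'w \<Rightarrow> int \<Rightarrow>\<^sub>0 'oj" where "CJ \<equiv> C_elem L eJ xJ"
text \<open>\<open>e_r\<close>, \<open>1 - e_r\<close> and \<open>v_s + v_s^-1\<close> as elements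
  of the Laurent ring. With \<open>fe\<close>, the statement that \<open>e_r\<close> fixes
  \<open>a\<close> becomes the equation \<open>fe r * a = 0\<close>, which can be multiplied and
  checked by exponents.\<close>

definition ee :: "'w \<Rightarrow> int \<Rightarrow>\<^sub>0 'oj" where "ee r = single 0 (eJ r)"
definition fe :: "'w \<Rightarrow> int \<Rightarrow>\<^sub>0 'oj" where "fe r = single 0 (1 - eJ r)"
definition vv :: "'w \<Rightarrow> int \<Rightarrow>\<^sub>0 'oj" where "vv s = vpow (L s) + vpow (- L s)"

abbreviation cm :: "(int \<Rightarrow>\<^sub>0 int) \<Rightarrow> int \<Rightarrow>\<^sub>0 'oj" where "cm \<equiv> Poly_Mapping.map of_int"

lemma additive_cm: "additive cm"
  by (rule additive_map) (simp add: additive_def)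

lemma cm_vpow [simp]: "cm (vpow k) = vpow k"
  by simp

lemma cm_1 [simp]: "cm 1 = 1"
  using cm_vpow[of 0] by simp

lemma cm_commute: "cm c * a = a * cm c"
proof (induction c rule: pm_induct)
  case (single k d)
  show ?case
    by (induction a rule: pm_induct) (simp_all add: mult_single algebra_simps mult_of_int_commute)
qed (simp_all add: additive.add[OF additive_cm] additive.zero[OF additive_cm] algebra_simps)

lemma lbar_cm: "lbar (cm c) = cm (lbar c)"
  by (rule poly_mapping_eqI) (simp add: lookup_lbar lookup_map_0)

lemma cm_q: "cm (q s) = vpow (L s) - vpow (- L s)"
  by (simp add: q_def additive.diff[OF additive_cm])

lemma ee_fe: "r \<in> J \<Longrightarrow> ee r * ee r = ee r" "r \<in> J \<Longrightarrow> fe r * ee r = 0" "fe r + ee r = 1" "lbar (ee r) = ee r" "lbar (fe r) = fe r"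
  using wgraph_relations(1)[OF wgraph_J, of r] by (simp_all add: ee_def fe_def mult_single left_diff_distrib flip: single_add)

lemma x_elem_rel:
  assumes "r \<in> J"
  shows "ee r * x_elem L xJ r = x_elem L xJ r" "x_elem L xJ r * ee r = 0" "lbar (x_elem L xJ r) = x_elem L xJ r"
proof -
  note rel = wgraph_relations[OF wgraph_J]
  have "ee r * x_elem L xJ r = (\<Sum>\<gamma>\<in>{- L r<..<L r}. single \<gamma> (eJ r * xJ r \<gamma>))"
    unfolding x_elem_def ee_def by (simp add: sum_distrib_left mult_single)
  also have "\<dots> = x_elem L xJ r"
    unfolding x_elem_def using rel(3) assms by (intro sum.cong) auto
  finally show "ee r * x_elem L xJ r = x_elem L xJ r" .
  have "x_elem L xJ r * ee r = (\<Sum>\<gamma>\<in>{- L r<..<L r}. single \<gamma> (xJ r \<gamma> * eJ r))"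
    unfolding x_elem_def ee_def by (simp add: sum_distrib_right mult_single)
  also have "\<dots> = 0" using rel(4) assms by (intro sum.neutral) auto
  finally show "x_elem L xJ r * ee r = 0" .
  show "lbar (x_elem L xJ r) = x_elem L xJ r"
  proof (rule poly_mapping_eqI)
    fix \<gamma>
    show "lookup (lbar (x_elem L xJ r)) \<gamma> = lookup (x_elem L xJ r) \<gamma>"
      using rel(5)[OF assms, of \<gamma>] by (cases "- L r < \<gamma> \<and> \<gamma> < L r") (auto simp: lookup_lbar lookup_x_elem)
  qed
qed

lemma CJ_eq: "CJ r = - (vv r * ee r) + x_elem L xJ r"
  unfolding C_elem_def jT_def vv_def ee_def
  by (simp add: distrib_right mult_single single_diff single_uminus)

lemma vv_commute: "vv s * a = a * vv s"
  unfolding vv_def by (simp add: distrib_left distrib_right vpow_commute)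

lemma lbar_vv: "lbar (vv s) = vv s"
  by (simp add: vv_def lbar_simps)

lemma vv_cancel: "s \<in> S \<Longrightarrow> vv s * a = 0 \<Longrightarrow> a = 0"
  using vpow_sum_cancel[of "L s" a] L_pos unfolding vv_def by blast

lemma CJ_ee: "r \<in> J \<Longrightarrow> CJ r * ee r = - (vv r * ee r)"
  by (simp add: CJ_eq left_diff_distrib mult.assoc ee_fe x_elem_rel)

lemma ee_CJ: "r \<in> J \<Longrightarrow> ee r * CJ r = CJ r"
proof -
  assume r: "r \<in> J"
  have "ee r * (vv r * ee r) = vv r * ee r" using ee_fe(1)[OF r] vv_commute[of r "ee r"] by (metis mult.assoc)
  then show ?thesis by (simp add: CJ_eq right_diff_distrib x_elem_rel r)
qed

lemma fe_CJ: assumes "r \<in> J" shows "fe r * CJ r = 0"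
proof -
  have "fe r * CJ r = (fe r * ee r) * CJ r" using ee_CJ[OF assms] by (simp add: mult.assoc)
  then show ?thesis by (simp add: ee_fe assms)
qed

lemma lge_CJ: "L r \<ge> 0 \<Longrightarrow> CJ r \<in> lge (- L r)"
  unfolding C_elem_def jT_def x_elem_def
  by (intro lge_diff lge_add lge_sum lge_single) auto

text \<open>The terms with \<open>e_s\<close> cancel in \<open>j(T_s)\<close> minus its conjugate,
  which leaves \<open>v_s - v_s^-1\<close>. This matches \<open>iota_t\<close>, so the two bar
  involutions agree on \<open>HJ\<close> (\<open>bet_iota\<close>).\<close>

lemma lbar_jTJ: assumes "s \<in> J" shows "lbar (jTJ s) = jTJ s - cm (q s)"
  unfolding jT_def cm_q
  by (simp add: lbar_simps x_elem_rel[OF assms] algebra_simps single_diff single_uminus)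

lemma jJ: "a \<in> HJ \<Longrightarrow> b \<in> HJ \<Longrightarrow> jJ (a + b) = jJ a + jJ b" "a \<in> HJ \<Longrightarrow> b \<in> HJ \<Longrightarrow> jJ (a * b) = jJ a * jJ b"
   "jJ (\<eta> c) = cm c" "s \<in> J \<Longrightarrow> jJ (t s) = jTJ s"
  using incl_J unfolding is_hecke_inclusion_def by blast+

definition bet :: "'h \<Rightarrow> int \<Rightarrow>\<^sub>0 'oj" where "bet h = jJ (proj h)"

lemma additive_bet: "additive bet"
  by (simp add: additive_def bet_def additive.add[OF additive_proj] jJ)

lemmas bet_simps = additive.add[OF additive_bet] additive.zero[OF additive_bet]
  additive.minus[OF additive_bet] additive.diff[OF additive_bet]

lemma bet_HJ: "a \<in> HJ \<Longrightarrow> bet a = jJ a"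
  by (simp add: bet_def)

lemma bet_mult: "a \<in> HJ \<Longrightarrow> b \<in> HJ \<Longrightarrow> bet (a * b) = bet a * bet b"
  by (simp add: bet_HJ HJ_mult jJ)

lemma bet_eta: "bet (\<eta> c) = cm c"
  by (simp add: bet_HJ jJ)

lemma bet_1 [simp]: "bet 1 = 1"
  using bet_eta[of 1] by (simp add: pres.eta)

lemma bet_t: "s \<in> J \<Longrightarrow> bet (t s) = jTJ s"
  by (simp add: bet_HJ jJ)

lemma bet_iota: assumes "b \<in> HJ" shows "bet (\<iota> b) = lbar (bet b)"
  using assms
proof (induction b rule: HJ_induct)
  case (T w c)
  obtain ws where ws: "ws \<in> lists J" "T w = prod_list (map t ws)" using T_J_word[OF T] .
  have HJ: "prod_list (map t us) \<in> HJ" if "us \<in> lists J" for us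
    using that by (induction us) (simp_all add: HJ_mult)
  have "bet (\<iota> (prod_list (map t ws))) = lbar (bet (prod_list (map t ws)))"
    using ws(1)
  proof (induction ws)
    case (Cons s ws)
    have s: "s \<in> J" "ws \<in> lists J" using Cons by auto
    have "bet (\<iota> (t s)) = lbar (bet (t s))"
      using s by (simp add: iota_t bet_simps bet_t bet_eta lbar_jTJ)
    then show ?case using Cons s HJ[OF s(2)] iota_HJ
      by (simp add: iota bet_mult lbar_mult)
  qed (simp add: iota, simp add: vpow_0[symmetric] del: single_one)
  then show ?case using T by (simp add: iota ws(2)[symmetric] bet_mult iota_HJ bet_eta lbar_mult lbar_cm)
qed (simp add: iota bet_simps lbar_simps)

section \<open>A coordinate model of the induced module with coefficients in
  \<open>\<int>[\<Gamma>]\<Omega>\<^sub>J\<close>\<close>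

definition Nn :: "('w \<Rightarrow>\<^sub>0 int \<Rightarrow>\<^sub>0 'oj) set" where "Nn = {n. keys n \<subseteq> D}"

lemma Nn_0 [simp]: "0 \<in> Nn" and Nn_single [simp]: "y \<in> D \<Longrightarrow> single y a \<in> Nn"
  by (simp_all add: Nn_def)

lemma Nn_iff: "n \<in> Nn \<longleftrightarrow> (\<forall>y. y \<notin> D \<longrightarrow> lookup n y = 0)"
  by (auto simp: Nn_def in_keys_iff)

lemma Nn_add: "m \<in> Nn \<Longrightarrow> n \<in> Nn \<Longrightarrow> m + n \<in> Nn" and Nn_diff: "m \<in> Nn \<Longrightarrow> n \<in> Nn \<Longrightarrow> m - n \<in> Nn"
  by (simp_all add: Nn_iff lookup_add lookup_minus)

lemma Nn_sum: "(\<And>i. i \<in> A \<Longrightarrow> f i \<in> Nn) \<Longrightarrow> sum f A \<in> Nn"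
  by (simp add: Nn_iff lookup_sum)

lemma Nn_plin: "(\<And>y a. y \<in> keys n \<Longrightarrow> g y a \<in> Nn) \<Longrightarrow> plin g n \<in> Nn"
  unfolding plin_def by (rule Nn_sum) auto

lemma Nn_eqI: "m \<in> Nn \<Longrightarrow> n \<in> Nn \<Longrightarrow> (\<And>y. y \<in> D \<Longrightarrow> lookup m y = lookup n y) \<Longrightarrow> m = n"
  by (rule poly_mapping_eqI) (metis Nn_iff)

text \<open>The coordinate vector of the tensor of \<open>h\<close> and \<open>a\<close>: the
  coefficients of \<open>h\<close>, which lie in \<open>HJ\<close>, are moved across the tensor sign
  by \<open>bet\<close>.\<close>

definition Psi :: "'h \<Rightarrow> (int \<Rightarrow>\<^sub>0 'oj) \<Rightarrow> 'w \<Rightarrow>\<^sub>0 int \<Rightarrow>\<^sub>0 'oj" where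
  "Psi h a = Poly_Mapping.map (\<lambda>b. bet b * a) (comp h)"

lemma lookup_Psi: "lookup (Psi h a) y = bet (lookup (comp h) y) * a"
  unfolding Psi_def by (rule lookup_map_0) (simp add: bet_simps)

lemma Psi_Nn [simp]: "Psi h a \<in> Nn"
proof -
  have "lookup (comp h) y = 0" if "y \<notin> D" for y using keys_comp[of h] that in_keys_iff[of y "comp h"] by blast
  then show ?thesis by (simp add: Nn_iff lookup_Psi bet_simps)
qed

lemma biadditive_Psi: "biadditive Psi"
  unfolding biadditive_def additive_def
  by (intro conjI allI poly_mapping_eqI)
    (simp_all add: lookup_Psi lookup_add comp_simps bet_simps distrib_left distrib_right)

lemmas Psi_simps = biadditive_simps[OF biadditive_Psi]

lemma Psi_mult: "b \<in> HJ \<Longrightarrow> Psi (h * b) a = Psi h (bet b * a)"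
  by (rule poly_mapping_eqI) (simp add: lookup_Psi comp_mult lookup_map_0 bet_mult mult.assoc)

lemma Psi_T: "x \<in> D \<Longrightarrow> Psi (T x) a = single x a"
  using comp_T_mult[of x 1] by (intro poly_mapping_eqI) (auto simp: lookup_Psi lookup_single when_def bet_simps)

lemma Psi_eta: "Psi (\<eta> c * h) a = Psi h (cm c * a)"
  using Psi_mult[of "\<eta> c" h a] by (simp add: bet_eta pres.eta(4))

definition hmul :: "'h \<Rightarrow> ('w \<Rightarrow>\<^sub>0 int \<Rightarrow>\<^sub>0 'oj) \<Rightarrow> 'w \<Rightarrow>\<^sub>0 int \<Rightarrow>\<^sub>0 'oj" where
  "hmul h n = plin (\<lambda>y a. Psi (h * T y) a) n"

text \<open>The bar involution on both tensor factors. It is given on the basis only;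
  \<open>iot_Psi\<close> shows that it has the expected value on all tensors, and depends on
  \<open>bet_iota\<close>.\<close>

definition iot :: "('w \<Rightarrow>\<^sub>0 int \<Rightarrow>\<^sub>0 'oj) \<Rightarrow> 'w \<Rightarrow>\<^sub>0 int \<Rightarrow>\<^sub>0 'oj" where
  "iot n = plin (\<lambda>y a. Psi (\<iota> (T y)) (lbar a)) n"

definition rmul :: "('w \<Rightarrow>\<^sub>0 int \<Rightarrow>\<^sub>0 'oj) \<Rightarrow> (int \<Rightarrow>\<^sub>0 'oj) \<Rightarrow> 'w \<Rightarrow>\<^sub>0 int \<Rightarrow>\<^sub>0 'oj" where
  "rmul n a = Poly_Mapping.map (\<lambda>b. b * a) n"

lemma lookup_rmul [simp]: "lookup (rmul n a) y = lookup n y * a"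
  by (simp add: rmul_def lookup_map_0)

lemma additive_hmul: "additive (hmul h)"
  unfolding hmul_def by (rule additive_plin, rule biadditiveD(1)[OF biadditive_Psi])

lemma additive_iot: "additive iot"
  unfolding iot_def by (rule additive_plin, rule additive_comp[OF biadditiveD(1)[OF biadditive_Psi] additive_lbar])

lemma additive_rmul: "additive (\<lambda>n. rmul n a)"
  unfolding rmul_def by (rule additive_map[OF additive_mult_right])

lemmas hmul_simps = additive.add[OF additive_hmul] additive.zero[OF additive_hmul] additive.diff[OF additive_hmul]
lemmas iot_simps = additive.add[OF additive_iot] additive.zero[OF additive_iot] additive.diff[OF additive_iot]
lemmas rmul_simps = additive.add[OF additive_rmul] additive.zero[OF additive_rmul] additive.diff[OF additive_rmul]

lemma hmul_Nn [simp]: "hmul h n \<in> Nn" and iot_Nn [simp]: "iot n \<in> Nn"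
  unfolding hmul_def iot_def by (auto intro: Nn_plin)

lemma rmul_Nn [simp]: "n \<in> Nn \<Longrightarrow> rmul n a \<in> Nn"
  by (simp add: Nn_iff)

lemma rmul_rmul: "rmul (rmul n a) b = rmul n (a * b)"
  by (rule poly_mapping_eqI) (simp add: mult.assoc)

lemma rmul_Psi: "rmul (Psi h a) b = Psi h (a * b)"
  by (rule poly_mapping_eqI) (simp add: lookup_Psi mult.assoc)

lemma rmul_single [simp]: "rmul (single y a) b = single y (a * b)"
  by (simp add: rmul_def)

lemma hmul_single: "hmul h (single y a) = Psi (h * T y) a"
  unfolding hmul_def by (rule plin_single) (simp add: Psi_simps)

lemma iot_single: "iot (single y a) = Psi (\<iota> (T y)) (lbar a)"
  unfolding iot_def by (rule plin_single) (simp add: Psi_simps lbar_simps)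

lemma hmul_Psi: "hmul h (Psi g a) = Psi (h * g) a"
proof (induction g rule: coset_induct)
  case (T x b)
  then show ?case using Psi_mult[of b "h * T x" a]
    by (simp add: Psi_mult Psi_T hmul_single mult.assoc)
qed (simp_all add: Psi_simps hmul_simps distrib_left)

lemma iot_Psi: "iot (Psi g a) = Psi (\<iota> g) (lbar a)"
proof (induction g rule: coset_induct)
  case (T x b)
  then show ?case using Psi_mult[OF iota_HJ[OF T(2)], of "\<iota> (T x)" "lbar a"]
    by (simp add: Psi_mult Psi_T iot_single iota lbar_mult bet_iota)
qed (simp_all add: Psi_simps iot_simps iota iota_simps)

lemma iot_hmul: assumes "n \<in> Nn" shows "iot (hmul h n) = hmul (\<iota> h) (iot n)"
  by (rule additive_eqI[OF additive_comp[OF additive_iot additive_hmul] additive_comp[OF additive_hmul additive_iot]])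
    (simp add: hmul_single iot_single iot_Psi hmul_Psi iota)

lemma iot_rmul: "iot (rmul n a) = rmul (iot n) (lbar a)"
  by (rule additive_eqI[OF additive_comp[OF additive_iot additive_rmul] additive_comp[OF additive_rmul additive_iot]])
    (simp add: iot_single rmul_Psi lbar_mult)

lemma hmul_rmul: "hmul h (rmul n a) = rmul (hmul h n) a"
  by (rule additive_eqI[OF additive_comp[OF additive_hmul additive_rmul] additive_comp[OF additive_rmul additive_hmul]])
    (simp add: hmul_single rmul_Psi)

lemma lookup_iot: "lookup (iot n) x = (\<Sum>y\<in>keys n. bet (lookup (comp (\<iota> (T y))) x) * lbar (lookup n y))"
  unfolding iot_def plin_def by (simp add: lookup_sum lookup_Psi)

text \<open>The bar of \<open>T_y\<close> equals \<open>T_y\<close> up to terms strictly below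
  \<open>y\<close>, so a coefficient at maximal length is merely conjugated.\<close>

lemma lookup_iot_top:
  assumes "n \<in> Nn" "\<And>y. y \<in> keys n \<Longrightarrow> len y \<le> k" "u \<in> D" "len u \<ge> k"
  shows "lookup (iot n) u = lbar (lookup n u)"
proof -
  have "lookup (iot n) u = (\<Sum>y\<in>keys n. if y = u then lbar (lookup n u) else 0)"
    unfolding lookup_iot
  proof (rule sum.cong)
    fix y assume y: "y \<in> keys n"
    then have yD: "y \<in> D" using assms(1) by (auto simp: Nn_def)
    show "bet (lookup (comp (\<iota> (T y))) u) * lbar (lookup n y) = (if y = u then lbar (lookup n u) else 0)"
    proof (cases "y = u")
      case True then show ?thesis using comp_iota_T_diag[OF yD] by simp
    next
      case False
      have "u \<notin> keys (comp (\<iota> (T y)))"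
      proof
        assume "u \<in> keys (comp (\<iota> (T y)))"
        then have "ble u y" using comp_iota_T_ble[OF yD] by simp
        then have "len u < len y" using ble_cases[of u y] False by auto
        then show False using assms(2)[OF y] assms(4) by simp
      qed
      then show ?thesis using False by (simp add: in_keys_iff bet_simps)
    qed
  qed simp
  also have "\<dots> = lbar (lookup n u)" by (simp add: in_keys_iff lbar_simps)
  finally show ?thesis .
qed

text \<open>At a support element of maximal length the coefficient is bar invariant and has only
  positive exponents.\<close>

lemma iot_invariant_pos_zero:
  assumes n: "n \<in> Nn" "iot n = n" and pos: "\<And>u. u \<in> D \<Longrightarrow> lookup n u \<in> lge 1"
  shows "n = 0"
proof (rule ccontr)
  assume "n \<noteq> 0"
  then have ne: "keys n \<noteq> {}" by simp
  define k where "k = Max (len ` keys n)"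
  obtain u where u: "u \<in> keys n" "len u = k"
    using Max_in[of "len ` keys n"] ne unfolding k_def by (metis finite_imageI finite_keys image_iff image_is_empty)
  have "len y \<le> k" if "y \<in> keys n" for y unfolding k_def using that by (intro Max_ge) auto
  moreover have uD: "u \<in> D" using u n by (auto simp: Nn_def)
  ultimately have "lookup (iot n) u = lbar (lookup n u)" using lookup_iot_top[OF n(1)] u by auto
  then have "lookup n u = 0" using lge_lbar_zero[OF pos[OF uD]] n(2) by simp
  then show False using u by (simp add: in_keys_iff)
qed

section \<open>The operator \<open>C_s\<close> and its eigenspace\<close>

definition Cs :: "'w \<Rightarrow> ('w \<Rightarrow>\<^sub>0 int \<Rightarrow>\<^sub>0 'oj) \<Rightarrow> 'w \<Rightarrow>\<^sub>0 int \<Rightarrow>\<^sub>0 'oj" where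
  "Cs s = hmul (t s - \<eta> (vpow (L s)))"

lemma additive_Cs: "additive (Cs s)"
  unfolding Cs_def by (rule additive_hmul)

lemmas Cs_simps = additive.add[OF additive_Cs] additive.zero[OF additive_Cs] additive.diff[OF additive_Cs]

lemma Cs_Nn [simp]: "Cs s n \<in> Nn"
  by (simp add: Cs_def)

lemma Cs_rmul: "Cs s (rmul n a) = rmul (Cs s n) a"
  by (simp add: Cs_def hmul_rmul)

lemma iot_Cs: assumes "s \<in> S" "n \<in> Nn" shows "iot (Cs s n) = Cs s (iot n)"
proof -
  have "\<iota> (t s - \<eta> (vpow (L s))) = t s - \<eta> (vpow (L s))"
    using assms by (simp add: iota_simps iota iota_t q_def additive.diff[OF pres.additive_eta])
  then show ?thesis using assms by (simp add: Cs_def iot_hmul)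
qed

lemma sc_L: "s \<in> S \<Longrightarrow> u \<in> Dz s \<Longrightarrow> L (sc s u) = L s"
  using L_conj[of s "sc s u" u] Dz_sc[of s u] Dz_D[of u s] by auto

lemma Cs_single:
  assumes s: "s \<in> S"
  shows "y \<in> Dp s \<Longrightarrow> Cs s (single y a) = single (s \<otimes> y) a - single y (vpow (L s) * a)"
    "y \<in> Dz s \<Longrightarrow> Cs s (single y a) = single y (CJ (sc s y) * a)"
    "y \<in> Dm s \<Longrightarrow> Cs s (single y a) = single (s \<otimes> y) a - single y (vpow (- L s) * a)"
proof -
  have 1: "Cs s (single y a) = Psi (t s * T y) a - single y (vpow (L s) * a)" if "y \<in> D" for y
    using that by (simp add: Cs_def hmul_single left_diff_distrib Psi_simps Psi_eta Psi_T)
  show "Cs s (single y a) = single (s \<otimes> y) a - single y (vpow (L s) * a)" if "y \<in> Dp s"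
    using that s t_T_up[OF s, of y] by (simp add: 1 Dp_iff[OF s] Psi_T)
  show "Cs s (single y a) = single y (CJ (sc s y) * a)" if y: "y \<in> Dz s"
  proof -
    note r = Dz_sc[OF s y]
    have yD: "y \<in> D" using y Dz_D by simp
    have "t s * T y = T (y \<otimes> sc s y)" using t_T_up[OF s, of y] yD r by simp
    also have "\<dots> = T y * t (sc s y)" using T_mult[of y "sc s y"] D_len[OF yD, of "sc s y"] yD r(1) by simp
    finally have "Psi (t s * T y) a = single y (jTJ (sc s y) * a)"
      using r(1) yD by (simp add: Psi_mult bet_t Psi_T)
    then show ?thesis using yD sc_L[OF s y] by (simp add: 1 C_elem_def left_diff_distrib single_diff)
  qed
  show "Cs s (single y a) = single (s \<otimes> y) a - single y (vpow (- L s) * a)" if y: "y \<in> Dm s"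
  proof -
    have "t s * T y = T (s \<otimes> y) + \<eta> (q s) * T y" using t_T_down[OF s, of y] y by (simp add: Dm_iff[OF s])
    then show ?thesis using y
      by (simp add: 1 Dm_iff[OF s] Psi_simps Psi_eta Psi_T cm_q left_diff_distrib single_diff)
  qed
qed

lemma lookup_Cs:
  assumes s: "s \<in> S" and n: "n \<in> Nn"
  shows "u \<in> Dp s \<Longrightarrow> lookup (Cs s n) u = lookup n (s \<otimes> u) - vpow (L s) * lookup n u"
    "u \<in> Dz s \<Longrightarrow> lookup (Cs s n) u = CJ (sc s u) * lookup n u"
    "u \<in> Dm s \<Longrightarrow> lookup (Cs s n) u = lookup n (s \<otimes> u) - vpow (- L s) * lookup n u"
proof -
  have add: "additive (\<lambda>n. lookup (Cs s n) u)"
    "additive (\<lambda>n. lookup n (s \<otimes> u) - a * lookup n u)" "additive (\<lambda>n. a * lookup n u)" for u and a :: "int \<Rightarrow>\<^sub>0 'oj"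
    by (simp_all add: additive_def lookup_add Cs_simps algebra_simps)
  have sw: "s \<otimes> y = u \<longleftrightarrow> y = s \<otimes> u" if "y \<in> D" "u \<in> D" for y u
    using that s S_cancel D_carrier by metis
  note DI = Dp_D[of _ s] Dz_D[of _ s] Dm_D[of _ s]
  note disj = D_disjoint[OF s]
  have key: "y \<in> D" if "y \<in> keys n" for y using that n by (auto simp: Nn_def)
  show "lookup (Cs s n) u = lookup n (s \<otimes> u) - vpow (L s) * lookup n u" if u: "u \<in> Dp s"
  proof (rule additive_eqI[where f = n, OF add(1) add(2)])
    fix y a assume "y \<in> keys n"
    then have y: "y \<in> D" using key by simp
    show "lookup (Cs s (single y a)) u = lookup (single y a) (s \<otimes> u) - vpow (L s) * lookup (single y a) u"
      using s y
    proof (cases rule: D_cases)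
      case plus
      then have "y \<noteq> s \<otimes> u" using Dp_mult[OF s u] disj by blast
      then show ?thesis using plus sw[OF y DI(1)[OF u]] by (auto simp: Cs_single[OF s] lookup_minus lookup_single when_def)
    next
      case zero
      then have "y \<noteq> s \<otimes> u" "y \<noteq> u" using Dp_mult[OF s u] disj u by blast+
      then show ?thesis using zero by (simp add: Cs_single[OF s] lookup_single)
    next
      case minus
      then have "y \<noteq> u" using disj u by blast
      then show ?thesis using minus sw[OF y DI(1)[OF u]] by (auto simp: Cs_single[OF s] lookup_minus lookup_single when_def)
    qed
  qed
  show "lookup (Cs s n) u = CJ (sc s u) * lookup n u" if u: "u \<in> Dz s"
  proof (rule additive_eqI[where f = n, OF add(1) add(3)])
    fix y a assume "y \<in> keys n"
    then have y: "y \<in> D" using key by simp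
    show "lookup (Cs s (single y a)) u = CJ (sc s u) * lookup (single y a) u"
      using s y
    proof (cases rule: D_cases)
      case plus
      then have "s \<otimes> y \<noteq> u" "y \<noteq> u" using Dp_mult[OF s plus] disj u by blast+
      then show ?thesis using plus by (simp add: Cs_single[OF s] lookup_minus lookup_single)
    next
      case zero
      then show ?thesis by (auto simp: Cs_single[OF s] lookup_single when_def)
    next
      case minus
      then have "s \<otimes> y \<noteq> u" "y \<noteq> u" using Dm_mult[OF s minus] disj u by blast+
      then show ?thesis using minus by (simp add: Cs_single[OF s] lookup_minus lookup_single)
    qed
  qed
  show "lookup (Cs s n) u = lookup n (s \<otimes> u) - vpow (- L s) * lookup n u" if u: "u \<in> Dm s"
  proof (rule additive_eqI[where f = n, OF add(1) add(2)])
    fix y a assume "y \<in> keys n"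
    then have y: "y \<in> D" using key by simp
    show "lookup (Cs s (single y a)) u = lookup (single y a) (s \<otimes> u) - vpow (- L s) * lookup (single y a) u"
      using s y
    proof (cases rule: D_cases)
      case plus
      then have "y \<noteq> u" using disj u by blast
      then show ?thesis using plus sw[OF y DI(3)[OF u]] by (auto simp: Cs_single[OF s] lookup_minus lookup_single when_def)
    next
      case zero
      then have "y \<noteq> s \<otimes> u" "y \<noteq> u" using Dm_mult[OF s u] disj u by blast+
      then show ?thesis using zero by (simp add: Cs_single[OF s] lookup_single)
    next
      case minus
      then have "y \<noteq> s \<otimes> u" using Dm_mult[OF s u] disj by blast
      then show ?thesis using minus sw[OF y DI(3)[OF u]] by (auto simp: Cs_single[OF s] lookup_minus lookup_single when_def)
    qed
  qed
qed

text \<open>The eigenspace of \<open>T\<^sub>s\<close> for the eigenvalue \<open>-v\<^sub>s\<^sup>-\<^sup>1\<close>.\<close>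
definition Ne :: "'w \<Rightarrow> ('w \<Rightarrow>\<^sub>0 int \<Rightarrow>\<^sub>0 'oj) set" where
  "Ne s = {n \<in> Nn. Cs s n = rmul n (- vv s)}"

lemma Ne_Nn: "n \<in> Ne s \<Longrightarrow> n \<in> Nn"
  by (simp add: Ne_def)

lemma Ne_0 [simp]: "0 \<in> Ne s"
  by (simp add: Ne_def Cs_simps rmul_simps)

lemma Ne_add: "m \<in> Ne s \<Longrightarrow> n \<in> Ne s \<Longrightarrow> m + n \<in> Ne s"
  by (simp add: Ne_def Nn_add Cs_simps rmul_simps)

lemma Ne_diff: "m \<in> Ne s \<Longrightarrow> n \<in> Ne s \<Longrightarrow> m - n \<in> Ne s"
  by (simp add: Ne_def Nn_diff Cs_simps rmul_simps)

lemma Ne_sum: "(\<And>i. i \<in> A \<Longrightarrow> f i \<in> Ne s) \<Longrightarrow> sum f A \<in> Ne s"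
  by (induction A rule: infinite_finite_induct) (auto intro: Ne_add)

lemma Ne_rmul: "n \<in> Ne s \<Longrightarrow> rmul n a \<in> Ne s"
  by (simp add: Ne_def Cs_rmul rmul_rmul vv_commute)

text \<open>Both \<open>C_s\<close> and the eigenvalue \<open>- (v_s + v_s^-1)\<close> are fixed by
  the bar involution.\<close>

lemma Ne_iot: "s \<in> S \<Longrightarrow> n \<in> Ne s \<Longrightarrow> iot n \<in> Ne s"
  using iot_Cs[of s n] iot_rmul[of n "- vv s"] by (simp add: Ne_def lbar_simps lbar_vv)

lemma vpow_neg_eq_iff: "b = - (vpow (- k) * a) \<longleftrightarrow> a = - (vpow k * b)" for a b :: "int \<Rightarrow>\<^sub>0 'oj"
proof
  assume "b = - (vpow (- k) * a)" then show "a = - (vpow k * b)" by (simp add: vpow_vpow)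
next
  assume "a = - (vpow k * b)" then show "b = - (vpow (- k) * a)" by (simp add: vpow_vpow)
qed

text \<open>Multiplication by \<open>fe r\<close> on the left kills \<open>C_r\<close> and leaves
  \<open>(v_r + v_r^-1) (fe r * a) = 0\<close>, where the first factor may be cancelled. Conversely
  \<open>C_r e_r = - (v_r + v_r^-1) e_r\<close>.\<close>

lemma CJ_eigen_iff:
  assumes "r \<in> J" shows "CJ r * a = - (vv r * a) \<longleftrightarrow> fe r * a = 0"
proof
  assume *: "CJ r * a = - (vv r * a)"
  have "vv r * (fe r * a) = fe r * (vv r * a)" by (simp add: vv_commute[of r "fe r"] flip: mult.assoc)
  also have "\<dots> = - (fe r * (CJ r * a))" unfolding * by simp
  also have "\<dots> = 0" by (simp add: fe_CJ[OF assms] flip: mult.assoc)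
  finally show "fe r * a = 0" using vv_cancel[of r] assms by simp
next
  assume *: "fe r * a = 0"
  have "a = (fe r + ee r) * a" by (simp add: ee_fe)
  then have a: "a = ee r * a" using * by (simp add: distrib_right)
  have "CJ r * a = (CJ r * ee r) * a" by (subst a) (simp add: mult.assoc)
  also have "\<dots> = - (vv r * (ee r * a))" by (simp add: CJ_ee[OF assms] mult.assoc)
  finally show "CJ r * a = - (vv r * a)" by (simp flip: a)
qed

text \<open>The operator couples only \<open>u\<close> and \<open>s \<otimes> u\<close>. For such a
  pair the two eigenvalue equations agree up to a power of \<open>v\<close>, so the one at
  \<open>Dp s\<close> represents both; at \<open>Dz s\<close> use
  \<open>CJ_eigen_iff\<close>.\<close>

lemma Ne_iff:
  assumes s: "s \<in> S" and n: "n \<in> Nn"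
  shows "n \<in> Ne s \<longleftrightarrow> (\<forall>u\<in>Dp s. lookup n u = - (vpow (L s) * lookup n (s \<otimes> u))) \<and>
     (\<forall>u\<in>Dz s. fe (sc s u) * lookup n u = 0)" (is "_ = (?P \<and> ?Z)")
proof -
  let ?E = "\<lambda>u. lookup (Cs s n) u = - (vv s * lookup n u)"
  have "n \<in> Ne s \<longleftrightarrow> (\<forall>u\<in>D. ?E u)"
  proof
    assume "n \<in> Ne s" then show "\<forall>u\<in>D. ?E u" by (simp add: Ne_def vv_commute)
  next
    assume "\<forall>u\<in>D. ?E u"
    then have "Cs s n = rmul n (- vv s)" using n by (intro Nn_eqI) (simp_all add: vv_commute)
    then show "n \<in> Ne s" using n by (simp add: Ne_def)
  qed
  moreover have p: "?E u \<longleftrightarrow> lookup n u = - (vpow (L s) * lookup n (s \<otimes> u))" if "u \<in> Dp s" for u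
  proof -
    have "?E u \<longleftrightarrow> lookup n (s \<otimes> u) = - (vpow (- L s) * lookup n u)"
      unfolding lookup_Cs(1)[OF s n that] vv_def by (auto simp: algebra_simps eq_neg_iff_add_eq_0)
    then show ?thesis by (simp only: vpow_neg_eq_iff)
  qed
  moreover have z: "?E u \<longleftrightarrow> fe (sc s u) * lookup n u = 0" if "u \<in> Dz s" for u
  proof -
    have "vv s = vv (sc s u)" using sc_L[OF s that] by (simp add: vv_def)
    then show ?thesis unfolding lookup_Cs(2)[OF s n that] using CJ_eigen_iff Dz_sc(1)[OF s that] by simp
  qed
  moreover have m: "?E u" if "u \<in> Dm s" ?P for u
  proof -
    have u: "u \<in> carrier G" by (rule D_carrier[OF Dm_D[OF that(1)]])
    have "lookup n (s \<otimes> u) = - (vpow (L s) * lookup n u)"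
      using that(2) Dm_mult[OF s that(1)] u s by fastforce
    then show ?thesis unfolding lookup_Cs(3)[OF s n that(1)] vv_def by (simp add: algebra_simps)
  qed
  ultimately show ?thesis using D_cases[OF s] Dp_D[of _ s] Dz_D[of _ s] by metis
qed

end

section \<open>The canonical basis\<close>

locale canonical = induced G S L \<eta> t J \<iota> eJ xJ jJ
  for G :: "('w, 'q) monoid_scheme" (structure) and S L and \<eta> :: "(int \<Rightarrow>\<^sub>0 int) \<Rightarrow> 'h::ring_1" and t J \<iota>
    and eJ :: "'w \<Rightarrow> 'oj::ring_1" and xJ jJ +
  fixes R :: "'w \<Rightarrow> 'w \<Rightarrow> int \<Rightarrow>\<^sub>0 int" and p :: "'w \<Rightarrow> 'w \<Rightarrow> int \<Rightarrow>\<^sub>0 'oj"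
    and \<mu> :: "'w \<Rightarrow> 'w \<Rightarrow> 'w \<Rightarrow> int \<Rightarrow>\<^sub>0 'oj"
  assumes R_family: "is_R_family G S \<eta> t \<iota> R"
    and p_family: "is_p_family G S J (\<lambda>u z. jJ (r_elem G S \<eta> t R J u z)) p"
    and mu_family: "is_mu_family G S L J eJ xJ p \<mu>"
begin

abbreviation muR :: "'w \<Rightarrow> 'w \<Rightarrow> 'w \<Rightarrow> int \<Rightarrow>\<^sub>0 'oj" where "muR \<equiv> mu_R G S L J eJ xJ p"
abbreviation between :: "'w \<Rightarrow> 'w \<Rightarrow> 'w set" where "between u z \<equiv> {y \<in> D. bless u y \<and> bless y z}"

lemma p_facts:
  assumes "x \<in> D" "z \<in> D"
  shows "p x z \<in> lge 0" "p z z = 1" "\<not> ble x z \<Longrightarrow> p x z = 0" "x \<noteq> z \<Longrightarrow> p x z \<in> lge 1"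
    "p x z = (\<Sum>y\<in>{y \<in> D. ble x y \<and> ble y z}. jJ (r_elem G S \<eta> t R J x y) * lbar (p y z))"
proof -
  have *: "p x z \<in> lnonneg \<and> p z z = 1 \<and> (\<not> ble x z \<longrightarrow> p x z = 0) \<and> (bless x z \<longrightarrow> p x z \<in> lpos) \<and>
     p x z = (\<Sum>y\<in>{y \<in> D. ble x y \<and> ble y z}. jJ (r_elem G S \<eta> t R J x y) * lbar (p y z))"
    using p_family assms unfolding is_p_family_def by blast
  then show "p x z \<in> lge 0" "p z z = 1" "\<not> ble x z \<Longrightarrow> p x z = 0"
    "p x z = (\<Sum>y\<in>{y \<in> D. ble x y \<and> ble y z}. jJ (r_elem G S \<eta> t R J x y) * lbar (p y z))"
    unfolding lnonneg_eq_lge by blast+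
  show "p x z \<in> lge 1" if "x \<noteq> z"
    using * that by (cases "ble x z") (auto simp: bruhat_less_def lpos_eq_lge)
qed

lemma finite_D_below: "z \<in> D \<Longrightarrow> finite {y \<in> D. ble y z}"
  using finite_below[of z] by (auto intro: finite_subset)

definition cc :: "'w \<Rightarrow> 'w \<Rightarrow>\<^sub>0 int \<Rightarrow>\<^sub>0 'oj" where
  "cc z = (\<Sum>y\<in>{y \<in> D. ble y z}. single y (p y z))"

lemma cc_Nn [simp]: "cc z \<in> Nn"
  unfolding cc_def by (rule Nn_sum) simp

lemma lookup_cc: assumes "u \<in> D" "z \<in> D" shows "lookup (cc z) u = p u z"
proof -
  have "lookup (cc z) u = (\<Sum>y\<in>{y \<in> D. ble y z}. if y = u then p u z else 0)"
    unfolding cc_def by (auto simp: lookup_sum lookup_single when_def intro!: sum.cong)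
  then show ?thesis using finite_D_below[OF assms(2)] p_facts(3)[OF assms] assms by auto
qed

lemma lookup_cc_out: "u \<notin> D \<Longrightarrow> lookup (cc z) u = 0"
  using cc_Nn Nn_iff by blast

lemma keys_cc: "z \<in> D \<Longrightarrow> u \<in> keys (cc z) \<Longrightarrow> u \<in> D \<and> ble u z"
  using lookup_cc lookup_cc_out p_facts(3) by (metis in_keys_iff)

text \<open>The equation defining \<open>p\<close>, read with the \<open>r_elem\<close> as
  coordinates of \<open>\<iota> (T y)\<close>. The terms outside the interval vanish by
  triangularity.\<close>

lemma iot_cc: assumes z: "z \<in> D" shows "iot (cc z) = cc z"
proof (rule Nn_eqI)
  fix x assume x: "x \<in> D"
  let ?r = "\<lambda>y. bet (lookup (comp (\<iota> (T y))) x)"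
  let ?B = "{y \<in> D. ble y z}"
  have "lookup (iot (cc z)) x = (\<Sum>y\<in>keys (cc z). ?r y * lbar (p y z))"
    unfolding lookup_iot using keys_cc[OF z] lookup_cc z by (intro sum.cong) auto
  also have "\<dots> = (\<Sum>y\<in>?B. ?r y * lbar (p y z))"
  proof (rule sum.mono_neutral_left)
    show "finite ?B" by (rule finite_D_below[OF z])
    show "keys (cc z) \<subseteq> ?B" using keys_cc[OF z] by blast
    show "\<forall>y\<in>?B - keys (cc z). ?r y * lbar (p y z) = 0"
      using lookup_cc[OF _ z] by (auto simp: in_keys_iff lbar_simps)
  qed
  also have "\<dots> = (\<Sum>y\<in>{y \<in> D. ble x y \<and> ble y z}. ?r y * lbar (p y z))"
  proof (rule sum.mono_neutral_right)
    show "finite ?B" by (rule finite_D_below[OF z])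
    show "\<forall>y\<in>?B - {y \<in> D. ble x y \<and> ble y z}. ?r y * lbar (p y z) = 0"
    proof
      fix y assume "y \<in> ?B - {y \<in> D. ble x y \<and> ble y z}"
      then have "y \<in> D" "\<not> ble x y" by auto
      then have "x \<notin> keys (comp (\<iota> (T y)))" using comp_iota_T_ble[of y x] by blast
      then have "lookup (comp (\<iota> (T y))) x = 0" by (simp add: in_keys_iff)
      then show "?r y * lbar (p y z) = 0" by (simp add: bet_simps)
    qed
  qed auto
  also have "\<dots> = p x z"
    unfolding p_facts(5)[OF x z]
  proof (rule sum.cong)
    fix y assume "y \<in> {y \<in> D. ble x y \<and> ble y z}"
    then have "?r y = jJ (r_elem G S \<eta> t R J x y)"
      using comp_iota_r_elem[OF R_family x, of y] bet_HJ[OF lookup_comp_HJ, of "\<iota> (T y)" x] by simp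
    then show "?r y * lbar (p y z) = jJ (r_elem G S \<eta> t R J x y) * lbar (p y z)" by simp
  qed simp
  finally show "lookup (iot (cc z)) x = lookup (cc z) x" using lookup_cc[OF x z] by simp
qed simp_all

text \<open>Top-degree induction: modulo canonical basis elements already known to lie in the eigenspace, the
  coefficients of maximal length are removed one layer at a time.\<close>
lemma Ne_lift:
  assumes s: "s \<in> S"
    and IH: "\<And>u. u \<in> D \<Longrightarrow> len u < N \<Longrightarrow> (u \<in> Dm s \<longrightarrow> cc u \<in> Ne s) \<and> (u \<in> Dz s \<longrightarrow> rmul (cc u) (ee (sc s u)) \<in> Ne s)"
    and "n \<in> Nn" "\<And>u. lookup n u \<in> lge 1" "\<And>u. u \<in> keys n \<Longrightarrow> len u < k" "k \<le> N" "iot n - n \<in> Ne s"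
  shows "n \<in> Ne s"
  using assms(3-)
proof (induction k arbitrary: n)
  case 0
  then have "keys n = {}" by blast
  then show ?case by simp
next
  case (Suc k)
  define U where "U = {u \<in> keys n. len u = k}"
  define tt where "tt = (\<Sum>u\<in>U. rmul (cc u) (lookup n u))"
  have fU: "finite U" by (simp add: U_def)
  have UD: "u \<in> D" if "u \<in> U" for u using that Suc.prems(1) by (auto simp: U_def Nn_def)
  have high: "lookup n w = 0" if "len w > k" for w
    using that Suc.prems(3)[of w] by (auto simp: in_keys_iff)
  have top: "lookup (iot n - n) w = lbar (lookup n w) - lookup n w" if "w \<in> D" "len w \<ge> k" for w
    using lookup_iot_top[OF Suc.prems(1) _ that] Suc.prems(3) by (simp add: lookup_minus less_Suc_eq_le)
  have NeC: "lookup (iot n - n) u = - (vpow (L s) * lookup (iot n - n) (s \<otimes> u))" if "u \<in> Dp s" for u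
    using Suc.prems(5) that Ne_iff[OF s Ne_Nn[OF Suc.prems(5)]] by blast
  have NeZ: "fe (sc s u) * lookup (iot n - n) u = 0" if "u \<in> Dz s" for u
    using Suc.prems(5) that Ne_iff[OF s Ne_Nn[OF Suc.prems(5)]] by blast
  have "tt \<in> Ne s"
    unfolding tt_def
  proof (rule Ne_sum)
    fix u assume u: "u \<in> U"
    then have uk: "len u = k" "u \<in> keys n" by (auto simp: U_def)
    have lu: "len u < N" using uk Suc.prems(4) by simp
    show "rmul (cc u) (lookup n u) \<in> Ne s"
      using s UD[OF u]
    proof (cases rule: D_cases)
      case plus
      then have su: "s \<otimes> u \<in> D" "len (s \<otimes> u) > k" using Dp_iff[OF s] uk by auto
      \<comment> \<open>\<open>s \<otimes> u\<close> is longer than every support element of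
        \<open>n\<close>; the eigenspace condition then makes the coefficient at \<open>u\<close>
        bar invariant, hence zero.\<close>
      have "lookup (iot n - n) (s \<otimes> u) = 0" using top[of "s \<otimes> u"] su high[OF su(2)] by (simp add: lbar_simps)
      then have "lbar (lookup n u) = lookup n u" using NeC[OF plus] top[OF UD[OF u]] uk by simp
      then have "lookup n u = 0" using lge_lbar_zero Suc.prems(2) by blast
      then show ?thesis using uk by (simp add: in_keys_iff)
    next
      case zero
      have "fe (sc s u) * (lbar (lookup n u) - lookup n u) = 0"
        using NeZ[OF zero] top[OF UD[OF u]] uk by simp
      then have "lbar (fe (sc s u) * lookup n u) = fe (sc s u) * lookup n u"
        by (simp add: lbar_mult ee_fe right_diff_distrib)
      moreover have "fe (sc s u) * lookup n u \<in> lge 1"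
        using lge_mult[OF lge_single[of 0 0] Suc.prems(2)[of u]] by (simp add: fe_def)
      ultimately have z: "fe (sc s u) * lookup n u = 0" by (intro lge_lbar_zero)
      have "lookup n u = (fe (sc s u) + ee (sc s u)) * lookup n u" by (simp add: ee_fe)
      then have "lookup n u = ee (sc s u) * lookup n u" using z by (simp add: distrib_right)
      then have "rmul (cc u) (lookup n u) = rmul (rmul (cc u) (ee (sc s u))) (lookup n u)"
        by (simp add: rmul_rmul)
      then show ?thesis using IH[OF UD[OF u] lu] zero Ne_rmul by simp
    next
      case minus
      then show ?thesis using IH[OF UD[OF u] lu] Ne_rmul by simp
    qed
  qed
  have tN: "tt \<in> Nn" using \<open>tt \<in> Ne s\<close> by (rule Ne_Nn)
  have lt: "lookup tt w = (\<Sum>u\<in>U. p w u * lookup n u)" if "w \<in> D" for w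
    unfolding tt_def using UD lookup_cc[OF that] by (auto simp: lookup_sum intro!: sum.cong)
  have lt_top: "lookup tt w = lookup n w" if w: "w \<in> D" "len w \<ge> k" for w
  proof -
    have "lookup tt w = (\<Sum>u\<in>U. if u = w then lookup n w else 0)"
      unfolding lt[OF w(1)]
    proof (rule sum.cong)
      fix u assume u: "u \<in> U"
      show "p w u * lookup n u = (if u = w then lookup n w else 0)"
      proof (cases "u = w")
        case True then show ?thesis using p_facts(2)[OF w(1) w(1)] by simp
      next
        case False
        have "\<not> ble w u" using ble_cases[of w u] False u w by (auto simp: U_def)
        then show ?thesis using p_facts(3)[OF w(1) UD[OF u]] False by simp
      qed
    qed simp
    also have "\<dots> = (if w \<in> U then lookup n w else 0)" using fU by simp
    also have "\<dots> = lookup n w" using high[of w] w by (auto simp: U_def in_keys_iff)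
    finally show ?thesis .
  qed
  have iot_t: "iot tt - tt \<in> Ne s" using Ne_iot[OF s \<open>tt \<in> Ne s\<close>] \<open>tt \<in> Ne s\<close> by (rule Ne_diff)
  have "n - tt \<in> Ne s"
  proof (rule Suc.IH)
    show "n - tt \<in> Nn" using Suc.prems(1) tN by (rule Nn_diff)
    show "lookup (n - tt) w \<in> lge 1" for w
    proof (cases "w \<in> D")
      case True
      have "lookup tt w \<in> lge 1" unfolding lt[OF True]
        using lge_mult[OF p_facts(1)[OF True UD] Suc.prems(2)] by (intro lge_sum) simp
      then show ?thesis unfolding lookup_minus by (rule lge_diff[OF Suc.prems(2)])
    next
      case False
      then show ?thesis using Nn_diff[OF Suc.prems(1) tN] by (simp add: Nn_iff)
    qed
    show "len w < k" if "w \<in> keys (n - tt)" for w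
    proof (rule ccontr)
      assume "\<not> len w < k"
      moreover have "w \<in> D" using that Nn_diff[OF Suc.prems(1) tN] by (auto simp: Nn_def)
      ultimately have "lookup (n - tt) w = 0" using lt_top by (simp add: lookup_minus)
      then show False using that by (simp add: in_keys_iff)
    qed
    show "k \<le> N" using Suc.prems(4) by simp
    have eq: "iot (n - tt) - (n - tt) = (iot n - n) - (iot tt - tt)" by (simp add: iot_simps)
    show "iot (n - tt) - (n - tt) \<in> Ne s" unfolding eq by (rule Ne_diff[OF Suc.prems(5) iot_t])
  qed
  then have "(n - tt) + tt \<in> Ne s" using \<open>tt \<in> Ne s\<close> by (rule Ne_add)
  then show ?case by simp
qed

text \<open>It suffices to have an explicit eigenvector \<open>x0\<close> with the leading term of
  the target \<open>c\<close>. Since \<open>c\<close> is bar invariant, \<open>x0 - c\<close>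
  changes under the bar exactly as \<open>x0\<close> does, that is, by an eigenvector; its exponents
  are positive and its support is shorter than \<open>z\<close>, so \<open>Ne_lift\<close>
  applies.\<close>

lemma cc_in_Ne:
  assumes s: "s \<in> S" and z: "z \<in> D"
  shows "(z \<in> Dm s \<longrightarrow> cc z \<in> Ne s) \<and> (z \<in> Dz s \<longrightarrow> rmul (cc z) (ee (sc s z)) \<in> Ne s)"
  using z
proof (induction "len z" arbitrary: z rule: less_induct)
  case less
  note zD = \<open>z \<in> D\<close>
  have core: "c \<in> Ne s"
    if x0: "x0 \<in> Ne s" and c: "c \<in> Nn" "iot c = c" and d: "\<And>u. u \<in> D \<Longrightarrow> lookup (x0 - c) u \<in> lge 1"
      and k: "\<And>u. u \<in> D \<Longrightarrow> \<not> len u < len z \<Longrightarrow> lookup (x0 - c) u = 0" for x0 c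
  proof -
    have N: "x0 - c \<in> Nn" using x0 c Ne_Nn Nn_diff by blast
    have "x0 - c \<in> Ne s"
    proof (rule Ne_lift[OF s, of "len z"])
      show "lookup (x0 - c) u \<in> lge 1" for u
        using d[of u] N by (cases "u \<in> D") (auto simp: Nn_iff)
      show "len u < len z" if "u \<in> keys (x0 - c)" for u
      proof (rule ccontr)
        assume "\<not> len u < len z"
        moreover have "u \<in> D" using that N by (auto simp: Nn_def)
        ultimately show False using k[of u] that in_keys_iff by blast
      qed
      have eq: "iot (x0 - c) - (x0 - c) = iot x0 - x0" by (simp add: iot_simps c)
      show "iot (x0 - c) - (x0 - c) \<in> Ne s" unfolding eq by (rule Ne_diff[OF Ne_iot[OF s x0] x0])
    qed (use less N in auto)
    then have "x0 - (x0 - c) \<in> Ne s" by (rule Ne_diff[OF x0])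
    then show ?thesis by simp
  qed
  have pz: "p u z = 0" if "u \<in> D" "u \<noteq> z" "\<not> len u < len z" for u
    using p_facts(3)[OF that(1) zD] ble_cases[of u z] that by auto
  show ?case
  proof (intro conjI impI)
    assume m: "z \<in> Dm s"
    have sz: "s \<otimes> z \<in> Dp s" "s \<otimes> z \<in> D" "len (s \<otimes> z) < len z" "z \<notin> Dp s"
      using Dm_mult[OF s m] m Dm_iff[OF s, of z] D_disjoint(5)[OF s m] by simp_all
    \<comment> \<open>The eigenvector supported on the pair \<open>z\<close>,
      \<open>s \<otimes> z\<close>: the relation of \<open>Ne_iff\<close> at
      \<open>s \<otimes> z\<close> fixes the coefficient \<open>- v_s\<close>, whose exponent is
      positive.\<close>
    define x0 :: "'w \<Rightarrow>\<^sub>0 int \<Rightarrow>\<^sub>0 'oj" where "x0 = single z 1 - single (s \<otimes> z) (vpow (L s))"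
    have lx: "lookup x0 u = (if u = z then 1 else if u = s \<otimes> z then - vpow (L s) else 0)" for u
      using sz by (auto simp: x0_def lookup_minus lookup_single when_def)
    show "cc z \<in> Ne s"
    proof (rule core)
      have x0N: "x0 \<in> Nn" unfolding x0_def using zD sz by (intro Nn_diff) auto
      show "x0 \<in> Ne s"
        unfolding Ne_iff[OF s x0N]
      proof (intro conjI ballI)
        fix u assume u: "u \<in> Dp s"
        have "s \<otimes> u \<noteq> s \<otimes> z" using D_disjoint(5)[OF s Dp_mult[OF s u]] sz by metis
        moreover have "s \<otimes> u = z \<longleftrightarrow> u = s \<otimes> z" using S_cancel[OF s] u Dp_D zD D_carrier by metis
        moreover have "u \<noteq> z" using u sz by blast
        ultimately show "lookup x0 u = - (vpow (L s) * lookup x0 (s \<otimes> u))" by (simp add: lx)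
      next
        fix u assume u: "u \<in> Dz s"
        then have "u \<noteq> z" "u \<noteq> s \<otimes> z" using m sz D_disjoint[OF s] by blast+
        then show "fe (sc s u) * lookup x0 u = 0" by (simp add: lx)
      qed
      show "lookup (x0 - cc z) u \<in> lge 1" if u: "u \<in> D" for u
      proof (cases "u = z")
        case True then show ?thesis using p_facts(2)[OF zD zD] by (simp add: lookup_minus lookup_cc zD lx)
      next
        case False
        have "vpow (L s) \<in> lge 1" using L_pos[OF s] by (intro lge_single) simp
        then have "lookup x0 u \<in> lge 1" using False lge_uminus by (auto simp: lx)
        then show ?thesis using p_facts(4)[OF u zD False] by (simp add: lookup_minus lookup_cc u zD lge_diff)
      qed
      show "lookup (x0 - cc z) u = 0" if u: "u \<in> D" "\<not> len u < len z" for u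
        using p_facts(2)[OF zD zD] pz[OF u(1) _ u(2)] u sz
        by (cases "u = z") (auto simp: lookup_minus lookup_cc zD lx)
    qed (use iot_cc zD in auto)
  next
    assume z: "z \<in> Dz s"
    let ?e = "ee (sc s z)"
    \<comment> \<open>At \<open>Dz s\<close> the operator acts on this coordinate as
      \<open>C_t\<close>, and \<open>e_t\<close> lies in the eigenspace of
      \<open>C_t\<close>.\<close>
    define x0 :: "'w \<Rightarrow>\<^sub>0 int \<Rightarrow>\<^sub>0 'oj" where "x0 = single z ?e"
    note r = Dz_sc[OF s z]
    have lx: "lookup x0 u = (if u = z then ?e else 0)" for u by (auto simp: x0_def lookup_single when_def)
    have e0: "?e \<in> lge 0" by (simp add: ee_def lge_single)
    show "rmul (cc z) ?e \<in> Ne s"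
    proof (rule core)
      have x0N: "x0 \<in> Nn" unfolding x0_def using zD by simp
      show "x0 \<in> Ne s"
        unfolding Ne_iff[OF s x0N]
      proof (intro conjI ballI)
        fix u assume u: "u \<in> Dp s"
        then have "u \<noteq> z" "s \<otimes> u \<noteq> z" using z D_disjoint[OF s] Dp_mult[OF s u] by blast+
        then show "lookup x0 u = - (vpow (L s) * lookup x0 (s \<otimes> u))" by (simp add: lx)
      next
        fix u assume u: "u \<in> Dz s"
        then show "fe (sc s u) * lookup x0 u = 0" using r by (simp add: lx ee_fe)
      qed
      show "rmul (cc z) ?e \<in> Nn" by simp
      show "iot (rmul (cc z) ?e) = rmul (cc z) ?e" by (simp add: iot_rmul iot_cc zD ee_fe)
      show "lookup (x0 - rmul (cc z) ?e) u \<in> lge 1" if u: "u \<in> D" for u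
      proof (cases "u = z")
        case True then show ?thesis using p_facts(2)[OF zD zD] by (simp add: lookup_minus lookup_cc zD lx)
      next
        case False
        then show ?thesis using lge_mult[OF p_facts(4)[OF u zD False] e0] lge_uminus
          by (simp add: lookup_minus lookup_cc u zD lx)
      qed
      show "lookup (x0 - rmul (cc z) ?e) u = 0" if u: "u \<in> D" "\<not> len u < len z" for u
        using p_facts(2)[OF zD zD] pz[OF u(1) _ u(2)] u
        by (cases "u = z") (auto simp: lookup_minus lookup_cc zD lx)
    qed
  qed
qed

text \<open>Membership in the eigenspace read off in coordinates. Together with \<open>p_Dz\<close>
  this is the form in which the eigenspace enters the study of \<open>\<mu>\<close>.\<close>

lemma p_Dm:
  assumes s: "s \<in> S" and z: "z \<in> Dm s"
  shows "u \<in> Dp s \<Longrightarrow> p u z = - (vpow (L s) * p (s \<otimes> u) z)"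
    "u \<in> Dz s \<Longrightarrow> fe (sc s u) * p u z = 0"
proof -
  have zD: "z \<in> D" using z Dm_D by blast
  then have "cc z \<in> Ne s" using cc_in_Ne[OF s zD] z by blast
  then have *: "(\<forall>u\<in>Dp s. lookup (cc z) u = - (vpow (L s) * lookup (cc z) (s \<otimes> u))) \<and>
     (\<forall>u\<in>Dz s. fe (sc s u) * lookup (cc z) u = 0)"
    using Ne_iff[OF s cc_Nn] by blast
  show "p u z = - (vpow (L s) * p (s \<otimes> u) z)" if "u \<in> Dp s"
    using * that zD Dp_iff[OF s, of u] lookup_cc by auto
  show "fe (sc s u) * p u z = 0" if "u \<in> Dz s"
    using * that zD Dz_D[OF that] lookup_cc by auto
qed

lemma p_Dz:
  assumes s: "s \<in> S" and z: "z \<in> Dz s"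
  shows "u \<in> Dp s \<Longrightarrow> p u z * ee (sc s z) = - (vpow (L s) * (p (s \<otimes> u) z * ee (sc s z)))"
    "u \<in> Dz s \<Longrightarrow> fe (sc s u) * (p u z * ee (sc s z)) = 0"
proof -
  have zD: "z \<in> D" using z Dz_D by blast
  let ?n = "rmul (cc z) (ee (sc s z))"
  have "?n \<in> Ne s" using cc_in_Ne[OF s zD] z by blast
  then have *: "(\<forall>u\<in>Dp s. lookup ?n u = - (vpow (L s) * lookup ?n (s \<otimes> u))) \<and>
     (\<forall>u\<in>Dz s. fe (sc s u) * lookup ?n u = 0)"
    using Ne_iff[OF s rmul_Nn[OF cc_Nn]] by blast
  show "p u z * ee (sc s z) = - (vpow (L s) * (p (s \<otimes> u) z * ee (sc s z)))" if "u \<in> Dp s"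
    using * that zD Dp_iff[OF s, of u] lookup_cc by auto
  show "fe (sc s u) * (p u z * ee (sc s z)) = 0" if "u \<in> Dz s"
    using * that zD Dz_D[OF that] lookup_cc by auto
qed

subsection \<open>The elements mu\<close>

lemma mu_facts:
  assumes "s \<in> S" "u \<in> D" "z \<in> D"
  shows "\<not> bless u z \<Longrightarrow> \<mu> s u z = 0" "z \<in> Dm s \<Longrightarrow> \<mu> s u z = 0" "u \<in> Dp s \<Longrightarrow> \<mu> s u z = 0"
    "lbar (\<mu> s u z) = \<mu> s u z"
    "z \<in> Dp s \<union> Dz s \<Longrightarrow> u \<in> Dz s \<union> Dm s \<Longrightarrow>
      \<mu> s u z + muR s u z + (\<Sum>y\<in>between u z. p u y * \<mu> s y z) \<in> lge 1"
proof -
  have *: "(\<not> (bless u z \<and> z \<in> Dp s \<union> Dz s \<and> u \<in> Dz s \<union> Dm s) \<longrightarrow> \<mu> s u z = 0) \<and>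
        lbar (\<mu> s u z) = \<mu> s u z \<and>
        (z \<in> Dp s \<union> Dz s \<and> u \<in> Dz s \<union> Dm s \<longrightarrow>
           \<mu> s u z + muR s u z +
             (\<Sum>y\<in>between u z. p u y * \<mu> s y z) \<in> lpos)"
    using mu_family assms unfolding is_mu_family_def by blast
  then show "\<not> bless u z \<Longrightarrow> \<mu> s u z = 0" "z \<in> Dm s \<Longrightarrow> \<mu> s u z = 0" "u \<in> Dp s \<Longrightarrow> \<mu> s u z = 0"
    "lbar (\<mu> s u z) = \<mu> s u z"
    "z \<in> Dp s \<union> Dz s \<Longrightarrow> u \<in> Dz s \<union> Dm s \<Longrightarrow>
      \<mu> s u z + muR s u z + (\<Sum>y\<in>between u z. p u y * \<mu> s y z) \<in> lge 1"
    unfolding lpos_eq_lge using D_disjoint[OF assms(1)] by blast+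
qed

lemma mu_R_cases:
  assumes s: "s \<in> S"
  shows "z \<in> Dp s \<Longrightarrow> u \<in> Dz s \<Longrightarrow> muR s u z = - (CJ (sc s u) * p u z)"
    "z \<in> Dp s \<Longrightarrow> u \<in> Dm s \<Longrightarrow> muR s u z = vpow (- L s) * p u z"
    "z \<in> Dz s \<Longrightarrow> u \<in> Dz s \<Longrightarrow> muR s u z = p u z * CJ (sc s z) - CJ (sc s u) * p u z"
    "z \<in> Dz s \<Longrightarrow> u \<in> Dm s \<Longrightarrow> muR s u z = p u z * CJ (sc s z) + vpow (- L s) * p u z"
proof -
  have *: "z \<in> Dz s \<Longrightarrow> z \<notin> Dp s" "u \<in> Dm s \<Longrightarrow> u \<notin> Dz s" using D_disjoint[OF s] by blast+
  show "z \<in> Dp s \<Longrightarrow> u \<in> Dz s \<Longrightarrow> muR s u z = - (CJ (sc s u) * p u z)"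
    "z \<in> Dp s \<Longrightarrow> u \<in> Dm s \<Longrightarrow> muR s u z = vpow (- L s) * p u z"
    "z \<in> Dz s \<Longrightarrow> u \<in> Dz s \<Longrightarrow> muR s u z = p u z * CJ (sc s z) - CJ (sc s u) * p u z"
    "z \<in> Dz s \<Longrightarrow> u \<in> Dm s \<Longrightarrow> muR s u z = p u z * CJ (sc s z) + vpow (- L s) * p u z"
    using * by (simp_all add: mu_R_def)
qed

text \<open>The condition for \<open>\<mu> s u z\<close> involves \<open>\<mu> s y z\<close> with
  \<open>y\<close> strictly between \<open>u\<close> and \<open>z\<close>, so the induction runs
  downwards from \<open>z\<close>.\<close>

lemma mu_induct:
  assumes z: "z \<in> D"
    and step: "\<And>u. u \<in> D \<Longrightarrow> bless u z \<Longrightarrow> (\<And>y. y \<in> D \<Longrightarrow> bless u y \<Longrightarrow> bless y z \<Longrightarrow> P y) \<Longrightarrow> P u"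
    and "u \<in> D" "bless u z"
  shows "P u"
  using assms(3,4)
proof (induction "len z - len u" arbitrary: u rule: less_induct)
  case less
  show ?case
  proof (rule step[OF less.prems])
    fix y assume y: "y \<in> D" "bless u y" "bless y z"
    then have "len z - len y < len z - len u" using bless_len[OF y(2)] bless_len[OF y(3)] by simp
    then show "P y" using less.hyps y by blast
  qed
qed

lemma CJ_lge: "s \<in> S \<Longrightarrow> u \<in> Dz s \<Longrightarrow> CJ (sc s u) \<in> lge (- L s)"
  using lge_CJ[of "sc s u"] sc_L[of s u] L_pos[of s] by simp

lemma mu_R_lge:
  assumes s: "s \<in> S" and D: "u \<in> D" "z \<in> D" "u \<noteq> z" and zu: "z \<in> Dp s \<union> Dz s" "u \<in> Dz s \<union> Dm s"
  shows "muR s u z \<in> lge (1 - L s)"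
proof -
  note p = p_facts(4)[OF D]
  have 1: "CJ (sc s u) * p u z \<in> lge (1 - L s)" if "u \<in> Dz s"
    using CJ_lge[OF s that] p by (rule lge_mult') simp
  have 2: "p u z * CJ (sc s z) \<in> lge (1 - L s)" if "z \<in> Dz s"
    using p CJ_lge[OF s that] by (rule lge_mult') simp
  have 3: "vpow (- L s) * p u z \<in> lge (1 - L s)"
    using lge_vpow_mult[OF p, of "- L s"] by simp
  show ?thesis using zu 1 2 3 mu_R_cases[OF s] by (auto intro: lge_add lge_diff lge_uminus)
qed

text \<open>All other terms of the defining condition have exponents at least
  \<open>1 - L s\<close>: \<open>C_t\<close> and \<open>v_s^-1\<close> start at
  \<open>- L s\<close>, and \<open>p u z\<close> starts at 1 as \<open>u\<close> differs from
  \<open>z\<close>. Bar invariance then gives the upper bound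
  (\<open>lookup_mu_bound\<close>).\<close>

lemma mu_lge:
  assumes s: "s \<in> S" and u: "u \<in> D" and z: "z \<in> D"
  shows "\<mu> s u z \<in> lge (1 - L s)"
proof (cases "bless u z")
  case False then show ?thesis using mu_facts(1)[OF s u z] by simp
next
  case True
  show ?thesis using z _ u True
  proof (rule mu_induct)
    fix u assume u: "u \<in> D" "bless u z" and IH: "\<And>y. y \<in> D \<Longrightarrow> bless u y \<Longrightarrow> bless y z \<Longrightarrow> \<mu> s y z \<in> lge (1 - L s)"
    note mu = mu_facts[OF s u(1) z]
    show "\<mu> s u z \<in> lge (1 - L s)"
    proof (cases "z \<in> Dp s \<union> Dz s \<and> u \<in> Dz s \<union> Dm s")
      case False
      then have "z \<in> Dm s \<or> u \<in> Dp s" using D_cases[OF s u(1)] D_cases[OF s z] by blast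
      then show ?thesis using mu by auto
    next
      case True
      let ?S = "\<Sum>y\<in>between u z. p u y * \<mu> s y z"
      have "u \<noteq> z" using u by auto
      have S: "?S \<in> lge (1 - L s)"
      proof (rule lge_sum)
        fix y assume y: "y \<in> between u z"
        have "p u y * \<mu> s y z \<in> lge (0 + (1 - L s))" by (rule lge_mult) (use y p_facts(1)[OF u(1)] IH in auto)
        then show "p u y * \<mu> s y z \<in> lge (1 - L s)" by simp
      qed
      have "\<mu> s u z + muR s u z + ?S \<in> lge (1 - L s)"
        using lge_mono[OF mu(5), of "1 - L s"] True L_pos[OF s] by simp
      then have "(\<mu> s u z + muR s u z + ?S) - ?S - muR s u z \<in> lge (1 - L s)"
        using S mu_R_lge[OF s u(1) z \<open>u \<noteq> z\<close>] True by (intro lge_diff) auto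
      then show ?thesis by simp
    qed
  qed
qed

text \<open>Multiply the defining condition on the right by \<open>e_t\<close>. The sum vanishes by
  induction, and the term \<open>muR\<close> becomes zero or positive by the eigenspace relations.
  So the bar invariant \<open>\<mu> e_t\<close> has only positive exponents.\<close>

lemma mu_ee:
  assumes s: "s \<in> S" and u: "u \<in> D" and z: "z \<in> Dz s"
  shows "\<mu> s u z * ee (sc s z) = 0"
proof (cases "bless u z")
  case False then show ?thesis using mu_facts(1)[OF s u] z Dz_D by auto
next
  case True
  have zD: "z \<in> D" using z Dz_D by blast
  note rz = Dz_sc(1)[OF s z]
  let ?e = "ee (sc s z)"
  show ?thesis using zD _ u True
  proof (rule mu_induct)
    fix u assume u: "u \<in> D" "bless u z" and IH: "\<And>y. y \<in> D \<Longrightarrow> bless u y \<Longrightarrow> bless y z \<Longrightarrow> \<mu> s y z * ?e = 0"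
    note mu = mu_facts[OF s u(1) zD]
    let ?S = "\<Sum>y\<in>between u z. p u y * \<mu> s y z"
    have S: "?S * ?e = 0"
      unfolding sum_distrib_right by (rule sum.neutral) (use IH in \<open>auto simp: mult.assoc\<close>)
    have e0: "?e \<in> lge 0" by (simp add: ee_def lge_single)
    have "u \<noteq> z" using u by auto
    note pp = p_facts(4)[OF u(1) zD this]
    have main: "\<mu> s u z * ?e + muR s u z * ?e \<in> lge 1" if "u \<in> Dz s \<union> Dm s"
      using lge_mult[OF mu(5) e0] that z S by (simp add: distrib_right)
    have vvL: "vv (sc s z) = vv s" using sc_L[OF s z] by (simp add: vv_def)
    have pCe: "p u z * CJ (sc s z) * ?e = - (vv s * (p u z * ?e))"
      unfolding mult.assoc CJ_ee[OF rz] vvL by (simp add: vv_commute[of s "p u z"] flip: mult.assoc)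
    have fin: "\<mu> s u z * ?e = 0" if "\<mu> s u z * ?e \<in> lge 1"
      using that by (rule lge_lbar_zero) (simp add: lbar_mult mu(4) ee_fe)
    show "\<mu> s u z * ?e = 0"
      using s u(1)
    proof (cases rule: D_cases)
      case plus then show ?thesis using mu(3) by simp
    next
      case zero
      have r: "sc s u \<in> J" using Dz_sc[OF s zero] by simp
      have "CJ (sc s u) * (p u z * ?e) = - (vv (sc s u) * (p u z * ?e))"
        using CJ_eigen_iff[OF r] p_Dz(2)[OF s z zero] by blast
      then have "CJ (sc s u) * p u z * ?e = - (vv s * (p u z * ?e))"
        using sc_L[OF s zero] by (simp add: vv_def mult.assoc)
      then have "muR s u z * ?e = 0"
        using mu_R_cases(3)[OF s z zero] pCe by (simp add: left_diff_distrib)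
      then show ?thesis using main zero fin by simp
    next
      case minus
      \<comment> \<open>The term \<open>v_s^-1 p\<close> cancels against half of
        \<open>p C_t e_t = - (v_s + v_s^-1) p e_t\<close>.\<close>
      have "muR s u z * ?e = - (vpow (L s) * (p u z * ?e))"
        using mu_R_cases(4)[OF s z minus] pCe by (simp add: distrib_right vv_def mult.assoc)
      moreover have "vpow (L s) * (p u z * ?e) \<in> lge 1"
      proof -
        have "vpow (L s) \<in> lge 0" using L_pos[OF s] by (intro lge_single) simp
        from lge_mult[OF this lge_mult[OF pp e0]] show ?thesis by simp
      qed
      ultimately have "\<mu> s u z * ?e - vpow (L s) * (p u z * ?e) \<in> lge 1" using main minus by simp
      from lge_add[OF this \<open>vpow (L s) * (p u z * ?e) \<in> lge 1\<close>] show ?thesis by (intro fin) simp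
    qed
  qed
qed

lemma ee_mu_of_fe: "fe r * a = 0 \<Longrightarrow> ee r * a = a"
proof -
  assume "fe r * a = 0"
  moreover have "a = (fe r + ee r) * a" by (simp add: ee_fe)
  ultimately show ?thesis by (simp add: distrib_right)
qed

text \<open>The mirror image of \<open>mu_ee\<close>, with \<open>1 - e_t\<close> on the left. Here
  \<open>p\<close> separates this factor from the \<open>\<mu>\<close> in the sum, so the vanishing
  of the sum needs the eigenspace relations as well.\<close>

lemma fe_mu:
  assumes s: "s \<in> S" and u: "u \<in> Dz s" and z: "z \<in> D"
  shows "fe (sc s u) * \<mu> s u z = 0"
proof (cases "bless u z")
  case False then show ?thesis using mu_facts(1)[OF s _ z] u Dz_D by auto
next
  case True
  have uD: "u \<in> D" using u Dz_D by blast
  have "u \<in> Dz s \<longrightarrow> fe (sc s u) * \<mu> s u z = 0" using z _ uD True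
  proof (rule mu_induct, intro impI)
    fix u assume u: "u \<in> D" "bless u z" "u \<in> Dz s"
      and IH: "\<And>y. y \<in> D \<Longrightarrow> bless u y \<Longrightarrow> bless y z \<Longrightarrow> y \<in> Dz s \<longrightarrow> fe (sc s y) * \<mu> s y z = 0"
    note mu = mu_facts[OF s u(1) z]
    let ?f = "fe (sc s u)"
    let ?S = "\<Sum>y\<in>between u z. p u y * \<mu> s y z"
    note r = Dz_sc(1)[OF s u(3)]
    have f0: "?f \<in> lge 0" by (simp add: fe_def lge_single)
    have S: "?f * ?S = 0"
      unfolding sum_distrib_left
    proof (rule sum.neutral, rule ballI)
      fix y assume y: "y \<in> between u z"
      then have yD: "y \<in> D" by simp
      show "?f * (p u y * \<mu> s y z) = 0"
        using s yD
      proof (cases rule: D_cases)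
        case plus then show ?thesis using mu_facts(3)[OF s yD z] by simp
      next
        case zero
        \<comment> \<open>The induction hypothesis allows \<open>e\<close> to be inserted between
          \<open>p\<close> and \<open>\<mu>\<close>, which is what \<open>p_Dz\<close>
          requires.\<close>
        have "ee (sc s y) * \<mu> s y z = \<mu> s y z" using IH[of y] y zero by (intro ee_mu_of_fe) simp
        then have "?f * (p u y * \<mu> s y z) = (?f * (p u y * ee (sc s y))) * \<mu> s y z" by (simp add: mult.assoc)
        then show ?thesis using p_Dz(2)[OF s zero u(3)] by simp
      next
        case minus
        then show ?thesis using p_Dm(2)[OF s minus u(3)] by (simp flip: mult.assoc)
      qed
    qed
    show "?f * \<mu> s u z = 0"
      using s z
    proof (cases rule: D_cases)
      case minus then show ?thesis using mu(2) by simp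
    next
      case plus
      have "?f * muR s u z = 0"
        using mu_R_cases(1)[OF s plus u(3)] by (simp add: fe_CJ[OF r] flip: mult.assoc)
      moreover have "?f * (\<mu> s u z + muR s u z + ?S) \<in> lge 1"
        using lge_mult[OF f0 mu(5)] plus u(3) by simp
      ultimately have "?f * \<mu> s u z \<in> lge 1" using S by (simp add: distrib_left)
      then show ?thesis by (rule lge_lbar_zero) (simp add: lbar_mult mu(4) ee_fe)
    next
      case zero
      have "?f * (p u z * CJ (sc s z)) = (?f * (p u z * ee (sc s z))) * CJ (sc s z)"
        using ee_CJ[OF Dz_sc(1)[OF s zero]] by (simp add: mult.assoc)
      then have "?f * (p u z * CJ (sc s z)) = 0" using p_Dz(2)[OF s zero u(3)] by simp
      moreover have "?f * (CJ (sc s u) * p u z) = 0" by (simp add: fe_CJ[OF r] flip: mult.assoc)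
      ultimately have "?f * muR s u z = 0"
        using mu_R_cases(3)[OF s zero u(3)] by (simp add: right_diff_distrib)
      moreover have "?f * (\<mu> s u z + muR s u z + ?S) \<in> lge 1"
        using lge_mult[OF f0 mu(5)] zero u(3) by simp
      ultimately have "?f * \<mu> s u z \<in> lge 1" using S by (simp add: distrib_left)
      then show ?thesis by (rule lge_lbar_zero) (simp add: lbar_mult mu(4) ee_fe)
    qed
  qed
  then show ?thesis using u by simp
qed

lemma ee_mu: "s \<in> S \<Longrightarrow> u \<in> Dz s \<Longrightarrow> z \<in> D \<Longrightarrow> ee (sc s u) * \<mu> s u z = \<mu> s u z"
  by (rule ee_mu_of_fe, rule fe_mu)

lemma lookup_mu_bound:
  assumes "s \<in> S" "u \<in> D" "z \<in> D" "\<not> (- L s < \<gamma> \<and> \<gamma> < L s)" shows "lookup (\<mu> s u z) \<gamma> = 0"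
proof -
  have *: "lookup (\<mu> s u z) \<gamma> = 0" if "\<gamma> \<le> - L s" for \<gamma>
    using mu_lge[OF assms(1-3)] that by (simp add: lge_def)
  have "lookup (\<mu> s u z) \<gamma> = lookup (\<mu> s u z) (- \<gamma>)" using mu_facts(4)[OF assms(1-3)] lookup_lbar by metis
  then show ?thesis using *[of \<gamma>] *[of "- \<gamma>"] assms(4) by auto
qed

subsection \<open>The action of the generators on the canonical basis\<close>

definition below :: "'w \<Rightarrow> 'w set" where "below z = {y \<in> D. bless y z}"

definition mus :: "'w \<Rightarrow> 'w \<Rightarrow> 'w \<Rightarrow>\<^sub>0 int \<Rightarrow>\<^sub>0 'oj" where
  "mus s z = (\<Sum>x\<in>below z. rmul (cc x) (\<mu> s x z))"

lemma finite_below_D: "z \<in> D \<Longrightarrow> finite (below z)"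
  using finite_D_below[of z] unfolding below_def by (rule rev_finite_subset) (auto simp: ble_iff)

lemma mus_Nn [simp]: "mus s z \<in> Nn"
  unfolding mus_def by (intro Nn_sum rmul_Nn cc_Nn)

lemma iot_mus: assumes "s \<in> S" "z \<in> D" shows "iot (mus s z) = mus s z"
  unfolding mus_def additive.sum[OF additive_iot]
  using assms mu_facts(4) by (intro sum.cong) (auto simp: below_def iot_rmul iot_cc)

text \<open>The second form isolates the term \<open>x = u\<close>, so that it contains the sum from
  the condition defining \<open>\<mu>\<close>; the first keeps all terms alike, as
  \<open>mus_Dp\<close> needs.\<close>

lemma lookup_mus:
  assumes s: "s \<in> S" and u: "u \<in> D" and z: "z \<in> D"
  shows "lookup (mus s z) u = (\<Sum>x\<in>below z. p u x * \<mu> s x z)"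
    "lookup (mus s z) u = \<mu> s u z + (\<Sum>y\<in>between u z. p u y * \<mu> s y z)"
proof -
  show 1: "lookup (mus s z) u = (\<Sum>x\<in>below z. p u x * \<mu> s x z)"
    unfolding mus_def lookup_sum using lookup_cc[OF u] by (intro sum.cong) (auto simp: below_def)
  let ?Y = "between u z"
  show "lookup (mus s z) u = \<mu> s u z + (\<Sum>y\<in>?Y. p u y * \<mu> s y z)"
  proof (cases "bless u z")
    case True
    have "(\<Sum>x\<in>below z. p u x * \<mu> s x z) = (\<Sum>x\<in>insert u ?Y. p u x * \<mu> s x z)"
    proof (rule sum.mono_neutral_right)
      show "insert u ?Y \<subseteq> below z" using True u by (auto simp: below_def)
      show "\<forall>x\<in>below z - insert u ?Y. p u x * \<mu> s x z = 0"
      proof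
        fix x assume x: "x \<in> below z - insert u ?Y"
        then have "x \<in> D" "\<not> ble u x" by (auto simp: below_def ble_iff)
        then show "p u x * \<mu> s x z = 0" using p_facts(3)[OF u] by simp
      qed
    qed (rule finite_below_D[OF z])
    also have "\<dots> = p u u * \<mu> s u z + (\<Sum>x\<in>?Y. p u x * \<mu> s x z)"
    proof (rule sum.insert)
      show "finite ?Y" using finite_below_D[OF z] unfolding below_def by (rule rev_finite_subset) auto
    qed auto
    finally show ?thesis using 1 p_facts(2)[OF u u] by simp
  next
    case False
    have "(\<Sum>x\<in>below z. p u x * \<mu> s x z) = 0"
    proof (rule sum.neutral, rule ballI)
      fix x assume "x \<in> below z"
      then have "x \<in> D" "\<not> ble u x" using False bless_trans(2) by (auto simp: below_def)
      then show "p u x * \<mu> s x z = 0" using p_facts(3)[OF u] by simp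
    qed
    moreover have "?Y = {}" using False bless_trans(1) by (auto simp: ble_iff)
    ultimately show ?thesis using 1 mu_facts(1)[OF s u z False] by (simp only: sum.empty) simp
  qed
qed

lemma mus_mu_R:
  assumes "s \<in> S" "u \<in> Dz s \<union> Dm s" "z \<in> Dp s \<union> Dz s"
  shows "lookup (mus s z) u + muR s u z \<in> lge 1"
proof -
  have "u \<in> D" "z \<in> D" using assms Dz_D Dm_D Dp_D by blast+
  then show ?thesis
    using mu_facts(5)[OF assms(1) _ _ assms(3,2)] lookup_mus(2)[OF assms(1)] by (simp add: algebra_simps)
qed

text \<open>The conditions on \<open>\<mu>\<close> are silent at \<open>Dp s\<close>. The eigenspace
  relations replace \<open>p u x\<close> by \<open>- v_s\<close> times
  \<open>p (s \<otimes> u) x\<close>, for \<open>x\<close> in \<open>Dz s\<close> after inserting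
  \<open>e_t\<close> before \<open>\<mu>\<close>, and \<open>v_s \<mu>\<close> has positive
  exponents.\<close>

lemma mus_Dp:
  assumes s: "s \<in> S" and u: "u \<in> Dp s" and z: "z \<in> D"
  shows "lookup (mus s z) u \<in> lge 1"
proof -
  have uD: "u \<in> D" "s \<otimes> u \<in> D" using u Dp_iff[OF s] by auto
  show ?thesis
    unfolding lookup_mus(1)[OF s uD(1) z]
  proof (rule lge_sum)
    fix x assume "x \<in> below z"
    then have x: "x \<in> D" by (simp add: below_def)
    have e0: "ee r \<in> lge 0" for r by (simp add: ee_def lge_single)
    have *: "p (s \<otimes> u) x * (vpow (L s) * \<mu> s x z) \<in> lge 1"
    proof -
      have "vpow (L s) * \<mu> s x z \<in> lge 1" using lge_vpow_mult[OF mu_lge[OF s x z], of "L s"] by simp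
      from lge_mult[OF p_facts(1)[OF uD(2) x] this] show ?thesis by simp
    qed
    show "p u x * \<mu> s x z \<in> lge 1"
      using s x
    proof (cases rule: D_cases)
      case plus then show ?thesis using mu_facts(3)[OF s x z] by simp
    next
      case zero
      have "p u x * \<mu> s x z = (p u x * ee (sc s x)) * \<mu> s x z"
        using ee_mu[OF s zero z] by (simp add: mult.assoc)
      also have "\<dots> = - (vpow (L s) * (p (s \<otimes> u) x * (ee (sc s x) * \<mu> s x z)))"
        unfolding p_Dz(1)[OF s zero u] by (simp add: mult.assoc)
      also have "\<dots> = - (p (s \<otimes> u) x * (vpow (L s) * \<mu> s x z))"
        unfolding ee_mu[OF s zero z] by (simp add: vpow_commute[of "L s" "p (s \<otimes> u) x"] flip: mult.assoc)
      finally show ?thesis using lge_uminus[OF *] by simp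
    next
      case minus
      have "p u x * \<mu> s x z = - (p (s \<otimes> u) x * (vpow (L s) * \<mu> s x z))"
        unfolding p_Dm(1)[OF s minus u] by (simp add: vpow_commute[of "L s" "p (s \<otimes> u) x"] flip: mult.assoc)
      then show ?thesis using lge_uminus[OF *] by simp
    qed
  qed
qed

lemma Cs_cc_Dm: "s \<in> S \<Longrightarrow> z \<in> Dm s \<Longrightarrow> Cs s (cc z) = rmul (cc z) (- vv s)"
  using cc_in_Ne[of s z] Dm_D[of z s] by (simp add: Ne_def)

text \<open>The difference of both sides is bar invariant, so only positivity of its coefficients is
  at stake. At \<open>Dz s\<close> and \<open>Dm s\<close> it comes from the condition defining
  \<open>\<mu>\<close>, at \<open>Dp s\<close> from \<open>mus_Dp\<close>.\<close>

lemma Cs_cc_Dp: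
  assumes s: "s \<in> S" and z: "z \<in> Dp s" shows "Cs s (cc z) = cc (s \<otimes> z) + mus s z"
proof -
  have D: "z \<in> D" "s \<otimes> z \<in> D" using z Dp_iff[OF s] by auto
  have szm: "s \<otimes> z \<in> Dm s" by (rule Dp_mult[OF s z])
  define a where "a = Cs s (cc z) - cc (s \<otimes> z) - mus s z"
  have "a = 0"
  proof (rule iot_invariant_pos_zero)
    show "a \<in> Nn" unfolding a_def by (intro Nn_diff) auto
    show "iot a = a" unfolding a_def by (simp add: iot_simps iot_Cs s iot_cc D iot_mus)
    fix u assume u: "u \<in> D"
    have la: "lookup a u = lookup (Cs s (cc z)) u - p u (s \<otimes> z) - lookup (mus s z) u"
      by (simp add: a_def lookup_minus lookup_cc u D)
    note Csu = lookup_Cs[OF s cc_Nn, of u z]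
    show "lookup a u \<in> lge 1"
      using s u
    proof (cases rule: D_cases)
      case plus
      have su: "s \<otimes> u \<in> D" "s \<otimes> u \<in> Dm s" using plus Dp_iff[OF s] Dp_mult[OF s plus] by auto
      have ne: "s \<otimes> u \<noteq> z" "u \<noteq> z \<or> u = z" "u \<noteq> s \<otimes> z" using D_disjoint[OF s] su z plus szm by blast+
      have "vpow (L s) * p u z \<in> lge 1"
        using lge_mono[OF lge_vpow_mult[OF p_facts(1)[OF u D(1)], of "L s"], of 1] L_pos[OF s] by simp
      then show ?thesis
        unfolding la Csu(1)[OF plus] lookup_cc[OF su(1) D(1)] lookup_cc[OF u D(1)]
        by (intro lge_diff p_facts(4)[OF su(1) D(1)] p_facts(4)[OF u D(2)] mus_Dp s plus D ne(1,3))
    next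
      case zero
      have "u \<noteq> s \<otimes> z" using D_disjoint[OF s] zero szm by blast
      moreover have "lookup a u = - (lookup (mus s z) u + muR s u z) - p u (s \<otimes> z)"
        unfolding la Csu(2)[OF zero] lookup_cc[OF u D(1)] mu_R_cases(1)[OF s z zero] by simp
      ultimately show ?thesis using mus_mu_R[OF s, of u z] zero z p_facts(4)[OF u D(2)]
        by (simp only:) (intro lge_diff lge_uminus; simp)
    next
      case minus
      have su: "s \<otimes> u \<in> D" using Dm_iff[OF s] minus by auto
      \<comment> \<open>For \<open>u = s \<otimes> z\<close> both terms are 1 and cancel; this is
        why \<open>cc (s \<otimes> z)\<close> occurs in the formula.\<close>
      have "p (s \<otimes> u) z - p u (s \<otimes> z) \<in> lge 1"
      proof (cases "u = s \<otimes> z")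
        case True
        then show ?thesis using s D p_facts(2)[OF D(1) D(1)] p_facts(2)[OF D(2) D(2)] by simp
      next
        case False
        then have "s \<otimes> u \<noteq> z" using s u D S_cancel[OF s] D_carrier by metis
        then show ?thesis using False by (intro lge_diff p_facts(4)[OF su D(1)] p_facts(4)[OF u D(2)])
      qed
      moreover have "lookup a u = (p (s \<otimes> u) z - p u (s \<otimes> z)) - (lookup (mus s z) u + muR s u z)"
        unfolding la Csu(3)[OF minus] lookup_cc[OF u D(1)] lookup_cc[OF su D(1)] mu_R_cases(2)[OF s z minus] by simp
      moreover have "lookup (mus s z) u + muR s u z \<in> lge 1"
        using minus z by (intro mus_mu_R s) simp_all
      ultimately show ?thesis using lge_diff by metis
    qed
  qed
  then show ?thesis by (simp add: a_def algebra_simps)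
qed

text \<open>As in \<open>Cs_cc_Dp\<close>, with a right factor \<open>C_t\<close> that is bar
  invariant but has exponents down to \<open>- L s\<close>.\<close>

lemma Cs_cc_Dz:
  assumes s: "s \<in> S" and z: "z \<in> Dz s" shows "Cs s (cc z) = rmul (cc z) (CJ (sc s z)) + mus s z"
proof -
  have D: "z \<in> D" using z Dz_D by blast
  note r = Dz_sc(1)[OF s z]
  define a where "a = Cs s (cc z) - rmul (cc z) (CJ (sc s z)) - mus s z"
  have lbar_CJ: "lbar (CJ (sc s z)) = CJ (sc s z)"
    unfolding CJ_eq using lbar_vv[of "sc s z"] by (simp add: lbar_simps lbar_mult ee_fe x_elem_rel r)
  have "a = 0"
  proof (rule iot_invariant_pos_zero)
    show "a \<in> Nn" unfolding a_def by (intro Nn_diff) auto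
    show "iot a = a" unfolding a_def by (simp add: iot_simps iot_Cs s iot_cc D iot_mus iot_rmul lbar_CJ)
    fix u assume u: "u \<in> D"
    have la: "lookup a u = lookup (Cs s (cc z)) u - p u z * CJ (sc s z) - lookup (mus s z) u"
      by (simp add: a_def lookup_minus lookup_cc u D)
    note Csu = lookup_Cs[OF s cc_Nn, of u z]
    show "lookup a u \<in> lge 1"
      using s u
    proof (cases rule: D_cases)
      case plus
      have su: "s \<otimes> u \<in> D" "s \<otimes> u \<in> Dm s" using plus Dp_iff[OF s] Dp_mult[OF s plus] by auto
      have ne: "s \<otimes> u \<noteq> z" "u \<noteq> z" using D_disjoint[OF s] su z plus by blast+
      have "vpow (L s) * p u z \<in> lge 1"
        using lge_mono[OF lge_vpow_mult[OF p_facts(1)[OF u D], of "L s"], of 1] L_pos[OF s] by simp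
      \<comment> \<open>Positivity of \<open>p\<close> is too weak against \<open>C_t\<close>. Since
        \<open>C_t = e_t C_t\<close>, the eigenspace relation for \<open>p u z * e_t\<close>
        supplies the missing factor \<open>v_s\<close>.\<close>
      moreover have "p u z * CJ (sc s z) \<in> lge 1"
      proof -
        have "p u z * CJ (sc s z) = (p u z * ee (sc s z)) * CJ (sc s z)" using ee_CJ[OF r] by (simp add: mult.assoc)
        also have "\<dots> = - (vpow (L s) * (p (s \<otimes> u) z * (ee (sc s z) * CJ (sc s z))))"
          unfolding p_Dz(1)[OF s z plus] by (simp add: mult.assoc)
        finally have eq: "p u z * CJ (sc s z) = - (vpow (L s) * (p (s \<otimes> u) z * CJ (sc s z)))"
          unfolding ee_CJ[OF r] .
        have "p (s \<otimes> u) z * CJ (sc s z) \<in> lge (1 - L s)"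
          using p_facts(4)[OF su(1) D ne(1)] CJ_lge[OF s z] by (rule lge_mult') simp
        then have "vpow (L s) * (p (s \<otimes> u) z * CJ (sc s z)) \<in> lge 1"
          using lge_vpow_mult[of _ "1 - L s" "L s"] by fastforce
        then show ?thesis unfolding eq by (rule lge_uminus)
      qed
      ultimately show ?thesis
        unfolding la Csu(1)[OF plus] lookup_cc[OF su(1) D] lookup_cc[OF u D]
        by (intro lge_diff p_facts(4)[OF su(1) D] mus_Dp s plus D ne(1))
    next
      case zero
      have "lookup a u = - (lookup (mus s z) u + muR s u z)"
        unfolding la Csu(2)[OF zero] lookup_cc[OF u D] mu_R_cases(3)[OF s z zero] by simp
      then show ?thesis using mus_mu_R[OF s, of u z] zero z
        by (simp only:) (intro lge_uminus; simp)
    next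
      case minus
      have su: "s \<otimes> u \<in> D" "s \<otimes> u \<in> Dp s" using Dm_iff[OF s] minus Dm_mult[OF s minus] by auto
      have ne: "s \<otimes> u \<noteq> z" using su z D_disjoint[OF s] by blast
      have "lookup a u = p (s \<otimes> u) z - (lookup (mus s z) u + muR s u z)"
        unfolding la Csu(3)[OF minus] lookup_cc[OF u D] lookup_cc[OF su(1) D] mu_R_cases(4)[OF s z minus] by simp
      then show ?thesis using mus_mu_R[OF s, of u z] minus z p_facts(4)[OF su(1) D ne]
        by (simp only:) (intro lge_diff; simp)
    qed
  qed
  then show ?thesis by (simp add: a_def algebra_simps)
qed

end

section \<open>The module induced from a module over the W-graph algebra\<close>

lemma int_scale_diff: "int_scale (int i - int j) a = (\<Sum>k<i. a) - (\<Sum>k<j. a)"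
proof -
  have add: "(\<Sum>k<m + n. a) = (\<Sum>k<m. a) + (\<Sum>k<n. a)" for m n :: nat
    by (induction n) (simp_all add: add.assoc)
  show ?thesis
  proof (cases "j \<le> i")
    case True
    then obtain d where "i = j + d" using le_Suc_ex by blast
    then show ?thesis by (simp add: int_scale_def add)
  next
    case False
    then obtain d where "j = i + d" using le_Suc_ex[of i j] by auto
    then show ?thesis using False by (simp add: int_scale_def add)
  qed
qed

lemma int_as_diff: obtains i j where "c = int i - int j"
  using that[of "nat c" "nat (- c)"] by (cases "c \<ge> 0") auto

lemma biadditive_int_scale: "biadditive int_scale"
  unfolding biadditive_def additive_def
proof (intro conjI allI)
  fix c d :: int and a b :: 'a
  have add: "(\<Sum>k<m + n. a) = (\<Sum>k<m. a) + (\<Sum>k<n. a)" for m n :: nat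
    by (induction n) (simp_all add: add.assoc)
  obtain i j where c: "c = int i - int j" by (rule int_as_diff)
  obtain k l where d: "d = int k - int l" by (rule int_as_diff)
  show "int_scale c (a + b) = int_scale c a + int_scale c b"
    unfolding c int_scale_diff by (simp add: sum.distrib)
  have "c + d = int (i + k) - int (j + l)" by (simp add: c d)
  then show "int_scale (c + d) a = int_scale c a + int_scale d a"
    unfolding c d by (simp only: int_scale_diff add) simp
qed

lemmas int_scale_simps = biadditive_simps[OF biadditive_int_scale]

lemma int_scale_1 [simp]: "int_scale 1 a = a"
  by (simp add: int_scale_def)

lemma additive_int_eqI:
  fixes F K :: "int \<Rightarrow> 'a::ab_group_add"
  assumes "additive F" "additive K" "F 1 = K 1" shows "F = K"
proof
  fix c
  show "F c = K c"
  proof (induction c rule: int_induct[where k = 0])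
    case base then show ?case using assms by (simp add: additive.zero)
  next
    case (step1 i) then show ?case using assms by (simp add: additive.add)
  next
    case (step2 i) then show ?case using assms by (simp add: additive.diff)
  qed
qed

lemma additive_int_scale: assumes "additive F" shows "F (int_scale c a) = int_scale c (F a)"
proof -
  have "(\<lambda>c. F (int_scale c a)) = (\<lambda>c. int_scale c (F a))"
    by (rule additive_int_eqI)
      (simp_all add: additive_def int_scale_simps additive.add[OF assms])
  then show ?thesis by metis
qed

lemma int_scale_mult: "int_scale (c * d) a = int_scale c (int_scale d a)"
proof -
  have "(\<lambda>c. int_scale (c * d) a) = (\<lambda>c. int_scale c (int_scale d a))"
    by (rule additive_int_eqI) (simp_all add: additive_def int_scale_simps distrib_right)
  then show ?thesis by metis
qed

locale w_induction = canonical G S L \<eta> t J \<iota> eJ xJ jJ R p \<mu>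
  for G :: "('w, 'q) monoid_scheme" (structure) and S L and \<eta> :: "(int \<Rightarrow>\<^sub>0 int) \<Rightarrow> 'h::ring_1" and t J \<iota>
    and eJ :: "'w \<Rightarrow> 'oj::ring_1" and xJ jJ R p \<mu> +
  fixes sm :: "'k::comm_ring_1 \<Rightarrow> 'm::ab_group_add \<Rightarrow> 'm" and actM :: "'oj \<Rightarrow> 'm \<Rightarrow> 'm"
    and \<tau> :: "'h \<Rightarrow> (int \<Rightarrow>\<^sub>0 'm) \<Rightarrow> 'i::ab_group_add"
    and hI :: "'h \<Rightarrow> 'i \<Rightarrow> 'i" and kI :: "(int \<Rightarrow>\<^sub>0 'k) \<Rightarrow> 'i \<Rightarrow> 'i"
  assumes M: "is_alg_module sm (UNIV :: 'm set) actM"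
    and Ind: "is_induced_module (hecke_parabolic G S \<eta> t J) (\<lambda>b. lact actM (jJ b)) (lact sm) \<tau> hI kI"
begin

section \<open>The tensor product over the parabolic subalgebra and its coordinates\<close>

lemma actM: "biadditive actM" "actM (a * b) m = actM a (actM b m)" "actM 1 m = m" "actM a (sm c m) = sm c (actM a m)"
  and sm: "biadditive sm" "sm (c * d) m = sm c (sm d m)" "sm 1 m = m"
  using M unfolding is_alg_module_def biadditive_def additive_def by simp_all

abbreviation lM :: "(int \<Rightarrow>\<^sub>0 'oj) \<Rightarrow> (int \<Rightarrow>\<^sub>0 'm) \<Rightarrow> int \<Rightarrow>\<^sub>0 'm" where "lM \<equiv> lact actM"

lemma biadditive_lM: "biadditive lM"
  by (rule biadditive_lact[OF actM(1)])

lemmas lM_simps = biadditive_simps[OF biadditive_lM]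

lemma lM_mult: "lM (a * b) f = lM a (lM b f)"
  by (rule lact_mult[OF actM(1,2)])

lemma lM_one [simp]: "lM 1 f = f"
  by (rule lact_one[OF actM(1)]) (rule actM(3))

lemma lM_sm: "lM a (lact sm c f) = lact sm c (lM a f)"
  by (rule lact_commute[OF actM(1) sm(1) actM(4)])

abbreviation rels where "rels \<equiv> tensor_rels HJ (\<lambda>b. lM (jJ b))"

definition ev :: "('h \<times> (int \<Rightarrow>\<^sub>0 'm) \<Rightarrow>\<^sub>0 int) \<Rightarrow> 'i" where
  "ev = plin (\<lambda>(h, n) c. int_scale c (\<tau> h n))"

lemma tensor: "range ev = UNIV" "ev f = 0 \<longleftrightarrow> f \<in> subgroup_gen rels"
proof -
  have "ev = (\<lambda>f. \<Sum>(h, n)\<in>keys f. int_scale (lookup f (h, n)) (\<tau> h n))"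
    by (rule ext) (simp add: ev_def plin_def case_prod_beta)
  then show "range ev = UNIV" "ev f = 0 \<longleftrightarrow> f \<in> subgroup_gen rels"
    using Ind unfolding is_induced_module_def is_tensor_product_def Let_def by auto
qed

lemma Ind_act: "additive (hI h)" "hI h (\<tau> g n) = \<tau> (h * g) n" "additive (kI c)" "kI c (\<tau> g n) = \<tau> g (lact sm c n)"
  using Ind unfolding is_induced_module_def additive_def by blast+

lemma additive_ev: "additive ev"
  unfolding ev_def by (rule additive_plin) (auto simp: additive_def int_scale_simps)

lemma ev_pure [simp]: "ev (pure h n) = \<tau> h n"
  unfolding ev_def pure_def by (subst plin_single) (auto simp: int_scale_simps)

lemma ev_rel: "r \<in> rels \<Longrightarrow> ev r = 0"
  using tensor(2)[of r] subgroup_gen.add[OF subgroup_gen.zero, of r rels] by simp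

lemma tau: "biadditive \<tau>" "b \<in> HJ \<Longrightarrow> \<tau> (h * b) n = \<tau> h (lM (bet b) n)"
proof -
  have 1: "\<tau> (g + h) n = \<tau> g n + \<tau> h n" for g h n
  proof -
    have "pure (g + h) n - pure g n - pure h n \<in> rels" unfolding tensor_rels_def by blast
    from ev_rel[OF this] show ?thesis by (simp add: additive.diff[OF additive_ev] additive.add[OF additive_ev] algebra_simps)
  qed
  have 2: "\<tau> h (n + n') = \<tau> h n + \<tau> h n'" for h n n'
  proof -
    have "pure h (n + n') - pure h n - pure h n' \<in> rels" unfolding tensor_rels_def by blast
    from ev_rel[OF this] show ?thesis by (simp add: additive.diff[OF additive_ev] additive.add[OF additive_ev] algebra_simps)
  qed
  show "biadditive \<tau>" using 1 2 by (simp add: biadditive_def additive_def)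
  show "\<tau> (h * b) n = \<tau> h (lM (bet b) n)" if "b \<in> HJ"
  proof -
    have "pure (h * b) n - pure h (lM (jJ b) n) \<in> rels" using that unfolding tensor_rels_def by blast
    from ev_rel[OF this] show ?thesis by (simp add: additive.diff[OF additive_ev] bet_HJ that)
  qed
qed

lemmas tau_simps = biadditive_simps[OF tau(1)]

text \<open>Every element is a value of \<open>ev\<close>, hence an integer combination of pure
  tensors.\<close>

lemma Ind_ext:
  fixes F K :: "'i \<Rightarrow> 'j::ab_group_add"
  assumes "additive F" "additive K" "\<And>h n. F (\<tau> h n) = K (\<tau> h n)" shows "F y = K y"
proof -
  obtain f where y: "y = ev f" using tensor(1) by (metis UNIV_I imageE)
  show ?thesis unfolding y ev_def additive_comp_plin[OF assms(1)] additive_comp_plin[OF assms(2)]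
    using assms by (intro plin_cong) (auto simp: additive_int_scale)
qed

lemma hI_mult: "hI (g * h) y = hI g (hI h y)"
  by (rule Ind_ext[OF Ind_act(1) additive_comp[OF Ind_act(1) Ind_act(1)]]) (simp add: Ind_act mult.assoc)

lemma hI_1: "hI 1 y = y"
  by (rule Ind_ext[OF Ind_act(1) additive_id]) (simp add: Ind_act)

lemma hI_add: "hI (g + h) y = hI g y + hI h y"
  by (rule Ind_ext[OF Ind_act(1) additive_plus[OF Ind_act(1) Ind_act(1)]])
    (simp add: Ind_act distrib_right tau_simps)

lemma kI_add: "kI (a + b) y = kI a y + kI b y"
  by (rule Ind_ext[OF Ind_act(3) additive_plus[OF Ind_act(3) Ind_act(3)]])
    (simp add: Ind_act biadditive_simps[OF biadditive_lact[OF sm(1)]] tau_simps)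

lemma biadditive_hI: "biadditive hI" and biadditive_kI: "biadditive kI"
  using Ind_act hI_add kI_add by (simp_all add: biadditive_def additive_def)

lemmas hI_simps = biadditive_simps[OF biadditive_hI]

definition PsM :: "'h \<Rightarrow> (int \<Rightarrow>\<^sub>0 'm) \<Rightarrow> 'w \<Rightarrow>\<^sub>0 int \<Rightarrow>\<^sub>0 'm" where
  "PsM h \<nu> = Poly_Mapping.map (\<lambda>b. lM (bet b) \<nu>) (comp h)"

lemma lookup_PsM: "lookup (PsM h \<nu>) y = lM (bet (lookup (comp h) y)) \<nu>"
  unfolding PsM_def by (rule lookup_map_0) (simp add: bet_simps lM_simps)

text \<open>The coordinate map \<open>co\<close> is defined on the free abelian group and kills the
  tensor relations. These generate the kernel of \<open>ev\<close>, so \<open>co\<close> descends to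
  the tensor product, where it recovers the coefficient of each \<open>T_y\<close>.\<close>

lemma tau_independent:
  assumes n: "keys n \<subseteq> D" and zero: "plin (\<lambda>y \<nu>. \<tau> (T y) \<nu>) n = 0" shows "n = 0"
proof -
  define co :: "('h \<times> (int \<Rightarrow>\<^sub>0 'm) \<Rightarrow>\<^sub>0 int) \<Rightarrow> 'w \<Rightarrow>\<^sub>0 int \<Rightarrow>\<^sub>0 'm" where
    "co = plin (\<lambda>(h, \<nu>) c. int_scale c (PsM h \<nu>))"
  have add: "additive co"
    unfolding co_def by (rule additive_plin) (auto simp: additive_def int_scale_simps)
  have co_pure: "co (pure h \<nu>) = PsM h \<nu>" for h \<nu>
    unfolding co_def pure_def by (subst plin_single) (auto simp: int_scale_simps)
  have co_rel: "co r = 0" if "r \<in> rels" for r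
  proof -
    have "PsM (g + h) \<nu> = PsM g \<nu> + PsM h \<nu>" for g h \<nu>
      by (rule poly_mapping_eqI) (simp add: lookup_PsM lookup_add comp_simps bet_simps lM_simps)
    moreover have "PsM h (\<nu> + \<nu>') = PsM h \<nu> + PsM h \<nu>'" for h \<nu> \<nu>'
      by (rule poly_mapping_eqI) (simp add: lookup_PsM lookup_add lM_simps)
    moreover have "PsM (h * b) \<nu> = PsM h (lM (jJ b) \<nu>)" if "b \<in> HJ" for h b \<nu>
      using that by (intro poly_mapping_eqI)
        (simp add: lookup_PsM comp_mult lookup_map_0 bet_mult lM_mult bet_HJ[of b])
    ultimately show ?thesis
      using that by (auto simp: tensor_rels_def additive.diff[OF add] co_pure)
  qed
  have co_gen: "co f = 0" if "f \<in> subgroup_gen rels" for f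
    using that by induction (simp_all add: additive.zero[OF add] additive.add[OF add] additive.diff[OF add] co_rel)
  define f where "f = (\<Sum>y\<in>keys n. pure (T y) (lookup n y))"
  have "ev f = 0" using zero unfolding f_def additive.sum[OF additive_ev] by (simp add: plin_def)
  then have "co f = 0" using tensor(2) co_gen by blast
  moreover have "co f = (\<Sum>y\<in>keys n. single y (lookup n y))"
    unfolding f_def additive.sum[OF add] co_pure
  proof (rule sum.cong)
    fix y assume "y \<in> keys n"
    then have "comp (T y) = single y 1" using n comp_T_mult[of y 1] by auto
    then show "PsM (T y) (lookup n y) = single y (lookup n y)"
      by (intro poly_mapping_eqI) (auto simp: lookup_PsM lookup_single when_def bet_simps lM_simps)
  qed simp
  ultimately show ?thesis by (simp add: sum_single_lookup)
qed

text \<open>Evaluation of the universal model at a vector: the tensor of \<open>h\<close> and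
  \<open>a\<close> goes to that of \<open>h\<close> and \<open>a \<nu>\<close>
  (\<open>th_Psi\<close>). It carries the formulas for \<open>C_s c_z\<close> to the module induced
  from \<open>M\<close>; a right factor moves onto \<open>\<nu>\<close> by
  \<open>th_rmul\<close>.\<close>

definition th :: "('w \<Rightarrow>\<^sub>0 int \<Rightarrow>\<^sub>0 'oj) \<Rightarrow> (int \<Rightarrow>\<^sub>0 'm) \<Rightarrow> 'i" where
  "th n \<nu> = plin (\<lambda>y a. \<tau> (T y) (lM a \<nu>)) n"

lemma biadditive_th: "biadditive th"
proof -
  have "additive (\<lambda>a. \<tau> (T y) (lM a \<nu>))" "additive (\<lambda>\<nu>. \<tau> (T y) (lM a \<nu>))" for y a \<nu>
    by (simp_all add: additive_def lM_simps tau_simps)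
  then show ?thesis unfolding biadditive_def th_def by (auto intro: additive_plin additive_plin_fun)
qed

lemmas th_simps = biadditive_simps[OF biadditive_th]

lemma th_single: "th (single y a) \<nu> = \<tau> (T y) (lM a \<nu>)"
  unfolding th_def by (rule plin_single) (simp add: lM_simps tau_simps)

lemma th_rmul: "th (rmul n a) \<nu> = th n (lM a \<nu>)"
  by (rule additive_eqI[OF additive_comp[OF biadditiveD(2)[OF biadditive_th] additive_rmul] biadditiveD(2)[OF biadditive_th]])
    (simp add: th_single lM_mult)

lemma th_Psi: "th (Psi h a) \<nu> = \<tau> h (lM a \<nu>)"
proof (induction h rule: coset_induct)
  case (T x b)
  then show ?case by (simp add: Psi_mult Psi_T th_single lM_mult tau(2))
qed (simp_all add: Psi_simps th_simps tau_simps)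

lemma hI_th: "hI h (th n \<nu>) = th (hmul h n) \<nu>"
  by (rule additive_eqI[OF additive_comp[OF Ind_act(1) biadditiveD(2)[OF biadditive_th]]
        additive_comp[OF biadditiveD(2)[OF biadditive_th] additive_hmul]])
    (simp add: th_single hmul_single th_Psi Ind_act)

lemma kI_th: "kI c (th n \<nu>) = th n (lact sm c \<nu>)"
  by (rule additive_eqI[OF additive_comp[OF Ind_act(3) biadditiveD(2)[OF biadditive_th]] biadditiveD(2)[OF biadditive_th]])
    (simp add: th_single Ind_act lM_sm)

lemma hI_eta_th: "hI (\<eta> c) (th n \<nu>) = th n (lM (cm c) \<nu>)"
proof (rule additive_eqI[OF additive_comp[OF Ind_act(1) biadditiveD(2)[OF biadditive_th]] biadditiveD(2)[OF biadditive_th]])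
  fix y a
  have "\<tau> (\<eta> c * T y) (lM a \<nu>) = \<tau> (T y) (lM (cm c) (lM a \<nu>))"
    using tau(2)[of "\<eta> c" "T y"] by (simp add: pres.eta(4) bet_eta)
  then show "hI (\<eta> c) (th (single y a) \<nu>) = th (single y a) (lM (cm c) \<nu>)"
    by (simp add: th_single Ind_act cm_commute flip: lM_mult)
qed

lemma hI_t_th:
  assumes "s \<in> S" shows "hI (t s) (th n \<nu>) = th (Cs s n) \<nu> + th n (lM (vpow (L s)) \<nu>)"
proof -
  have "hI (t s) (th n \<nu>) = hI (t s - \<eta> (vpow (L s))) (th n \<nu>) + hI (\<eta> (vpow (L s))) (th n \<nu>)"
    by (simp add: hI_simps)
  then show ?thesis by (simp add: hI_th[of "t s - \<eta> (vpow (L s))"] Cs_def[symmetric] hI_eta_th)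
qed

subsection \<open>The canonicalisation map\<close>

text \<open>\<open>canon\<close> sums over supports, which hides its additivity. \<open>Phi\<close>
  is an additive map on the whole type that agrees with it on \<open>HL\<close>
  (\<open>canon_Phi\<close>).\<close>

definition Phi :: "(int \<Rightarrow>\<^sub>0 'w \<Rightarrow>\<^sub>0 'm) \<Rightarrow> 'i" where
  "Phi = plin (\<lambda>\<gamma>. plin (\<lambda>z m. th (cc z) (single \<gamma> m)))"

lemma additive_th_single: "additive (\<lambda>m. th n (single \<gamma> m))"
  by (simp add: additive_def single_add th_simps)

lemma additive_Phi: "additive Phi"
  unfolding Phi_def by (rule additive_plin, rule additive_plin, rule additive_th_single)

lemmas Phi_simps = additive.add[OF additive_Phi] additive.zero[OF additive_Phi]
  additive.minus[OF additive_Phi] additive.diff[OF additive_Phi]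

lemma Phi_single: "Phi (single \<gamma> (single z m)) = th (cc z) (single \<gamma> m)"
  unfolding Phi_def
  by (subst plin_single, simp, subst plin_single) (simp_all add: th_simps)

abbreviation can :: "(int \<Rightarrow>\<^sub>0 'w \<Rightarrow>\<^sub>0 'm) \<Rightarrow> 'i" where "can \<equiv> canon G S J t p actM \<tau> kI"
abbreviation HL :: "(int \<Rightarrow>\<^sub>0 'w \<Rightarrow>\<^sub>0 'm) set" where "HL \<equiv> HY_laurent D"

lemma HY_iff: "f \<in> HY D \<longleftrightarrow> keys f \<subseteq> D"
  by (simp add: HY_def)

lemma HY_add: "f \<in> HY D \<Longrightarrow> g \<in> HY D \<Longrightarrow> f + g \<in> HY D" for f g :: "'w \<Rightarrow>\<^sub>0 'm"
  using keys_add[of f g] by (auto simp: HY_iff)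

lemma HY_0 [simp]: "0 \<in> HY D"
  by (simp add: HY_iff)

lemma HY_single [simp]: "z \<in> D \<Longrightarrow> single z m \<in> HY D"
  by (simp add: HY_iff)

lemma HY_uminus: "f \<in> HY D \<Longrightarrow> - f \<in> HY D" for f :: "'w \<Rightarrow>\<^sub>0 'm"
  by (auto simp: HY_iff in_keys_iff)

lemma HY_diff: "f \<in> HY D \<Longrightarrow> g \<in> HY D \<Longrightarrow> f - g \<in> HY D" for f g :: "'w \<Rightarrow>\<^sub>0 'm"
  using HY_add[of f "- g"] HY_uminus[of g] by simp

lemma HY_sum: "(\<And>i. i \<in> A \<Longrightarrow> f i \<in> HY D) \<Longrightarrow> sum f A \<in> HY D" for f :: "'b \<Rightarrow> 'w \<Rightarrow>\<^sub>0 'm"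
  by (induction A rule: infinite_finite_induct) (auto intro: HY_add)

lemma HY_plin: "(\<And>k b. g k b \<in> HY D) \<Longrightarrow> plin g f \<in> HY D" for g :: "'b \<Rightarrow> 'c::zero \<Rightarrow> 'w \<Rightarrow>\<^sub>0 'm"
  unfolding plin_def by (rule HY_sum)

lemma HL_iff: "f \<in> HL \<longleftrightarrow> (\<forall>\<gamma>. lookup f \<gamma> \<in> HY D)"
  by (simp add: HY_laurent_def)

lemma HL_single [simp]: "n \<in> HY D \<Longrightarrow> single \<gamma> n \<in> HL"
  by (auto simp: HL_iff lookup_single when_def)

lemma HL_eqI:
  fixes F K :: "(int \<Rightarrow>\<^sub>0 'w \<Rightarrow>\<^sub>0 'm) \<Rightarrow> 'z::ab_group_add"
  assumes "additive F" "additive K" "f \<in> HL"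
    and "\<And>\<gamma> z m. z \<in> D \<Longrightarrow> F (single \<gamma> (single z m)) = K (single \<gamma> (single z m))"
  shows "F f = K f"
proof -
  have 1: "F (single \<gamma> n) = K (single \<gamma> n)" if "n \<in> HY D" for \<gamma> n
    by (rule additive_eqI[OF additive_comp[OF assms(1) additive_single] additive_comp[OF assms(2) additive_single]])
      (use assms(4) that in \<open>auto simp: HY_iff\<close>)
  have "F f = (\<Sum>\<gamma>\<in>keys f. F (single \<gamma> (lookup f \<gamma>)))"
    using additive.sum[OF assms(1), of "\<lambda>\<gamma>. single \<gamma> (lookup f \<gamma>)" "keys f"] by (simp add: sum_single_lookup)
  also have "\<dots> = (\<Sum>\<gamma>\<in>keys f. K (single \<gamma> (lookup f \<gamma>)))"
    using 1 assms(3) by (simp add: HL_iff)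
  also have "\<dots> = K f"
    using additive.sum[OF assms(2), of "\<lambda>\<gamma>. single \<gamma> (lookup f \<gamma>)" "keys f"] by (simp add: sum_single_lookup)
  finally show ?thesis .
qed

lemma HY_eqI:
  fixes F K :: "('w \<Rightarrow>\<^sub>0 'm) \<Rightarrow> 'z::ab_group_add"
  assumes "additive F" "additive K" "n \<in> HY D" "\<And>z m. z \<in> D \<Longrightarrow> F (single z m) = K (single z m)"
  shows "F n = K n"
  by (rule additive_eqI[OF assms(1,2)]) (use assms in \<open>auto simp: HY_iff\<close>)

lemma lact_HL:
  assumes "\<And>a n. n \<in> HY D \<Longrightarrow> A a n \<in> HY D" "f \<in> HL" shows "lact A a f \<in> HL"
proof -
  have "lookup (lact A a f) \<gamma> \<in> HY D" for \<gamma>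
    unfolding lact_def lookup_sum using assms
    by (intro HY_sum) (auto simp: lookup_single when_def HL_iff)
  then show ?thesis by (simp add: HL_iff)
qed

lemma canon_gen_th: "z \<in> D \<Longrightarrow> canon_gen G S J t p actM \<tau> z m = th (cc z) (single 0 m)"
  unfolding canon_gen_def cc_def
  by (subst additive.sum[OF biadditiveD(2)[OF biadditive_th]]) (simp add: th_single)

lemma canon_Phi: assumes "f \<in> HL" shows "can f = Phi f"
  unfolding canon_def Phi_def plin_def
proof (rule sum.cong)
  fix \<gamma> assume "\<gamma> \<in> keys f"
  let ?g = "lookup f \<gamma>"
  have D: "keys ?g \<subseteq> D" using assms by (simp add: HL_iff HY_iff)
  have "kI (vpow \<gamma>) (canon_gen G S J t p actM \<tau> z m) = th (cc z) (single \<gamma> m)" if "z \<in> D" for z m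
    using that by (simp add: canon_gen_th kI_th lact_single_single[OF sm(1)] sm)
  then show "kI (vpow \<gamma>) (\<Sum>z\<in>keys ?g. canon_gen G S J t p actM \<tau> z (lookup ?g z)) =
      (\<Sum>z\<in>keys ?g. th (cc z) (single \<gamma> (lookup ?g z)))"
    unfolding additive.sum[OF Ind_act(3)] using D by (intro sum.cong) auto
qed simp

text \<open>Choose \<open>z\<close> of maximal length in the support of \<open>f\<close>. Since
  \<open>p z z = 1\<close> and no other support element lies above \<open>z\<close>, the coefficient
  of \<open>T_z\<close> in the image collects exactly the coefficients of \<open>f\<close> at
  \<open>z\<close>.\<close>

lemma Phi_inj:
  assumes f: "f \<in> HL" and zero: "Phi f = 0" shows "f = 0"
proof (rule ccontr)
  assume "f \<noteq> 0"
  define thc :: "('w \<Rightarrow>\<^sub>0 int \<Rightarrow>\<^sub>0 'oj) \<Rightarrow> (int \<Rightarrow>\<^sub>0 'm) \<Rightarrow> 'w \<Rightarrow>\<^sub>0 int \<Rightarrow>\<^sub>0 'm" where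
    "thc n \<nu> = Poly_Mapping.map (\<lambda>a. lM a \<nu>) n" for n \<nu>
  \<comment> \<open>\<open>CP f\<close> lists the coefficients of \<open>Phi f\<close> at the
    \<open>T_y\<close>, and \<open>ta\<close> reassembles them; by \<open>tau_independent\<close>
    the list is already zero.\<close>
  define CP :: "(int \<Rightarrow>\<^sub>0 'w \<Rightarrow>\<^sub>0 'm) \<Rightarrow> 'w \<Rightarrow>\<^sub>0 int \<Rightarrow>\<^sub>0 'm" where
    "CP = plin (\<lambda>\<gamma>. plin (\<lambda>z m. thc (cc z) (single \<gamma> m)))"
  define ta :: "('w \<Rightarrow>\<^sub>0 int \<Rightarrow>\<^sub>0 'm) \<Rightarrow> 'i" where "ta = plin (\<lambda>y \<nu>. \<tau> (T y) \<nu>)"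
  have lthc: "lookup (thc n \<nu>) y = lM (lookup n y) \<nu>" for n \<nu> y
    unfolding thc_def by (rule lookup_map_0) (simp add: lM_simps)
  have add_thc: "additive (\<lambda>m. thc n (single \<gamma> m))" for n \<gamma>
    by standard (rule poly_mapping_eqI, simp add: lthc lookup_add single_add lM_simps)
  have add_CP: "additive CP" unfolding CP_def by (rule additive_plin, rule additive_plin, rule add_thc)
  have add_ta: "additive ta" unfolding ta_def by (rule additive_plin, rule biadditiveD(1)[OF tau(1)])
  have ta_thc: "ta (thc n \<nu>) = th n \<nu>" for n \<nu>
  proof (rule additive_eqI[OF _ biadditiveD(2)[OF biadditive_th]])
    have "additive (\<lambda>n. thc n \<nu>)" by standard (rule poly_mapping_eqI, simp add: lthc lookup_add lM_simps)
    then show "additive (\<lambda>n. ta (thc n \<nu>))" by (rule additive_comp[OF add_ta])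
    fix y a
    have "thc (single y a) \<nu> = single y (lM a \<nu>)"
      by (rule poly_mapping_eqI) (auto simp: lthc lookup_single when_def lM_simps)
    then show "ta (thc (single y a) \<nu>) = th (single y a) \<nu>"
      unfolding th_single ta_def by (simp add: plin_single tau_simps)
  qed
  have "ta (CP f) = Phi f"
  proof (rule HL_eqI[OF additive_comp[OF add_ta add_CP] additive_Phi f])
    fix \<gamma> z m
    have "CP (single \<gamma> (single z m)) = thc (cc z) (single \<gamma> m)"
      unfolding CP_def using additive.zero[OF add_thc] by (subst plin_single, simp, subst plin_single) auto
    then show "ta (CP (single \<gamma> (single z m))) = Phi (single \<gamma> (single z m))"
      by (simp add: ta_thc Phi_single)
  qed
  then have "plin (\<lambda>y \<nu>. \<tau> (T y) \<nu>) (CP f) = 0" using zero by (simp add: ta_def)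
  moreover have "keys (CP f) \<subseteq> D"
  proof -
    have "lookup (CP f) y = 0" if "y \<notin> D" for y
      using that lookup_cc_out by (simp add: CP_def plin_def lookup_sum lthc lM_simps)
    then show ?thesis using in_keys_iff by blast
  qed
  ultimately have CP0: "CP f = 0" by (rule tau_independent[rotated])
  define P where "P = {z. \<exists>\<gamma>. lookup (lookup f \<gamma>) z \<noteq> 0}"
  have "P \<subseteq> (\<Union>\<gamma>\<in>keys f. keys (lookup f \<gamma>))"
  proof
    fix z assume "z \<in> P"
    then obtain \<gamma> where "lookup (lookup f \<gamma>) z \<noteq> 0" by (auto simp: P_def)
    then have "\<gamma> \<in> keys f" "z \<in> keys (lookup f \<gamma>)" by (auto simp: in_keys_iff)
    then show "z \<in> (\<Union>\<gamma>\<in>keys f. keys (lookup f \<gamma>))" by blast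
  qed
  then have fP: "finite P" by (rule finite_subset) simp
  have "P \<noteq> {}"
  proof
    assume "P = {}"
    then have "lookup f \<gamma> = 0" for \<gamma> unfolding P_def by (intro poly_mapping_eqI) auto
    then show False using \<open>f \<noteq> 0\<close> by (metis poly_mapping_eqI lookup_zero)
  qed
  then obtain z where z: "z \<in> P" "len z = Max (len ` P)"
    using Max_in[of "len ` P"] fP by (metis (no_types, lifting) finite_imageI image_iff image_is_empty)
  then obtain \<gamma> where g: "lookup (lookup f \<gamma>) z \<noteq> 0" by (auto simp: P_def)
  have max: "len z' \<le> len z" if "lookup (lookup f \<gamma>') z' \<noteq> 0" for z' \<gamma>'
    unfolding z(2) using fP that by (intro Max_ge) (auto simp: P_def)
  have fD: "z' \<in> D" if "z' \<in> keys (lookup f \<gamma>')" for z' \<gamma>' using f that by (auto simp: HL_iff HY_iff)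
  have zD: "z \<in> D" using fD g in_keys_iff by fast
  have "lookup (CP f) z = (\<Sum>\<gamma>'\<in>keys f. \<Sum>z'\<in>keys (lookup f \<gamma>'). lM (lookup (cc z') z) (single \<gamma>' (lookup (lookup f \<gamma>') z')))"
    by (simp add: CP_def plin_def lookup_sum lthc)
  also have "\<dots> = (\<Sum>\<gamma>'\<in>keys f. \<Sum>z'\<in>keys (lookup f \<gamma>'). if z' = z then single \<gamma>' (lookup (lookup f \<gamma>') z) else 0)"
  proof (intro sum.cong)
    fix \<gamma>' z' assume z': "z' \<in> keys (lookup f \<gamma>')"
    have z'D: "z' \<in> D" using fD[OF z'] .
    have l: "len z' \<le> len z" using max z' by (simp add: in_keys_iff)
    show "lM (lookup (cc z') z) (single \<gamma>' (lookup (lookup f \<gamma>') z')) =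
        (if z' = z then single \<gamma>' (lookup (lookup f \<gamma>') z) else 0)"
    proof (cases "z' = z")
      case True then show ?thesis using p_facts(2)[OF zD zD] lookup_cc[OF zD zD] by simp
    next
      case False
      then have "\<not> ble z z'" using l ble_cases[of z z'] by auto
      then show ?thesis using False p_facts(3)[OF zD z'D] lookup_cc[OF zD z'D] by (simp add: lM_simps)
    qed
  qed auto
  also have "\<dots> = (\<Sum>\<gamma>'\<in>keys f. single \<gamma>' (lookup (lookup f \<gamma>') z))"
    by (intro sum.cong) (auto simp: in_keys_iff)
  finally have "lookup (lookup (CP f) z) \<gamma> = (\<Sum>\<gamma>'\<in>keys f. if \<gamma>' = \<gamma> then lookup (lookup f \<gamma>) z else 0)"
    by (auto simp: lookup_sum lookup_single when_def intro!: sum.cong)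
  also have "\<dots> = lookup (lookup f \<gamma>) z" using g by (auto simp: in_keys_iff)
  finally show False using CP0 g by simp
qed

subsection \<open>The operators on the direct sum\<close>

text \<open>Indices outside \<open>D\<close> are sent to 0, here and in \<open>XX\<close>, so these
  operators map every function into \<open>HY D\<close>.\<close>

definition EE :: "'w \<Rightarrow> ('w \<Rightarrow>\<^sub>0 'm) \<Rightarrow> 'w \<Rightarrow>\<^sub>0 'm" where
  "EE s = plin (\<lambda>z m. if z \<in> Dz s then single z (actM (eJ (sc s z)) m) else if z \<in> Dm s then single z m else 0)"

definition muX :: "'w \<Rightarrow> int \<Rightarrow> 'w \<Rightarrow> 'm \<Rightarrow> 'w \<Rightarrow>\<^sub>0 'm" where
  "muX s \<gamma> z m = (\<Sum>u\<in>below z. single u (actM (lookup (\<mu> s u z) \<gamma>) m))"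

definition XX :: "'w \<Rightarrow> int \<Rightarrow> ('w \<Rightarrow>\<^sub>0 'm) \<Rightarrow> 'w \<Rightarrow>\<^sub>0 'm" where
  "XX s \<gamma> = plin (\<lambda>z m. if z \<in> Dp s then muX s \<gamma> z m + (if \<gamma> = 0 then single (s \<otimes> z) m else 0)
     else if z \<in> Dz s then muX s \<gamma> z m + single z (actM (xJ (sc s z) \<gamma>) m) else 0)"

lemmas actM_simps = biadditive_simps[OF actM(1)]

lemma additive_muX: "additive (muX s \<gamma> z)"
  unfolding muX_def by (rule additive_sum) (simp add: additive_def actM_simps single_add)

lemma additive_EE: "additive (EE s)"
  unfolding EE_def by (rule additive_plin) (auto simp: additive_def actM_simps single_add)

lemma additive_XX: "additive (XX s \<gamma>)"
  unfolding XX_def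
  by (rule additive_plin) (auto simp: additive_def actM_simps single_add additive.add[OF additive_muX])

lemmas EE_simps = additive.add[OF additive_EE] additive.zero[OF additive_EE]
lemmas XX_simps = additive.add[OF additive_XX] additive.zero[OF additive_XX]

lemma EE_single: "EE s (single z m) = (if z \<in> Dz s then single z (actM (eJ (sc s z)) m) else if z \<in> Dm s then single z m else 0)"
  unfolding EE_def by (rule plin_single) (simp add: actM_simps)

lemma XX_single: "XX s \<gamma> (single z m) = (if z \<in> Dp s then muX s \<gamma> z m + (if \<gamma> = 0 then single (s \<otimes> z) m else 0)
     else if z \<in> Dz s then muX s \<gamma> z m + single z (actM (xJ (sc s z) \<gamma>) m) else 0)"
  unfolding XX_def by (rule plin_single) (simp add: actM_simps additive.zero[OF additive_muX])

lemma muX_HY: "muX s \<gamma> z m \<in> HY D"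
  unfolding muX_def by (rule HY_sum) (simp add: below_def)

lemma EE_HY: "EE s n \<in> HY D"
  unfolding EE_def using Dz_D[of _ s] Dm_D[of _ s] by (intro HY_plin) auto

lemma XX_HY: "XX s \<gamma> n \<in> HY D"
  unfolding XX_def
proof (rule HY_plin)
  fix z m
  have "s \<otimes> z \<in> D" if "z \<in> Dp s" using that by (simp add: D_plus_def)
  then show "(if z \<in> Dp s then muX s \<gamma> z m + (if \<gamma> = 0 then single (s \<otimes> z) m else 0)
     else if z \<in> Dz s then muX s \<gamma> z m + single z (actM (xJ (sc s z) \<gamma>) m) else 0) \<in> HY D"
    using Dz_D[of z s] muX_HY by (auto intro!: HY_add)
qed

definition gop :: "'w wgen \<Rightarrow> ('w \<Rightarrow>\<^sub>0 'm) \<Rightarrow> 'w \<Rightarrow>\<^sub>0 'm" where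
  "gop g = (case g of GE s \<Rightarrow> EE s | GX s \<gamma> \<Rightarrow> XX s \<gamma>)"

lemma gop_simps [simp]: "gop (GE s) = EE s" "gop (GX s \<gamma>) = XX s \<gamma>"
  by (simp_all add: gop_def)

lemma additive_gop: "additive (gop g)"
  by (cases g) (simp_all add: additive_EE additive_XX)

lemma gop_HY: "gop g n \<in> HY D"
  by (cases g) (simp_all add: EE_HY XX_HY)

sublocale fa: free_action "int_scale :: int \<Rightarrow> ('w \<Rightarrow>\<^sub>0 'm) \<Rightarrow> _" gop
proof
  show "gop g (int_scale c n) = int_scale c (gop g n)" for g c n
    by (rule additive_int_scale[OF additive_gop])
  show "gop g (m + n) = gop g m + gop g n" for g m n
    by (rule additive.add[OF additive_gop])
qed (simp_all add: biadditive_int_scale int_scale_mult)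

lemma int_scale_HY: "n \<in> HY D \<Longrightarrow> int_scale c n \<in> HY D" for n :: "'w \<Rightarrow>\<^sub>0 'm"
  unfolding int_scale_def by (auto intro: HY_sum HY_uminus)

lemma pact_HY: assumes "n \<in> HY D" shows "fa.pact f n \<in> HY D"
proof (induction f rule: pm_induct)
  case (single w c)
  have "foldr gop gs n \<in> HY D" for gs using assms gop_HY by (induction gs) auto
  then show ?case by (simp add: fa.pact_single int_scale_HY)
qed (simp_all add: fa.pact_simps HY_add)

text \<open>Stated for any ring whose generators act by these operators, because it is applied
  twice: to the free algebra, in order to prove the braid relations, and then to
  \<open>\<Omega>\<close> itself.\<close>

lemma Phi_jT:
  fixes A :: "'a::ring_1 \<Rightarrow> ('w \<Rightarrow>\<^sub>0 'm) \<Rightarrow> 'w \<Rightarrow>\<^sub>0 'm"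
  assumes A: "biadditive A" and one: "\<And>n. n \<in> HY D \<Longrightarrow> A 1 n = n"
    and e: "\<And>n. n \<in> HY D \<Longrightarrow> A (e s) n = EE s n"
    and x: "\<And>n \<gamma>. n \<in> HY D \<Longrightarrow> - L s < \<gamma> \<Longrightarrow> \<gamma> < L s \<Longrightarrow> A (x s \<gamma>) n = XX s \<gamma> n"
    and s: "s \<in> S" and f: "f \<in> HL"
  shows "Phi (lact A (jT L e x s) f) = hI (t s) (Phi f)"
proof (rule HL_eqI[OF _ _ f])
  show "additive (\<lambda>f. Phi (lact A (jT L e x s) f))"
    by (rule additive_comp[OF additive_Phi biadditiveD(1)[OF biadditive_lact[OF A]]])
  show "additive (\<lambda>f. hI (t s) (Phi f))" by (rule additive_comp[OF Ind_act(1) additive_Phi])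
  fix i z and m :: 'm assume z: "z \<in> D"
  note As = biadditive_simps[OF A]
  let ?n = "single z m"
  let ?I = "{- L s<..<L s}"
  have nH: "?n \<in> HY D" using z by simp
  have "lact A (jT L e x s) (single i ?n) =
     single (i - L s) (- EE s ?n) + single (i + L s) (?n - EE s ?n) + (\<Sum>\<gamma>\<in>?I. single (i + \<gamma>) (XX s \<gamma> ?n))"
  proof -
    have "lact A (x_elem L x s) (single i ?n) = (\<Sum>\<gamma>\<in>?I. lact A (single \<gamma> (x s \<gamma>)) (single i ?n))"
      unfolding x_elem_def by (rule additive.sum[OF biadditiveD(2)[OF biadditive_lact[OF A]]])
    also have "\<dots> = (\<Sum>\<gamma>\<in>?I. single (i + \<gamma>) (XX s \<gamma> ?n))"
      using x[OF nH] by (intro sum.cong) (auto simp: lact_single_single[OF A] add.commute)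
    finally show ?thesis
      unfolding jT_def by (simp add: biadditive_simps[OF biadditive_lact[OF A]] lact_single_single[OF A] As one e nH add.commute[of i "L s"])
  qed
  then have lhs: "Phi (lact A (jT L e x s) (single i ?n)) =
     - Phi (single (i - L s) (EE s ?n)) + (Phi (single (i + L s) ?n) - Phi (single (i + L s) (EE s ?n)))
       + (\<Sum>\<gamma>\<in>?I. Phi (single (i + \<gamma>) (XX s \<gamma> ?n)))"
    by (simp add: Phi_simps single_diff single_uminus additive.sum[OF additive_Phi])
  have lMs: "lM (single k a) (single i m) = single (i + k) (actM a m)" for k a
    by (simp add: lact_single_single[OF actM(1)] add.commute)
  have rhs: "hI (t s) (Phi (single i ?n)) = th (Cs s (cc z)) (single i m) + th (cc z) (single (i + L s) m)"
    using hI_t_th[OF s, of "cc z" "single i m"] by (simp add: Phi_single lMs actM)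
  have mu: "(\<Sum>\<gamma>\<in>?I. Phi (single (i + \<gamma>) (muX s \<gamma> z m))) = th (mus s z) (single i m)"
  proof -
    have "th (rmul (cc u) (\<mu> s u z)) (single i m) = (\<Sum>\<gamma>\<in>?I. Phi (single (i + \<gamma>) (single u (actM (lookup (\<mu> s u z) \<gamma>) m))))"
      if u: "u \<in> below z" for u
    proof -
      have uD: "u \<in> D" using u by (simp add: below_def)
      have "lM (\<mu> s u z) (single i m) = plin (\<lambda>\<gamma> a. lM (single \<gamma> a) (single i m)) (\<mu> s u z)"
        using additive_comp_plin[OF biadditiveD(2)[OF biadditive_lM], of single "\<mu> s u z" "single i m"]
        by (simp add: plin_def sum_single_lookup)
      also have "\<dots> = (\<Sum>\<gamma>\<in>?I. lM (single \<gamma> (lookup (\<mu> s u z) \<gamma>)) (single i m))"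
      \<comment> \<open>By \<open>lookup_mu_bound\<close> the support of \<open>\<mu>\<close> lies
        in the range of \<open>\<gamma>\<close> for which there are generators, so splitting by
        \<open>\<gamma>\<close> loses nothing.\<close>
      proof (rule plin_superset)
        show "keys (\<mu> s u z) \<subseteq> ?I"
          using lookup_mu_bound[OF s uD z] by (auto simp: in_keys_iff) (meson linorder_not_less)+
      qed (simp_all add: lM_simps)
      finally show ?thesis
        by (simp add: th_rmul lMs Phi_single additive.sum[OF biadditiveD(1)[OF biadditive_th]])
    qed
    then have "th (mus s z) (single i m) =
        (\<Sum>u\<in>below z. \<Sum>\<gamma>\<in>?I. Phi (single (i + \<gamma>) (single u (actM (lookup (\<mu> s u z) \<gamma>) m))))"
      unfolding mus_def additive.sum[OF biadditiveD(2)[OF biadditive_th]] by simp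
    also have "\<dots> = (\<Sum>\<gamma>\<in>?I. \<Sum>u\<in>below z. Phi (single (i + \<gamma>) (single u (actM (lookup (\<mu> s u z) \<gamma>) m))))"
      by (rule sum.swap)
    also have "\<dots> = (\<Sum>\<gamma>\<in>?I. Phi (single (i + \<gamma>) (muX s \<gamma> z m)))"
      unfolding muX_def additive.sum[OF additive_single] additive.sum[OF additive_Phi] ..
    finally show ?thesis ..
  qed
  show "Phi (lact A (jT L e x s) (single i ?n)) = hI (t s) (Phi (single i ?n))"
    using s z
  proof (cases rule: D_cases)
    case plus
    have ns: "z \<notin> Dz s" "z \<notin> Dm s" using plus D_disjoint[OF s] by blast+
    \<comment> \<open>The index 0 carries the summand at \<open>s \<otimes> z\<close>; it occurs
      because \<open>L s\<close> is positive.\<close>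
    have "0 \<in> ?I" using L_pos[OF s] by simp
    have "(\<Sum>\<gamma>\<in>?I. Phi (single (i + \<gamma>) (XX s \<gamma> ?n))) =
       (\<Sum>\<gamma>\<in>?I. Phi (single (i + \<gamma>) (muX s \<gamma> z m)) + (if \<gamma> = 0 then th (cc (s \<otimes> z)) (single i m) else 0))"
      using plus by (intro sum.cong) (auto simp: XX_single Phi_simps single_add Phi_single)
    also have "\<dots> = th (mus s z) (single i m) + th (cc (s \<otimes> z)) (single i m)"
      using \<open>0 \<in> ?I\<close> by (simp add: sum.distrib mu)
    finally show ?thesis
      unfolding lhs rhs Cs_cc_Dp[OF s plus] using ns by (simp add: EE_single Phi_single Phi_simps th_simps)
  next
    case zero
    note r = Dz_sc(1)[OF s zero] and Lr = sc_L[OF s zero]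
    let ?r = "sc s z"
    have ns: "z \<notin> Dp s" using zero D_disjoint[OF s] by blast
    have "(\<Sum>\<gamma>\<in>?I. Phi (single (i + \<gamma>) (XX s \<gamma> ?n))) =
       (\<Sum>\<gamma>\<in>?I. Phi (single (i + \<gamma>) (muX s \<gamma> z m)) + th (cc z) (single (i + \<gamma>) (actM (xJ ?r \<gamma>) m)))"
      using zero ns by (intro sum.cong) (auto simp: XX_single Phi_simps single_add Phi_single)
    also have "\<dots> = th (mus s z) (single i m) + th (cc z) (lM (x_elem L xJ ?r) (single i m))"
      unfolding x_elem_def Lr additive.sum[OF biadditiveD(2)[OF biadditive_lM]] lMs
        additive.sum[OF biadditiveD(1)[OF biadditive_th]] by (simp add: sum.distrib mu)
    finally have XXs: "(\<Sum>\<gamma>\<in>?I. Phi (single (i + \<gamma>) (XX s \<gamma> ?n))) =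
        th (mus s z) (single i m) + th (cc z) (lM (x_elem L xJ ?r) (single i m))" .
    have "CJ ?r = single (- L s) (- eJ ?r) - single (L s) (eJ ?r) + x_elem L xJ ?r"
      unfolding C_elem_def jT_def Lr by (simp add: single_diff)
    then have "lM (CJ ?r) (single i m) = - single (i - L s) (actM (eJ ?r) m) - single (i + L s) (actM (eJ ?r) m)
        + lM (x_elem L xJ ?r) (single i m)"
      by (simp add: lM_simps lMs actM_simps single_uminus)
    then show ?thesis
      unfolding lhs rhs Cs_cc_Dz[OF s zero] XXs using zero
      by (simp add: EE_single Phi_single th_simps th_rmul)
  next
    case minus
    have ns: "z \<notin> Dz s" "z \<notin> Dp s" using minus D_disjoint[OF s] by blast+
    have "lM (- vv s) (single i m) = - single (i + L s) m - single (i - L s) m"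
      by (simp add: vv_def lM_simps lMs actM)
    then show ?thesis
      unfolding lhs rhs Cs_cc_Dm[OF s minus] using ns minus
      by (simp add: EE_single XX_single Phi_single Phi_simps th_simps th_rmul)
  qed
qed

text \<open>\<open>e x = x\<close> and \<open>x e = 0\<close> rest on \<open>ee_mu\<close> and
  \<open>mu_ee\<close> together with the same relations in \<open>\<Omega>\<^sub>J\<close>; the
  symmetry in \<open>\<gamma>\<close> is bar invariance of \<open>\<mu>\<close>.\<close>

lemma wgraph_rels_vanish:
  assumes r: "r \<in> wgraph_rels G S L" and n: "n \<in> HY D"
  shows "fa.pact r n = 0"
proof -
  note rel = wgraph_relations[OF wgraph_J]
  note fs = fa.pact_simps fa.pact_mult fa.pact_fgen
  have muD: "u \<in> D" if "u \<in> below z" for u z using that by (simp add: below_def)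
  consider s where "r = fE s * fE s - fE s" "s \<in> S"
    | s u where "r = fE s * fE u - fE u * fE s" "s \<in> S" "u \<in> S"
    | s \<gamma> where "r = fE s * fX s \<gamma> - fX s \<gamma>" "s \<in> S" "- L s < \<gamma>" "\<gamma> < L s"
    | s \<gamma> where "r = fX s \<gamma> * fE s" "s \<in> S" "- L s < \<gamma>" "\<gamma> < L s"
    | s \<gamma> where "r = fX s \<gamma> - fX s (- \<gamma>)" "s \<in> S" "- L s < \<gamma>" "\<gamma> < L s"
    | s u m \<gamma> where "r = lookup (alt_prod m (jT L fE fX s) (jT L fE fX u) - alt_prod m (jT L fE fX u) (jT L fE fX s)) \<gamma>"
        "s \<in> S" "u \<in> S" "m = ord (s \<otimes> u)" "m \<noteq> 0"
    using r unfolding wgraph_rels_def by blast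
  then show ?thesis
  proof cases
    case (1 s)
    have "EE s (EE s n) = EE s n"
    proof (rule HY_eqI[OF additive_comp[OF additive_EE additive_EE] additive_EE n])
      fix z m
      show "EE s (EE s (single z m)) = EE s (single z m)"
        using rel(1)[OF Dz_sc(1)[OF 1(2)], of z] actM(2)[of "eJ (sc s z)" "eJ (sc s z)" m]
        by (auto simp: EE_single EE_simps)
    qed
    then show ?thesis using 1 by (simp add: fs)
  next
    case (2 s u)
    have "EE s (EE u n) = EE u (EE s n)"
    proof (rule HY_eqI[OF additive_comp[OF additive_EE additive_EE] additive_comp[OF additive_EE additive_EE] n])
      fix z m
      have "actM (eJ (sc s z)) (actM (eJ (sc u z)) m) = actM (eJ (sc u z)) (actM (eJ (sc s z)) m)"
        if "z \<in> Dz s" "z \<in> Dz u"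
        using rel(2)[OF Dz_sc(1)[OF 2(2) that(1)] Dz_sc(1)[OF 2(3) that(2)]] actM(2) by metis
      then show "EE s (EE u (single z m)) = EE u (EE s (single z m))"
        by (auto simp: EE_single EE_simps)
    qed
    then show ?thesis using 2 by (simp add: fs)
  next
    case (3 s \<gamma>)
    have "EE s (XX s \<gamma> n) = XX s \<gamma> n"
    proof (rule HY_eqI[OF additive_comp[OF additive_EE additive_XX] additive_XX n])
      fix z and m :: 'm assume z: "z \<in> D"
      have mu: "EE s (muX s \<gamma> z m) = muX s \<gamma> z m"
        unfolding muX_def additive.sum[OF additive_EE]
      proof (rule sum.cong)
        fix u assume "u \<in> below z"
        then have u: "u \<in> D" by (rule muD)
        show "EE s (single u (actM (lookup (\<mu> s u z) \<gamma>) m)) = single u (actM (lookup (\<mu> s u z) \<gamma>) m)"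
          using 3(2) u
        proof (cases rule: D_cases)
          case plus
          then show ?thesis using mu_facts(3)[OF 3(2) u z] by (simp add: actM_simps EE_simps)
        next
          case zero
          have "lookup (ee (sc s u) * \<mu> s u z) \<gamma> = eJ (sc s u) * lookup (\<mu> s u z) \<gamma>"
            unfolding ee_def by (simp only: mult_map_scale_conv_mult[symmetric] lookup_map_0 mult_zero_right)
          then have "eJ (sc s u) * lookup (\<mu> s u z) \<gamma> = lookup (\<mu> s u z) \<gamma>"
            using ee_mu[OF 3(2) zero z] by simp
          then show ?thesis using zero by (simp add: EE_single flip: actM(2))
        next
          case minus
          then show ?thesis using D_disjoint(6)[OF 3(2) minus] by (simp add: EE_single)
        qed
      qed simp
      have sz: "EE s (single (s \<otimes> z) m) = single (s \<otimes> z) m" if "z \<in> Dp s"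
        using Dp_mult[OF 3(2) that] D_disjoint(6)[OF 3(2)] by (simp add: EE_single)
      have "EE s (single z (actM (xJ (sc s z) \<gamma>) m)) = single z (actM (xJ (sc s z) \<gamma>) m)" if "z \<in> Dz s"
        using that rel(3)[OF Dz_sc(1)[OF 3(2) that], of \<gamma>] 3 sc_L[OF 3(2) that]
        by (simp add: EE_single flip: actM(2))
      then show "EE s (XX s \<gamma> (single z m)) = XX s \<gamma> (single z m)"
        using mu sz by (simp add: XX_single EE_simps)
    qed
    then show ?thesis using 3 by (simp add: fs)
  next
    case (4 s \<gamma>)
    have "XX s \<gamma> (EE s n) = 0"
    proof (rule HY_eqI[OF additive_comp[OF additive_XX additive_EE] additive_const_0 n])
      fix z and m :: 'm assume z: "z \<in> D"
      show "XX s \<gamma> (EE s (single z m)) = 0"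
        using 4(2) z
      proof (cases rule: D_cases)
        case plus
        then show ?thesis using D_disjoint(1,2)[OF 4(2)] by (simp add: EE_single XX_simps)
      next
        case zero
        have "muX s \<gamma> z (actM (eJ (sc s z)) m) = 0"
          unfolding muX_def
        proof (rule sum.neutral, rule ballI)
          fix u assume "u \<in> below z"
          then have u: "u \<in> D" by (rule muD)
          have "lookup (\<mu> s u z * ee (sc s z)) \<gamma> = lookup (\<mu> s u z) \<gamma> * eJ (sc s z)"
          proof -
            have "additive (\<lambda>a. lookup (a * ee (sc s z)) \<gamma>)" "additive (\<lambda>a. lookup a \<gamma> * eJ (sc s z))"
              by (simp_all add: additive_def lookup_add distrib_right)
            then show ?thesis
              by (rule additive_eqI) (auto simp: ee_def mult_single lookup_single when_def)
          qed
          then have "lookup (\<mu> s u z) \<gamma> * eJ (sc s z) = 0" using mu_ee[OF 4(2) u zero] by simp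
          then show "single u (actM (lookup (\<mu> s u z) \<gamma>) (actM (eJ (sc s z)) m)) = 0"
            by (simp add: actM_simps flip: actM(2))
        qed
        moreover have "actM (xJ (sc s z) \<gamma>) (actM (eJ (sc s z)) m) = 0"
          using rel(4)[OF Dz_sc(1)[OF 4(2) zero], of \<gamma>] 4 sc_L[OF 4(2) zero]
          by (simp add: actM_simps flip: actM(2))
        ultimately show ?thesis using zero D_disjoint(4)[OF 4(2) zero] by (simp add: EE_single XX_single)
      next
        case minus
        then show ?thesis using D_disjoint(5,6)[OF 4(2) minus] by (simp add: EE_single XX_single)
      qed
    qed
    then show ?thesis using 4 by (simp add: fs)
  next
    case (5 s \<gamma>)
    have "XX s \<gamma> n = XX s (- \<gamma>) n"
    proof (rule HY_eqI[OF additive_XX additive_XX n])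
      fix z and m :: 'm assume z: "z \<in> D"
      have "lookup (\<mu> s u z) \<gamma> = lookup (\<mu> s u z) (- \<gamma>)" if "u \<in> below z" for u
        using mu_facts(4)[OF 5(2) muD[OF that] z] lookup_lbar by metis
      then have "muX s \<gamma> z m = muX s (- \<gamma>) z m" unfolding muX_def by simp
      moreover have "xJ (sc s z) \<gamma> = xJ (sc s z) (- \<gamma>)" if "z \<in> Dz s"
        using rel(5)[OF Dz_sc(1)[OF 5(2) that], of \<gamma>] 5 sc_L[OF 5(2) that] by simp
      ultimately show "XX s \<gamma> (single z m) = XX s (- \<gamma>) (single z m)" by (simp add: XX_single)
    qed
    then show ?thesis using 5 by (simp add: fs)
  next
    case (6 s u m \<gamma>)
    \<comment> \<open>The action of \<open>\<Omega>\<close> is not yet available, so the free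
      algebra is used: \<open>Phi\<close> turns products of its elements \<open>j(T_s)\<close> into
      products of the \<open>T_s\<close>, where the braid relation holds.\<close>
    have gen: "Phi (lact fa.pact (jT L fE fX s) f) = hI (t s) (Phi f)" if "s \<in> S" "f \<in> HL" for s f
      by (rule Phi_jT[OF fa.biadditive_pact]) (use that in \<open>auto simp: fa.pact_one fa.pact_fgen\<close>)
    have lf: "lact fa.pact (a * b) f = lact fa.pact a (lact fa.pact b f)" for a b f
      by (rule lact_mult[OF fa.biadditive_pact fa.pact_mult])
    have HLf: "lact fa.pact a f \<in> HL" if "f \<in> HL" for a f by (rule lact_HL[OF pact_HY that])
    have alt: "Phi (lact fa.pact (alt_prod k (jT L fE fX s) (jT L fE fX u)) f) = hI (alt_prod k (t s) (t u)) (Phi f)"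
      if "s \<in> S" "u \<in> S" "f \<in> HL" for k s u f
      using that(1,2)
    proof (induction k arbitrary: s u)
      case 0
      show ?case using lact_one[OF fa.biadditive_pact, of f] by (simp add: fa.pact_one hI_1)
    next
      case (Suc k)
      then show ?case by (simp add: lf gen HLf that(3) hI_mult)
    qed
    let ?y = "alt_prod m (jT L fE fX s) (jT L fE fX u) - alt_prod m (jT L fE fX u) (jT L fE fX s)"
    have n0: "single 0 n \<in> HL" using n by simp
    have "Phi (lact fa.pact ?y (single 0 n)) = 0"
      using alt[OF 6(2,3) n0, of m] alt[OF 6(3,2) n0, of m] hecke_braid[of s u] 6
      by (simp add: biadditive_simps[OF biadditive_lact[OF fa.biadditive_pact]] Phi_simps)
    then have zero: "lact fa.pact ?y (single 0 n) = 0" by (rule Phi_inj[OF HLf[OF n0]])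
    \<comment> \<open>As \<open>n\<close> sits in degree 0, the degree \<open>\<gamma>\<close> part
      of the result is the action of the single relator \<open>y^\<gamma>(s,u)\<close>.\<close>
    have lk: "lookup (lact fa.pact a (single 0 n)) \<gamma> = fa.pact (lookup a \<gamma>) n" for a
    proof (rule additive_eqI[of "\<lambda>a. lookup (lact fa.pact a (single 0 n)) \<gamma>" "\<lambda>a. fa.pact (lookup a \<gamma>) n"])
      show "additive (\<lambda>a. lookup (lact fa.pact a (single 0 n)) \<gamma>)" "additive (\<lambda>a. fa.pact (lookup a \<gamma>) n)"
        by (simp_all add: additive_def lookup_add fa.pact_simps biadditive_simps[OF biadditive_lact[OF fa.biadditive_pact]])
    qed (auto simp: lact_single_single[OF fa.biadditive_pact] lookup_single when_def fa.pact_simps)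
    show ?thesis using lk[of ?y] zero 6(1) by simp
  qed
qed

section \<open>Scalars from \<open>k\<close> and linearity of the canonicalisation\<close>

lemma HY_smult:
  fixes z :: 'w
  shows "biadditive (HY_smult sm :: 'k \<Rightarrow> ('w \<Rightarrow>\<^sub>0 'm) \<Rightarrow> _)" "HY_smult sm c (single z m) = single z (sm c m)"
proof -
  note sms = biadditive_simps[OF sm(1)]
  have l: "lookup (HY_smult sm c f) z = sm c (lookup f z)" for c and f :: "'w \<Rightarrow>\<^sub>0 'm" and z
    unfolding HY_smult_def by (rule lookup_map_0) (simp add: sms)
  show "biadditive (HY_smult sm :: 'k \<Rightarrow> ('w \<Rightarrow>\<^sub>0 'm) \<Rightarrow> _)"
    unfolding biadditive_def additive_def by (intro conjI allI poly_mapping_eqI) (simp_all add: l lookup_add sms)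
  show "HY_smult sm c (single z m) = single z (sm c m)"
    by (rule poly_mapping_eqI) (simp add: l lookup_single when_def sms)
qed

lemma lookup_HY_smult: "lookup (HY_smult sm c f) z = sm c (lookup f z)"
  unfolding HY_smult_def by (rule lookup_map_0) (simp add: biadditive_simps[OF sm(1)])

lemma HY_smult_HY: "n \<in> HY D \<Longrightarrow> HY_smult sm c n \<in> HY D"
  unfolding HY_iff
proof
  fix x assume "keys n \<subseteq> D" "x \<in> keys (HY_smult sm c n)"
  then have "lookup n x \<noteq> 0" using biadditive_simps(8)[OF sm(1)] by (auto simp: in_keys_iff lookup_HY_smult)
  then show "x \<in> D" using \<open>keys n \<subseteq> D\<close> by (auto simp: in_keys_iff)
qed

lemma gop_smult: "gop g (HY_smult sm c n) = HY_smult sm c (gop g n)"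
proof (rule additive_eqI[where f = n])
  note ad = biadditiveD(1)[OF HY_smult(1)]
  note sms = biadditive_simps[OF HY_smult(1)]
  show "additive (\<lambda>n. gop g (HY_smult sm c n))" by (rule additive_comp[OF additive_gop ad])
  show "additive (\<lambda>n. HY_smult sm c (gop g n))" by (rule additive_comp[OF ad additive_gop])
  fix z m
  have "muX s \<gamma> z (sm c m) = HY_smult sm c (muX s \<gamma> z m)" for s \<gamma>
    unfolding muX_def additive.sum[OF ad] by (simp add: HY_smult(2) actM(4))
  then show "gop g (HY_smult sm c (single z m)) = HY_smult sm c (gop g (single z m))"
    by (cases g) (auto simp: HY_smult(2) EE_single XX_single sms actM(4))
qed

text \<open>The vanishing relators give the action of \<open>\<Omega>\<close>. Linearity over the
  Hecke algebra is then checked on the \<open>T_s\<close> and the powers of \<open>v\<close>, and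
  spreads to the basis \<open>T_w\<close> along reduced expressions.\<close>

theorem w_induction:
  fixes e :: "'w \<Rightarrow> 'o::ring_1" and x :: "'w \<Rightarrow> int \<Rightarrow> 'o" and j :: "'h \<Rightarrow> int \<Rightarrow>\<^sub>0 'o"
  assumes Omega: "is_wgraph_algebra G S L e x" and incl: "is_hecke_inclusion G S L \<eta> t S e x j"
  shows "\<exists>act :: 'o \<Rightarrow> ('w \<Rightarrow>\<^sub>0 'm) \<Rightarrow> ('w \<Rightarrow>\<^sub>0 'm).
    is_alg_module (HY_smult sm) (HY D) act \<and>
    (\<forall>s\<in>S. \<forall>n\<in>HY D. act (e s) n = EE s n) \<and>
    (\<forall>s\<in>S. \<forall>\<gamma>. - L s < \<gamma> \<and> \<gamma> < L s \<longrightarrow> (\<forall>n\<in>HY D. act (x s \<gamma>) n = XX s \<gamma> n)) \<and>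
    (\<forall>f\<in>HL. \<forall>g\<in>HL. can (f + g) = can f + can g) \<and>
    (\<forall>a. \<forall>f\<in>HL. can (lact (HY_smult sm) a f) = kI a (can f)) \<and>
    (\<forall>h. \<forall>f\<in>HL. can (lact act (j h) f) = hI h (can f))"
proof -
  interpret om: presentation "of_int :: int \<Rightarrow> 'o" "\<lambda>g. case g of GE s \<Rightarrow> e s | GX s \<gamma> \<Rightarrow> x s \<gamma>" "wgens S L" "wgraph_rels G S L"
    by unfold_locales (use Omega in \<open>simp add: is_wgraph_algebra_def\<close>)
  interpret PS: parabolic_hecke G S L \<eta> t S
    by unfold_locales simp
  have "\<exists>act. om.is_action_on (HY D) int_scale gop act \<and>
    (\<forall>\<delta>. additive \<delta> \<longrightarrow> (\<forall>n. \<delta> (pm_restrict D n) = pm_restrict D (\<delta> n)) \<longrightarrow> (\<forall>c n. \<delta> (int_scale c n) = int_scale c (\<delta> n)) \<longrightarrow>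
       (\<forall>g n. \<delta> (gop g n) = gop g (\<delta> n)) \<longrightarrow> (\<forall>a n. act a (\<delta> n) = \<delta> (act a n)))"
  proof (rule om.action_exists[OF fa.free_action_axioms additive_pm_restrict])
    show "pm_restrict D n \<in> HY D" for n :: "'w \<Rightarrow>\<^sub>0 'm" by (simp add: HY_iff keys_pm_restrict)
    show "pm_restrict D n = n" if "n \<in> HY D" for n :: "'w \<Rightarrow>\<^sub>0 'm" using that by (simp add: HY_iff pm_restrict_id)
  qed (simp_all add: int_scale_HY gop_HY wgraph_rels_vanish)
  then obtain act :: "'o \<Rightarrow> ('w \<Rightarrow>\<^sub>0 'm) \<Rightarrow> ('w \<Rightarrow>\<^sub>0 'm)" where
    A: "om.is_action_on (HY D) int_scale gop act" and
    comm: "\<forall>\<delta>. additive \<delta> \<longrightarrow> (\<forall>n. \<delta> (pm_restrict D n) = pm_restrict D (\<delta> n)) \<longrightarrow> (\<forall>c n. \<delta> (int_scale c n) = int_scale c (\<delta> n)) \<longrightarrow>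
       (\<forall>g n. \<delta> (gop g n) = gop g (\<delta> n)) \<longrightarrow> (\<forall>a n. act a (\<delta> n) = \<delta> (act a n))"
    by (elim exE conjE) (rule that; assumption)
  note act = om.is_action_onD(1-5)[OF A] and gens = om.is_action_onD(6)[OF A]
    and comm = comm[THEN spec, THEN mp, THEN mp, THEN mp, THEN mp, THEN spec, THEN spec]
  have act_e: "act (e s) n = EE s n" if "s \<in> S" "n \<in> HY D" for s n
    using gens[of "GE s" n] that by (simp add: wgens_def)
  have act_x: "act (x s \<gamma>) n = XX s \<gamma> n" if "s \<in> S" "n \<in> HY D" "- L s < \<gamma>" "\<gamma> < L s" for s n \<gamma>
    using gens[of "GX s \<gamma>" n] that by (simp add: wgens_def)
  note smb = biadditive_simps[OF HY_smult(1)]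
  \<comment> \<open>The commutation clause of \<open>action_exists\<close>, with multiplication by
    the scalar \<open>c\<close> as \<open>\<delta>\<close>.\<close>
  have act_sm: "act a (HY_smult sm c n) = HY_smult sm c (act a n)" for a c n
  proof (rule comm)
    note ad = biadditiveD(1)[OF HY_smult(1), of c]
    show "additive (HY_smult sm c :: ('w \<Rightarrow>\<^sub>0 'm) \<Rightarrow> _)" by (rule ad)
    show "\<forall>n. HY_smult sm c (pm_restrict D n) = pm_restrict D (HY_smult sm c n)"
    proof
      fix n :: "'w \<Rightarrow>\<^sub>0 'm"
      show "HY_smult sm c (pm_restrict D n) = pm_restrict D (HY_smult sm c n)"
        by (rule additive_eqI[OF additive_comp[OF ad additive_pm_restrict] additive_comp[OF additive_pm_restrict ad]])
          (simp add: pm_restrict_single HY_smult(2) smb)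
    qed
    show "\<forall>d (n :: 'w \<Rightarrow>\<^sub>0 'm). HY_smult sm c (int_scale d n) = int_scale d (HY_smult sm c n)"
      by (intro allI additive_int_scale[OF ad])
  qed (simp add: gop_smult)
  have alg: "is_alg_module (HY_smult sm) (HY D) act"
  proof -
    have "HY_smult sm 1 n = n" "HY_smult sm (c * d) n = HY_smult sm c (HY_smult sm d n)" for c d and n :: "'w \<Rightarrow>\<^sub>0 'm"
      by (rule poly_mapping_eqI, simp add: lookup_HY_smult sm)+
    then show ?thesis
      unfolding is_alg_module_def
      using act act_sm HY_smult_HY HY_diff by (auto simp: smb biadditive_simps[OF act(1)])
  qed
  have HL_add: "f + g \<in> HL" if "f \<in> HL" "g \<in> HL" for f g
    using that HY_add by (simp add: HL_iff lookup_add)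
  have HL_sm: "lact (HY_smult sm) a f \<in> HL" if "f \<in> HL" for a f
    by (rule lact_HL[OF HY_smult_HY that])
  have HL_act: "lact act a f \<in> HL" if "f \<in> HL" for a f
    by (rule lact_HL[OF act(4) that])
  have lin_k: "Phi (lact (HY_smult sm) a f) = kI a (Phi f)" if f: "f \<in> HL" for a f
  proof (rule HL_eqI[OF _ _ f])
    show "additive (\<lambda>f. Phi (lact (HY_smult sm) a f))"
      by (rule additive_comp[OF additive_Phi biadditiveD(1)[OF biadditive_lact[OF HY_smult(1)]]])
    show "additive (\<lambda>f. kI a (Phi f))" by (rule additive_comp[OF Ind_act(3) additive_Phi])
    fix \<gamma> z and m :: 'm
    show "Phi (lact (HY_smult sm) a (single \<gamma> (single z m))) = kI a (Phi (single \<gamma> (single z m)))"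
    proof (rule additive_eqI[of "\<lambda>a. Phi (lact (HY_smult sm) a (single \<gamma> (single z m)))" "\<lambda>a. kI a (Phi (single \<gamma> (single z m)))"])
      show "additive (\<lambda>a. Phi (lact (HY_smult sm) a (single \<gamma> (single z m))))"
        by (rule additive_comp[OF additive_Phi biadditiveD(2)[OF biadditive_lact[OF HY_smult(1)]]])
      show "additive (\<lambda>a. kI a (Phi (single \<gamma> (single z m))))" by (rule biadditiveD(2)[OF biadditive_kI])
      fix k c
      show "Phi (lact (HY_smult sm) (single k c) (single \<gamma> (single z m))) = kI (single k c) (Phi (single \<gamma> (single z m)))"
        by (simp add: lact_single_single[OF HY_smult(1)] lact_single_single[OF sm(1)] HY_smult(2) Phi_single kI_th)
    qed
  qed
  \<comment> \<open>For \<open>J = S\<close> the parabolic subalgebra is everything, so the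
    multiplicativity of \<open>j\<close> in \<open>incl\<close> holds without restriction.\<close>
  have all_HS: "h \<in> hecke_parabolic G S \<eta> t S" for h
    unfolding PS.HJ_iff S_gen by (rule keys_kap)
  have j: "j (a + b) = j a + j b" "j (a * b) = j a * j b" "j (\<eta> c) = Poly_Mapping.map of_int c"
    "s \<in> S \<Longrightarrow> j (t s) = jT L e x s" for a b c s
    using incl all_HS unfolding is_hecke_inclusion_def by blast+
  note lab = biadditive_lact[OF act(1)]
  have lin_t: "Phi (lact act (j (t s)) f) = hI (t s) (Phi f)" if "s \<in> S" "f \<in> HL" for s f
    unfolding j(4)[OF that(1)] by (rule Phi_jT[OF act(1)]) (use act act_e act_x that in auto)
  have lin_eta: "Phi (lact act (j (\<eta> c)) f) = hI (\<eta> c) (Phi f)" if f: "f \<in> HL" for c f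
    unfolding j(3)
  proof (rule additive_eqI[of "\<lambda>c. Phi (lact act (Poly_Mapping.map of_int c) f)" "\<lambda>c. hI (\<eta> c) (Phi f)"])
    have ac: "additive (Poly_Mapping.map of_int :: _ \<Rightarrow> int \<Rightarrow>\<^sub>0 'o)" by (rule additive_map) (simp add: additive_def)
    show A1: "additive (\<lambda>c. Phi (lact act (Poly_Mapping.map of_int c) f))"
      by (rule additive_comp[OF additive_Phi additive_comp[OF biadditiveD(2)[OF lab] ac]])
    show A2: "additive (\<lambda>c. hI (\<eta> c) (Phi f))"
      by (rule additive_comp[OF biadditiveD(2)[OF biadditive_hI] pres.additive_eta])
    fix k d
    \<comment> \<open>Coefficients are integers here, so additivity in \<open>d\<close> reduces the
      claim to \<open>d = 1\<close>.\<close>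
    have "(\<lambda>d. Phi (lact act (Poly_Mapping.map of_int (single k d)) f)) = (\<lambda>d. hI (\<eta> (single k d)) (Phi f))"
    proof (rule additive_int_eqI[OF additive_comp[OF A1 additive_single] additive_comp[OF A2 additive_single]])
      show "Phi (lact act (Poly_Mapping.map of_int (vpow k)) f) = hI (\<eta> (vpow k)) (Phi f)"
      proof (rule HL_eqI[OF _ _ f])
        show "additive (\<lambda>f. Phi (lact act (Poly_Mapping.map of_int (vpow k)) f))"
          by (rule additive_comp[OF additive_Phi biadditiveD(1)[OF lab]])
        show "additive (\<lambda>f. hI (\<eta> (vpow k)) (Phi f))" by (rule additive_comp[OF Ind_act(1) additive_Phi])
        fix \<gamma> z and m :: 'm assume z: "z \<in> D"
        show "Phi (lact act (Poly_Mapping.map of_int (vpow k)) (single \<gamma> (single z m))) = hI (\<eta> (vpow k)) (Phi (single \<gamma> (single z m)))"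
          using z by (simp add: lact_single_single[OF act(1)] lact_single_single[OF actM(1)] act(3) actM(3) Phi_single hI_eta_th)
      qed
    qed
    then show "Phi (lact act (Poly_Mapping.map of_int (single k d)) f) = hI (\<eta> (single k d)) (Phi f)" by metis
  qed
  have lact_act: "lact act (a * b) f = lact act a (lact act b f)" for a b f
    by (rule lact_mult[OF act(1,2)])
  have lin_h: "Phi (lact act (j h) f) = hI h (Phi f)" if f: "f \<in> HL" for h f
  proof (induction h rule: hecke_induct)
    case zero
    have "j 0 = 0" using j(3)[of 0] by (simp add: additive.zero[OF pres.additive_eta] poly_mapping_eqI lookup_map_0)
    then show ?case by (simp add: biadditive_simps[OF lab] Phi_simps hI_simps)
  next
    case (add a b)
    then show ?case by (simp add: j biadditive_simps[OF lab] Phi_simps hI_simps)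
  next
    case (T w c)
    then have w: "w \<in> carrier G" using keys_kap by blast
    obtain ws where ws: "reduced_expr G S w ws" using ex_reduced[OF w] by blast
    then have lS: "ws \<in> lists S" by (simp add: reduced_expr_def)
    have "Phi (lact act (j (prod_list (map t ws))) f) = hI (prod_list (map t ws)) (Phi f)"
      using lS
    proof (induction ws rule: list.induct)
      case Nil
      show ?case using lin_eta[OF f, of 1] by (simp add: pres.eta)
    next
      case (Cons s ws)
      then show ?case by (simp add: j(2) lact_act lin_t HL_act f hI_mult)
    qed
    then show ?case
      by (simp add: T_word[OF ws] j(2) lact_act lin_eta HL_act f hI_mult)
  qed
  have "can (f + g) = can f + can g"
    if "f \<in> HL" "g \<in> HL" for f g using that HL_add by (simp add: canon_Phi Phi_simps)
  moreover have "can (lact (HY_smult sm) a f) = kI a (can f)"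
    if "f \<in> HL" for a f using that HL_sm lin_k by (simp add: canon_Phi)
  moreover have "can (lact act (j h) f) = hI h (can f)"
    if "f \<in> HL" for h f using that HL_act lin_h by (simp add: canon_Phi)
  ultimately show ?thesis
    using alg act_e act_x by (intro exI[of _ act]) auto
qed

end

theorem theorem4p5:
  fixes G :: "('w, 'q) monoid_scheme" and S J :: "'w set" and L :: "'w \<Rightarrow> int"
    and \<eta> :: "(int \<Rightarrow>\<^sub>0 int) \<Rightarrow> 'h::ring_1" and t :: "'w \<Rightarrow> 'h" and \<iota> :: "'h \<Rightarrow> 'h"
    and R :: "'w \<Rightarrow> 'w \<Rightarrow> int \<Rightarrow>\<^sub>0 int"
    and e :: "'w \<Rightarrow> 'o::ring_1" and x :: "'w \<Rightarrow> int \<Rightarrow> 'o" and j :: "'h \<Rightarrow> int \<Rightarrow>\<^sub>0 'o"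
    and eJ :: "'w \<Rightarrow> 'oj::ring_1" and xJ :: "'w \<Rightarrow> int \<Rightarrow> 'oj" and jJ :: "'h \<Rightarrow> int \<Rightarrow>\<^sub>0 'oj"
    and p :: "'w \<Rightarrow> 'w \<Rightarrow> int \<Rightarrow>\<^sub>0 'oj" and \<mu> :: "'w \<Rightarrow> 'w \<Rightarrow> 'w \<Rightarrow> int \<Rightarrow>\<^sub>0 'oj"
    and sm :: "'k::comm_ring_1 \<Rightarrow> 'm::ab_group_add \<Rightarrow> 'm" and actM :: "'oj \<Rightarrow> 'm \<Rightarrow> 'm"
    and \<tau> :: "'h \<Rightarrow> (int \<Rightarrow>\<^sub>0 'm) \<Rightarrow> 'i::ab_group_add"
    and hact :: "'h \<Rightarrow> 'i \<Rightarrow> 'i" and kact :: "(int \<Rightarrow>\<^sub>0 'k) \<Rightarrow> 'i \<Rightarrow> 'i"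
  assumes coxeter: "coxeter_system G S"
    and weight: "weight_function G S L" "\<forall>s\<in>S. L s > 0"
    and J: "J \<subseteq> S"
    and hecke: "is_hecke_algebra G S L \<eta> t"
    and Omega: "is_wgraph_algebra G S L e x"
    and Omega_J: "is_wgraph_algebra G J L eJ xJ"
    and incl: "is_hecke_inclusion G S L \<eta> t S e x j"
    and incl_J: "is_hecke_inclusion G S L \<eta> t J eJ xJ jJ"
    and bar: "is_hecke_bar S \<eta> t \<iota>"
    and R: "is_R_family G S \<eta> t \<iota> R"
    and p: "is_p_family G S J (\<lambda>u z. jJ (r_elem G S \<eta> t R J u z)) p"
    and mu: "is_mu_family G S L J eJ xJ p \<mu>"
    and M: "is_alg_module sm (UNIV :: 'm set) actM"
    and Ind: "is_induced_module (hecke_parabolic G S \<eta> t J) (\<lambda>b. lact actM (jJ b)) (lact sm)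
                \<tau> hact kact"
  shows "\<exists>act :: 'o \<Rightarrow> ('w \<Rightarrow>\<^sub>0 'm) \<Rightarrow> ('w \<Rightarrow>\<^sub>0 'm).
    is_alg_module (HY_smult sm) (HY (coset_reps G S J)) act \<and>
    (\<forall>s\<in>S. \<forall>m.
       (\<forall>z\<in>D_plus G S J s. act (e s) (Poly_Mapping.single z m) = 0) \<and>
       (\<forall>z\<in>D_zero G S J s. act (e s) (Poly_Mapping.single z m) =
          Poly_Mapping.single z (actM (eJ (sconj G s z)) m)) \<and>
       (\<forall>z\<in>D_minus G S J s. act (e s) (Poly_Mapping.single z m) = Poly_Mapping.single z m)) \<and>
    (\<forall>s\<in>S. \<forall>\<gamma>. - L s < \<gamma> \<and> \<gamma> < L s \<longrightarrow> (\<forall>m.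
       (\<forall>z\<in>D_plus G S J s. act (x s \<gamma>) (Poly_Mapping.single z m) =
          (\<Sum>u\<in>{u \<in> coset_reps G S J. bruhat_less G S u z}.
             Poly_Mapping.single u (actM (Poly_Mapping.lookup (\<mu> s u z) \<gamma>) m)) +
          (if \<gamma> = 0 then Poly_Mapping.single (s \<otimes>\<^bsub>G\<^esub> z) m else 0)) \<and>
       (\<forall>z\<in>D_zero G S J s. act (x s \<gamma>) (Poly_Mapping.single z m) =
          (\<Sum>u\<in>{u \<in> coset_reps G S J. bruhat_less G S u z}.
             Poly_Mapping.single u (actM (Poly_Mapping.lookup (\<mu> s u z) \<gamma>) m)) +
          Poly_Mapping.single z (actM (xJ (sconj G s z) \<gamma>) m)) \<and>
       (\<forall>z\<in>D_minus G S J s. act (x s \<gamma>) (Poly_Mapping.single z m) = 0))) \<and>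
    (let N = HY_laurent (coset_reps G S J); c = canon G S J t p actM \<tau> kact in
       (\<forall>f\<in>N. \<forall>g\<in>N. c (f + g) = c f + c g) \<and>
       (\<forall>a. \<forall>f\<in>N. c (lact (HY_smult sm) a f) = kact a (c f)) \<and>
       (\<forall>h. \<forall>f\<in>N. c (lact act (j h) f) = hact h (c f)))"
proof -
  interpret group G using coxeter by (rule coxeter_system_group)
  interpret cox: coxeter G S by unfold_locales (rule coxeter)
  interpret w: w_induction G S L \<eta> t J \<iota> eJ xJ jJ R p \<mu> sm actM \<tau> hact kact
    by unfold_locales (use assms in auto)
  obtain act where alg: "is_alg_module (HY_smult sm) (HY w.D) act"
    and e: "\<forall>s\<in>S. \<forall>n\<in>HY w.D. act (e s) n = w.EE s n"
    and x: "\<forall>s\<in>S. \<forall>\<gamma>. - L s < \<gamma> \<and> \<gamma> < L s \<longrightarrow> (\<forall>n\<in>HY w.D. act (x s \<gamma>) n = w.XX s \<gamma> n)"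
    and c: "\<forall>f\<in>w.HL. \<forall>g\<in>w.HL. canon G S J t p actM \<tau> kact (f + g) = canon G S J t p actM \<tau> kact f + canon G S J t p actM \<tau> kact g"
      "\<forall>a. \<forall>f\<in>w.HL. canon G S J t p actM \<tau> kact (lact (HY_smult sm) a f) = kact a (canon G S J t p actM \<tau> kact f)"
      "\<forall>h. \<forall>f\<in>w.HL. canon G S J t p actM \<tau> kact (lact act (j h) f) = hact h (canon G S J t p actM \<tau> kact f)"
    using w.w_induction[OF Omega incl] by (elim exE conjE) (rule that; assumption)
  have D: "single z m \<in> HY w.D" if "z \<in> w.Dp s \<or> z \<in> w.Dz s \<or> z \<in> w.Dm s" for s z and m :: 'm
    using that w.Dp_D w.Dz_D w.Dm_D by (intro w.HY_single) blast
  show ?thesis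
    unfolding Let_def
  proof (intro exI[of _ act] conjI ballI allI impI)
    fix s m z assume s: "s \<in> S"
    have E: "act (e s) (single z m) = w.EE s (single z m)" if "z \<in> w.Dp s \<or> z \<in> w.Dz s \<or> z \<in> w.Dm s"
      using e s D[OF that] by blast
    show "act (e s) (single z m) = 0" if "z \<in> w.Dp s"
      using E that w.D_disjoint(1,2)[OF s that] by (simp add: w.EE_single)
    show "act (e s) (single z m) = single z (actM (eJ (sconj G s z)) m)" if "z \<in> w.Dz s"
      using E that by (simp add: w.EE_single)
    show "act (e s) (single z m) = single z m" if "z \<in> w.Dm s"
      using E that w.D_disjoint(6)[OF s that] by (simp add: w.EE_single)
    fix \<gamma> assume g: "- L s < \<gamma> \<and> \<gamma> < L s"
    have X: "act (x s \<gamma>) (single z m) = w.XX s \<gamma> (single z m)" if "z \<in> w.Dp s \<or> z \<in> w.Dz s \<or> z \<in> w.Dm s"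
      using x s g D[OF that] by blast
    show "act (x s \<gamma>) (single z m) = (\<Sum>u\<in>{u \<in> w.D. bruhat_less G S u z}. single u (actM (lookup (\<mu> s u z) \<gamma>) m)) +
          (if \<gamma> = 0 then single (s \<otimes>\<^bsub>G\<^esub> z) m else 0)" if "z \<in> w.Dp s"
      using X that by (simp add: w.XX_single w.muX_def w.below_def)
    show "act (x s \<gamma>) (single z m) = (\<Sum>u\<in>{u \<in> w.D. bruhat_less G S u z}. single u (actM (lookup (\<mu> s u z) \<gamma>) m)) +
          single z (actM (xJ (sconj G s z) \<gamma>) m)" if "z \<in> w.Dz s"
      using X that w.D_disjoint(4)[OF s that] by (simp add: w.XX_single w.muX_def w.below_def)
    show "act (x s \<gamma>) (single z m) = 0" if "z \<in> w.Dm s"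
      using X that w.D_disjoint(5,6)[OF s that] by (simp add: w.XX_single)
  qed (use alg c in auto)
qed

end
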